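(* Let $M^3\subset\mathbb{R}^4$ be a rotated translational hypersurface whose profile is a curve, considered on an open set where $H_3\neq 0$. Then the second mean curvature of $M^3$ vanishes, $H_2=0$, if and only if there exist constants $C_1>0$ and $C_2\in\mathbb{R}$ such that $M^3$ can be (locally) parametrized by one of the following: (i) $X:U_1\subseteq\mathbb{R}^3\to M^3$, where $U_1=\{(u,v,\theta)\,:\,1+C_1^2K\sec^4\theta\neq 0\}$, $$X(u,v,\theta)=Y(u,v)+C_1\sec^2\theta\,N^Y(u,v)+\big(C_2+2C_1\tan\theta\big)e_4,$$ where $Y$ is a minimal surface in $\mathbb{R}^3$ with Gauss map $N^Y$ and $K$ denotes the Gaussian curvature of $Y$; (ii) $X:U_2\subseteq\mathbb{R}^3\to M^3$, where $U_2=\{(u,v,\theta)\,:\,C_1\sec^2\theta\neq 0\}$, $$X(u,v,\theta)=\frac{C_1\sec^2\theta}{r}\,Y(u,v)+\big(C_2+2C_1\tan\theta\big)e_4,$$ where $Y$ is (a local parametrization of) the sphere $S^2(r)\subset\mathbb{R}^3$ of radius $r$ centered at the origin, with Gauss map $N^Y=\frac{1}{r}Y$. In both cases $\theta\in\left(-\frac{\pi}{2},\frac{\pi}{2}\right)$.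
   Context: For a hypersurface of dimension $m$ with principal curvatures $\kappa_1,\dots,\kappa_m$, $H_r=\binom{m}{r}^{-1}\sum_{i_1<\dots<i_r}\kappa_{i_1}\cdots\kappa_{i_r}$ is the $r$-mean curvature. A rotated translational hypersurface $M^3\subset\mathbb{R}^4$ whose profile is a curve is, up to a rigid motion of $\mathbb{R}^4$ and locally, a hypersurface parametrized by $$X(u,w)=Y(u)+Z_1(w)N^Y(u)+Z_2(w)e_4,$$ where $\{e_1,\dots,e_4\}$ is the canonical basis, $Y:U\subset\mathbb{R}^2\to\mathbb{R}^3=\mathrm{span}\{e_1,e_2,e_3\}$ is an immersed surface (the directrix) with Gauss map $N^Y$ and principal curvatures $\kappa_1,\kappa_2$, $Z=(Z_1,Z_2)$ is a regular plane curve (the profile, in $\mathrm{span}\{e_1,e_4\}$), and $1-Z_1\kappa_i\neq 0$ for $i=1,2$. "Can be parametrized" is understood locally and up to rigid motion.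
   Formalization: In case (i) the local parametrization is asserted near every point of a dense open subset of M (M connected), since it can fail at points where two principal curvatures coincide (branch points of the minimal surface Y). *)

theory Defs
  imports "HOL-Analysis.Analysis"
begin

(* Meant for open S in finite dimension, where continuity of all directional derivatives
   up to order k is the usual C^k. *)
primrec Ck_on :: "nat \<Rightarrow> ('a::real_normed_vector \<Rightarrow> 'b::real_normed_vector) \<Rightarrow> 'a set \<Rightarrow> bool" where
  "Ck_on 0 f S = continuous_on S f"
| "Ck_on (Suc k) f S =
     ((\<forall>x\<in>S. f differentiable (at x)) \<and> (\<forall>v. Ck_on k (\<lambda>x. frechet_derivative f (at x) v) S))"

definition smooth_on :: "'a::real_normed_vector set \<Rightarrow> ('a \<Rightarrow> 'b::real_normed_vector) \<Rightarrow> bool" where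
  "smooth_on S f \<longleftrightarrow> (\<forall>k. Ck_on k f S)"

definition diffeomorphism_betw ::
  "'a::real_normed_vector set \<Rightarrow> 'b::real_normed_vector set \<Rightarrow> ('a \<Rightarrow> 'b) \<Rightarrow> bool" where
  "diffeomorphism_betw W V \<phi> \<longleftrightarrow>
     open W \<and> open V \<and> smooth_on W \<phi> \<and> \<phi> ` W = V \<and>
     (\<exists>\<psi>. smooth_on V \<psi> \<and> (\<forall>x\<in>W. \<psi> (\<phi> x) = x))"

definition rigid_motion :: "('a::euclidean_space \<Rightarrow> 'a) \<Rightarrow> bool" where
  "rigid_motion B \<longleftrightarrow> (\<exists>T a. orthogonal_transformation T \<and> B = (\<lambda>x. a + T x))"

definition immersion_on :: "'a::euclidean_space set \<Rightarrow> ('a \<Rightarrow> 'b::euclidean_space) \<Rightarrow> bool" where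
  "immersion_on U F \<longleftrightarrow>
     open U \<and> smooth_on U F \<and> (\<forall>p\<in>U. inj (frechet_derivative F (at p)))"

(* Hypersurfaces are given by immersions F of an open subset of 'a, where
   DIM('b) = DIM('a) + 1; such an F has exactly two Gauss maps on a connected set. *)
definition gauss_map_on ::
  "'a::euclidean_space set \<Rightarrow> ('a \<Rightarrow> 'b::euclidean_space) \<Rightarrow> ('a \<Rightarrow> 'b) \<Rightarrow> bool" where
  "gauss_map_on U F N \<longleftrightarrow> smooth_on U N \<and>
     (\<forall>p\<in>U. norm (N p) = 1 \<and> (\<forall>v. frechet_derivative F (at p) v \<bullet> N p = 0))"

(* The numbers k 0, ..., k (m-1), with m = DIM('a), are the eigenvalues (with multiplicity)
   of the shape operator -dN at p: there is an orthonormal basis dF(b i) of the tangent space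
   with dN(b i) = -k i dF(b i). Values of k beyond m are irrelevant. *)
definition principal_curvatures_at ::
  "('a::euclidean_space \<Rightarrow> 'b::euclidean_space) \<Rightarrow> ('a \<Rightarrow> 'b) \<Rightarrow> 'a \<Rightarrow> (nat \<Rightarrow> real) \<Rightarrow> bool" where
  "principal_curvatures_at F N p k \<longleftrightarrow>
     (\<exists>b::nat \<Rightarrow> 'a.
        (\<forall>i<DIM('a). \<forall>j<DIM('a).
           frechet_derivative F (at p) (b i) \<bullet> frechet_derivative F (at p) (b j)
             = (if i = j then 1 else 0)) \<and>
        (\<forall>i<DIM('a).
           frechet_derivative N (at p) (b i) = - (k i *\<^sub>R frechet_derivative F (at p) (b i))))"

(* Well defined because the principal curvatures are unique up to order. *)
definition r_mean_curvature ::
  "nat \<Rightarrow> ('a::euclidean_space \<Rightarrow> 'b::euclidean_space) \<Rightarrow> ('a \<Rightarrow> 'b) \<Rightarrow> 'a \<Rightarrow> real" where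
  "r_mean_curvature r F N p =
     (THE h. \<exists>k. principal_curvatures_at F N p k \<and>
        h = (\<Sum>S | S \<subseteq> {..<DIM('a)} \<and> card S = r. \<Prod>i\<in>S. k i) / real (DIM('a) choose r))"

definition gaussian_curvature ::
  "(real^2 \<Rightarrow> real^3) \<Rightarrow> (real^2 \<Rightarrow> real^3) \<Rightarrow> real^2 \<Rightarrow> real" where
  "gaussian_curvature Y N u = r_mean_curvature 2 Y N u"

definition minimal_surface_on ::
  "(real^2) set \<Rightarrow> (real^2 \<Rightarrow> real^3) \<Rightarrow> (real^2 \<Rightarrow> real^3) \<Rightarrow> bool" where
  "minimal_surface_on U Y N \<longleftrightarrow>
     immersion_on U Y \<and> gauss_map_on U Y N \<and> (\<forall>u\<in>U. r_mean_curvature 1 Y N u = 0)"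

definition sphere_parametrization_on ::
  "(real^2) set \<Rightarrow> real \<Rightarrow> (real^2 \<Rightarrow> real^3) \<Rightarrow> bool" where
  "sphere_parametrization_on U r Y \<longleftrightarrow> immersion_on U Y \<and> inj_on Y U \<and> Y ` U \<subseteq> sphere 0 r"

(* R^3 as the span of the first three canonical vectors of R^4 *)
definition emb :: "real^3 \<Rightarrow> real^4" where
  "emb y = (y $ 1) *\<^sub>R axis 1 1 + (y $ 2) *\<^sub>R axis 2 1 + (y $ 3) *\<^sub>R axis 3 1"

definition e4 :: "real^4" where
  "e4 = axis 4 1"

(* D is a set of parameters (u, w), and F is the hypersurface. *)
definition rotated_translational_on ::
  "((real^2) \<times> real) set \<Rightarrow> ((real^2) \<times> real \<Rightarrow> real^4) \<Rightarrow> bool" where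
  "rotated_translational_on D F \<longleftrightarrow>
     (\<exists>(U :: (real^2) set) (I :: real set) (Y :: real^2 \<Rightarrow> real^3) (N :: real^2 \<Rightarrow> real^3)
        (Z :: real \<Rightarrow> real^2) (B :: real^4 \<Rightarrow> real^4).
        rigid_motion B \<and>
        immersion_on U Y \<and> gauss_map_on U Y N \<and>
        is_interval I \<and> immersion_on I Z \<and>
        D \<subseteq> U \<times> I \<and>
        (\<forall>(u, w)\<in>D. \<forall>k. principal_curvatures_at Y N u k \<longrightarrow>
            1 - Z w $ 1 * k 0 \<noteq> 0 \<and> 1 - Z w $ 1 * k 1 \<noteq> 0) \<and>
        (\<forall>(u, w)\<in>D. F (u, w) = B (emb (Y u) + (Z w $ 1) *\<^sub>R emb (N u) + (Z w $ 2) *\<^sub>R e4)))"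

(* X restricted to the open set W is, up to a reparametrization, the restriction of F to a
   neighbourhood of q. *)
definition parametrizes_near ::
  "'a::euclidean_space set \<Rightarrow> ('a \<Rightarrow> 'b::euclidean_space) \<Rightarrow> 'a \<Rightarrow> 'a set \<Rightarrow> ('a \<Rightarrow> 'b) \<Rightarrow> bool" where
  "parametrizes_near D F q W X \<longleftrightarrow>
     (\<exists>V \<phi>. V \<subseteq> D \<and> q \<in> V \<and> diffeomorphism_betw W V \<phi> \<and> (\<forall>x\<in>W. X x = F (\<phi> x)))"

definition sec :: "real \<Rightarrow> real" where
  "sec t = 1 / cos t"

definition minimal_type_domain ::
  "real \<Rightarrow> (real^2) set \<Rightarrow> (real^2 \<Rightarrow> real^3) \<Rightarrow> (real^2 \<Rightarrow> real^3) \<Rightarrow> ((real^2) \<times> real) set" where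
  "minimal_type_domain C1 U Y N =
     {(u, \<theta>). u \<in> U \<and> \<theta> \<in> {-pi/2<..<pi/2} \<and> 1 + C1^2 * gaussian_curvature Y N u * sec \<theta> ^ 4 \<noteq> 0}"

definition minimal_type_map ::
  "real \<Rightarrow> real \<Rightarrow> (real^2 \<Rightarrow> real^3) \<Rightarrow> (real^2 \<Rightarrow> real^3) \<Rightarrow> (real^2) \<times> real \<Rightarrow> real^4" where
  "minimal_type_map C1 C2 Y N =
     (\<lambda>(u, \<theta>). emb (Y u) + (C1 * sec \<theta> ^ 2) *\<^sub>R emb (N u) + (C2 + 2 * C1 * tan \<theta>) *\<^sub>R e4)"

definition sphere_type_domain :: "real \<Rightarrow> (real^2) set \<Rightarrow> ((real^2) \<times> real) set" where
  "sphere_type_domain C1 U = {(u, \<theta>). u \<in> U \<and> \<theta> \<in> {-pi/2<..<pi/2} \<and> C1 * sec \<theta> ^ 2 \<noteq> 0}"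

definition sphere_type_map ::
  "real \<Rightarrow> real \<Rightarrow> real \<Rightarrow> (real^2 \<Rightarrow> real^3) \<Rightarrow> (real^2) \<times> real \<Rightarrow> real^4" where
  "sphere_type_map C1 C2 r Y =
     (\<lambda>(u, \<theta>). (C1 * sec \<theta> ^ 2 / r) *\<^sub>R emb (Y u) + (C2 + 2 * C1 * tan \<theta>) *\<^sub>R e4)"

(* The local description is asked for on a dense open part G of D, not at every point.
   With Y the given directrix, H_2 = 0 makes c = (1/k_1 + 1/k_2)/2 constant, and the minimal
   surface is the parallel surface Y + c N. It is not immersed where k_1 = k_2 = 1/c, which may
   happen at isolated points of the directrix (the branch points of a minimal surface, whose
   parallel surfaces can be regular there); the hypersurface itself is regular there and
   satisfies H_2 = 0 and H_3 \<noteq> 0. *)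
definition locally_minimal_type ::
  "real \<Rightarrow> real \<Rightarrow> ((real^2) \<times> real) set \<Rightarrow> ((real^2) \<times> real \<Rightarrow> real^4) \<Rightarrow> bool" where
  "locally_minimal_type C1 C2 D F \<longleftrightarrow>
     (\<exists>B G. rigid_motion B \<and> open G \<and> G \<subseteq> D \<and> D \<subseteq> closure G \<and>
        (\<forall>q\<in>G. \<exists>U Y N W. minimal_surface_on U Y N \<and> W \<subseteq> minimal_type_domain C1 U Y N \<and>
            parametrizes_near D F q W (B \<circ> minimal_type_map C1 C2 Y N)))"

definition locally_sphere_type ::
  "real \<Rightarrow> real \<Rightarrow> ((real^2) \<times> real) set \<Rightarrow> ((real^2) \<times> real \<Rightarrow> real^4) \<Rightarrow> bool" where
  "locally_sphere_type C1 C2 D F \<longleftrightarrow>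
     (\<exists>B. rigid_motion B \<and>
        (\<forall>q\<in>D. \<exists>U r Y W. r > 0 \<and> sphere_parametrization_on U r Y \<and> W \<subseteq> sphere_type_domain C1 U \<and>
            parametrizes_near D F q W (B \<circ> sphere_type_map C1 C2 r Y)))"

end

theory Submission
  imports Defs "HOL-Complex_Analysis.Conformal_Mappings"
begin

text \<open>
  A rotated translational hypersurface with directrix \<open>Y\<close>, Gauss map \<open>N\<close> and profile
  \<open>(z\<^sub>1, z\<^sub>2)\<close> has principal curvatures proportional to \<open>k\<^sub>i / (1 - z\<^sub>1 k\<^sub>i)\<close> along the
  directrix and the curvature of the plane curve along the profile. If \<open>H\<^sub>3 \<noteq> 0\<close>, all of them are
  nonzero, and in terms of the radii \<open>1/k\<^sub>i\<close> the equation \<open>H\<^sub>2 = 0\<close> separates: with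
  \<open>c = (1/k\<^sub>0 + 1/k\<^sub>1) / 2\<close> it reads
  \<open>z\<^sub>2' (z\<^sub>1'\<^sup>2 + z\<^sub>2'\<^sup>2) = 2 (z\<^sub>1 - c) (z\<^sub>1'' z\<^sub>2' - z\<^sub>1' z\<^sub>2'')\<close>. Here \<open>c\<close> depends only on the
  point of the directrix and everything else only on the point of the profile, so \<open>c\<close> is constant
  on a connected domain. The resulting ordinary differential equation for the profile has a first
  integral, and its solutions are the parabolas
  \<open>z\<^sub>1 - c = C (1 + tan\<^sup>2 \<theta>)\<close>, \<open>z\<^sub>2 = C\<^sub>2 + 2 C tan \<theta>\<close> (\<open>profile_parabola\<close>).

  The hypersurface is then built over the parallel surface \<open>Y + c N\<close>, whose principal radii
  \<open>1/k\<^sub>i - c\<close> add up to zero. Where this surface is immersed it is minimal, and \<open>C sec\<^sup>2 \<theta>\<close> is the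
  signed distance from it; a negative \<open>C\<close> is absorbed by reversing \<open>N\<close>. Where it is not immersed, its
  differential is zero. The delicate point is the alternative on the whole domain: either the
  points with zero differential are nowhere dense, or the parallel surface is constant and the
  directrix is spherical. This is unique continuation for the trace-free relation between
  \<open>d(Y + c N)\<close> and \<open>dN\<close>: in the stereographic coordinate of the Gauss map, which is a local
  diffeomorphism because \<open>k\<^sub>0 k\<^sub>1 \<noteq> 0\<close>, the differential becomes a triple of holomorphic functions,
  and the identity theorem applies (\<open>tracefree_surface_unique_continuation\<close>).

  Conversely, both models are parabolic profiles over a surface with
  \<open>k\<^sub>0 + k\<^sub>1 + 2 c k\<^sub>0 k\<^sub>1 = 0\<close>, for which the separated equation is an identity
  (\<open>parabolic_profile_zero_curvature\<close>). Since the mean curvatures do not depend on the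
  parametrization, \<open>H\<^sub>2 = 0\<close> holds near every point that is covered by a model, and by
  continuity on the closure of the set of these points.
\<close>

section \<open>Calculus of smooth functions\<close>

abbreviation dif :: "('a::real_normed_vector \<Rightarrow> 'b::real_normed_vector) \<Rightarrow> 'a \<Rightarrow> 'a \<Rightarrow> 'b" where
  "dif f x \<equiv> frechet_derivative f (at x)"

lemma frechet_derivative_eq:
  "(f has_derivative f') (at x) \<Longrightarrow> dif f x = f'"
  by (metis frechet_derivative_at)

lemma frechet_derivative_works_at:
  "f differentiable (at x) \<Longrightarrow> (f has_derivative dif f x) (at x)"
  using frechet_derivative_works by blast

text \<open>The congruence premise is an instance of \<open>Ck_on_cong_imp\<close> on an open set; it is a premise here
  because the induction that proves \<open>Ck_on_cong_imp\<close> goes through this rule.\<close>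

lemma Ck_on_SucI:
  fixes f :: "'a::real_normed_vector \<Rightarrow> 'b::real_normed_vector"
  assumes "\<And>x. x \<in> S \<Longrightarrow> (f has_derivative f' x) (at x)"
    and "\<And>v. Ck_on k (\<lambda>x. f' x v) S"
    and cong: "\<And>g h :: 'a \<Rightarrow> 'b. (\<And>x. x \<in> S \<Longrightarrow> g x = h x) \<Longrightarrow> Ck_on k g S \<Longrightarrow> Ck_on k h S"
  shows "Ck_on (Suc k) f S"
proof -
  have "Ck_on k (\<lambda>x. dif f x v) S" for v
    by (rule cong[OF _ assms(2)[of v]]) (simp add: frechet_derivative_eq[OF assms(1)])
  then show ?thesis using assms(1) by (auto simp: differentiable_def)
qed

lemma Ck_on_cong_imp:
  assumes "open S"
  shows "(\<And>x. x \<in> S \<Longrightarrow> f x = g x) \<Longrightarrow> Ck_on k f S \<Longrightarrow> Ck_on k g S"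
proof (induction k arbitrary: f g)
  case 0
  then show ?case by (simp cong: continuous_on_cong)
next
  case (Suc k)
  have d: "(g has_derivative dif f x) (at x)" if "x \<in> S" for x
    by (rule has_derivative_transform_within_open[OF frechet_derivative_works_at \<open>open S\<close> that])
      (use Suc.prems that in auto)
  show ?case
  proof (rule Ck_on_SucI[OF d])
    show "Ck_on k (\<lambda>x. dif f x v) S" for v using Suc.prems(2) by simp
    show "Ck_on k h S" if "\<And>x. x \<in> S \<Longrightarrow> g x = h x" "Ck_on k g S" for g h :: "'a \<Rightarrow> 'b"
      using Suc.IH[OF that] .
  qed
qed

lemma Ck_on_Suc_openI:
  assumes "open S" "\<And>x. x \<in> S \<Longrightarrow> (f has_derivative f' x) (at x)"
    and "\<And>v. Ck_on k (\<lambda>x. f' x v) S"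
  shows "Ck_on (Suc k) f S"
  by (rule Ck_on_SucI[OF assms(2,3)]) (auto intro: Ck_on_cong_imp[OF \<open>open S\<close>])

lemma Ck_on_subset: "Ck_on k f S \<Longrightarrow> T \<subseteq> S \<Longrightarrow> Ck_on k f T"
  by (induction k arbitrary: f) (auto intro: continuous_on_subset)

lemma Ck_on_SucD: "Ck_on (Suc k) f S \<Longrightarrow> Ck_on k f S"
proof (induction k arbitrary: f)
  case 0
  then show ?case
    by (auto intro!: continuous_at_imp_continuous_on differentiable_imp_continuous_within)
next
  case (Suc k)
  then show ?case by (metis Ck_on.simps(2))
qed

lemma Ck_on_const: "Ck_on k (\<lambda>x. c) S"
  by (induction k arbitrary: c) auto

lemma Ck_on_bounded_linear_compose:
  assumes "open S" "bounded_linear L"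
  shows "Ck_on k f S \<Longrightarrow> Ck_on k (\<lambda>x. L (f x)) S"
proof (induction k arbitrary: f)
  case 0
  then show ?case using assms(2) by (auto intro: bounded_linear.continuous_on)
next
  case (Suc k)
  show ?case
    by (rule Ck_on_Suc_openI[OF \<open>open S\<close>, where f' = "\<lambda>x v. L (dif f x v)"])
      (use Suc in \<open>auto intro!: bounded_linear.has_derivative[OF assms(2)] frechet_derivative_works_at\<close>)
qed

lemma Ck_on_bounded_linear:
  assumes "open S" "bounded_linear L"
  shows "Ck_on k L S"
proof (cases k)
  case 0
  then show ?thesis using assms by (auto intro: linear_continuous_on)
next
  case (Suc m)
  show ?thesis unfolding Suc
    by (rule Ck_on_Suc_openI[OF \<open>open S\<close> bounded_linear.has_derivative[OF assms(2) has_derivative_ident]])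
      (rule Ck_on_const)
qed

lemma Ck_on_add:
  assumes "open S"
  shows "Ck_on k f S \<Longrightarrow> Ck_on k g S \<Longrightarrow> Ck_on k (\<lambda>x. f x + g x) S"
proof (induction k arbitrary: f g)
  case 0
  then show ?case by (auto intro: continuous_on_add)
next
  case (Suc k)
  show ?case
    by (rule Ck_on_Suc_openI[OF \<open>open S\<close>, where f' = "\<lambda>x v. dif f x v + dif g x v"])
      (use Suc in \<open>auto intro!: has_derivative_add frechet_derivative_works_at\<close>)
qed

lemma Ck_on_bilinear:
  assumes "open S" and bil: "bounded_bilinear bp"
  shows "Ck_on k f S \<Longrightarrow> Ck_on k g S \<Longrightarrow> Ck_on k (\<lambda>x. bp (f x) (g x)) S"
proof (induction k arbitrary: f g)
  case 0
  then show ?case by (auto intro: bounded_bilinear.continuous_on[OF bil])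
next
  case (Suc k)
  have k: "Ck_on k f S" "Ck_on k g S" using Suc.prems Ck_on_SucD by blast+
  show ?case
    by (rule Ck_on_Suc_openI[OF \<open>open S\<close>, where f' = "\<lambda>x v. bp (f x) (dif g x v) + bp (dif f x v) (g x)"])
      (use Suc.prems k in \<open>auto intro!: bounded_bilinear.FDERIV[OF bil] frechet_derivative_works_at Ck_on_add[OF \<open>open S\<close>] Suc.IH\<close>)
qed

lemma Ck_on_real_SucI:
  fixes f :: "real \<Rightarrow> real"
  assumes "open S" "\<And>x. x \<in> S \<Longrightarrow> (f has_real_derivative f' x) (at x)" "Ck_on k f' S"
  shows "Ck_on (Suc k) f S"
proof (rule Ck_on_Suc_openI[OF \<open>open S\<close>])
  show "(f has_derivative (*) (f' x)) (at x)" if "x \<in> S" for x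
    using assms(2)[OF that] by (simp add: has_field_derivative_def)
  show "Ck_on k (\<lambda>x. f' x * v) S" for v
    by (rule Ck_on_bilinear[OF \<open>open S\<close> bounded_bilinear_mult assms(3) Ck_on_const])
qed

lemma Ck_on_real_compose:
  fixes f :: "real \<Rightarrow> real" and g :: "'a::real_normed_vector \<Rightarrow> real"
  assumes "open S" "g ` S \<subseteq> T"
  shows "Ck_on k f T \<Longrightarrow> Ck_on k g S \<Longrightarrow> Ck_on k (\<lambda>x. f (g x)) S"
proof (induction k arbitrary: f)
  case 0
  then show ?case using assms(2) by (auto intro: continuous_on_compose2)
next
  case (Suc k)
  have k: "Ck_on k g S" using Suc.prems Ck_on_SucD by blast
  have d: "((\<lambda>x. f (g x)) has_derivative (\<lambda>v. dif f (g x) 1 * dif g x v)) (at x)" if x: "x \<in> S" for x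
  proof -
    have f: "(f has_derivative dif f (g x)) (at (g x))"
      using Suc.prems assms(2) x by (auto intro!: frechet_derivative_works_at)
    have g: "(g has_derivative dif g x) (at x)"
      using Suc.prems x by (auto intro!: frechet_derivative_works_at)
    interpret bounded_linear "dif f (g x)" using f by (rule has_derivative_bounded_linear)
    have "dif f (g x) r = dif f (g x) 1 * r" for r
      using scaleR[of r 1] by simp
    then have "(\<lambda>v. dif f (g x) (dif g x v)) = (\<lambda>v. dif f (g x) 1 * dif g x v)" by blast
    then show ?thesis
      using has_derivative_compose[OF g f] by (simp only:)
  qed
  show ?case
  proof (rule Ck_on_Suc_openI[OF \<open>open S\<close> d])
    fix v
    have "Ck_on k (\<lambda>x. dif f (g x) 1) S"
      by (rule Suc.IH[OF _ k]) (use Suc.prems(1) in simp)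
    moreover have "Ck_on k (\<lambda>x. dif g x v) S" using Suc.prems(2) by simp
    ultimately show "Ck_on k (\<lambda>x. dif f (g x) 1 * dif g x v) S"
      by (rule Ck_on_bilinear[OF \<open>open S\<close> bounded_bilinear_mult])
  qed
qed

text \<open>If \<open>f' = g (f)\<close> with \<open>g\<close> smooth, then \<open>f\<close> gains one derivative in each round of the
  induction. Inverse functions, \<open>tan\<close> and reciprocals are all of this kind.\<close>

lemma Ck_on_autonomous_ode:
  fixes f :: "real \<Rightarrow> real"
  assumes "open S" "f ` S \<subseteq> T" "smooth_on T g"
    and "\<And>x. x \<in> S \<Longrightarrow> (f has_real_derivative g (f x)) (at x)"
  shows "smooth_on S f"
proof -
  have "Ck_on k f S" for k
  proof (induction k)
    case 0
    then show ?case using assms(4)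
      by (auto intro!: continuous_at_imp_continuous_on DERIV_isCont)
  next
    case (Suc k)
    show ?case
      by (rule Ck_on_real_SucI[OF \<open>open S\<close> assms(4)], simp)
        (rule Ck_on_real_compose[OF assms(1,2) _ Suc], use assms(3) in \<open>simp add: smooth_on_def\<close>)
  qed
  then show ?thesis by (simp add: smooth_on_def)
qed

lemma smooth_on_subset: "smooth_on S f \<Longrightarrow> T \<subseteq> S \<Longrightarrow> smooth_on T f"
  unfolding smooth_on_def by (intro allI Ck_on_subset[of _ f S T]) auto

lemma smooth_on_cong:
  "open S \<Longrightarrow> smooth_on S f \<Longrightarrow> (\<And>x. x \<in> S \<Longrightarrow> f x = g x) \<Longrightarrow> smooth_on S g"
  unfolding smooth_on_def by (intro allI Ck_on_cong_imp[of S f g]) auto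

lemma smooth_on_const: "smooth_on S (\<lambda>x. c)"
  unfolding smooth_on_def by (simp add: Ck_on_const)

lemma smooth_on_bounded_linear: "open S \<Longrightarrow> bounded_linear L \<Longrightarrow> smooth_on S L"
  unfolding smooth_on_def by (simp add: Ck_on_bounded_linear)

lemma smooth_on_bounded_linear_compose:
  "open S \<Longrightarrow> bounded_linear L \<Longrightarrow> smooth_on S f \<Longrightarrow> smooth_on S (\<lambda>x. L (f x))"
  unfolding smooth_on_def by (intro allI Ck_on_bounded_linear_compose[where L = L]) auto

lemma smooth_on_add: "open S \<Longrightarrow> smooth_on S f \<Longrightarrow> smooth_on S g \<Longrightarrow> smooth_on S (\<lambda>x. f x + g x)"
  unfolding smooth_on_def by (intro allI Ck_on_add) auto

lemma smooth_on_bilinear: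
  "open S \<Longrightarrow> bounded_bilinear bp \<Longrightarrow> smooth_on S f \<Longrightarrow> smooth_on S g \<Longrightarrow> smooth_on S (\<lambda>x. bp (f x) (g x))"
  unfolding smooth_on_def by (intro allI Ck_on_bilinear[where bp = bp]) auto

lemmas smooth_on_mult = smooth_on_bilinear[OF _ bounded_bilinear_mult]
lemmas smooth_on_cmult = smooth_on_mult[OF _ smooth_on_const]

lemma smooth_on_cscaleR: "open S \<Longrightarrow> smooth_on S f \<Longrightarrow> smooth_on S (\<lambda>x. c *\<^sub>R f x)"
  by (rule smooth_on_bounded_linear_compose[OF _ bounded_linear_scaleR_right])

lemma smooth_on_Pair:
  assumes "open S" "smooth_on S f" "smooth_on S g"
  shows "smooth_on S (\<lambda>x. (f x, g x))"
proof -
  have "smooth_on S (\<lambda>x. (f x, 0))"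
    by (rule smooth_on_bounded_linear_compose[OF assms(1) _ assms(2), of "\<lambda>x. (x, 0)"])
      (intro bounded_linear_Pair bounded_linear_ident bounded_linear_zero)
  moreover have "smooth_on S (\<lambda>x. (0, g x))"
    by (rule smooth_on_bounded_linear_compose[OF assms(1) _ assms(3), of "\<lambda>x. (0, x)"])
      (intro bounded_linear_Pair bounded_linear_ident bounded_linear_zero)
  ultimately have "smooth_on S (\<lambda>x. (f x, 0) + (0, g x))"
    by (rule smooth_on_add[OF assms(1)])
  then show ?thesis by simp
qed

lemma smooth_on_real_compose:
  fixes f :: "real \<Rightarrow> real"
  shows "open S \<Longrightarrow> g ` S \<subseteq> T \<Longrightarrow> smooth_on T f \<Longrightarrow> smooth_on S g \<Longrightarrow> smooth_on S (\<lambda>x. f (g x))"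
  unfolding smooth_on_def by (rule allI, rule Ck_on_real_compose[where T = T]) auto

lemma smooth_on_realI:
  fixes f :: "real \<Rightarrow> real"
  assumes "open S" "\<And>x. x \<in> S \<Longrightarrow> (f has_real_derivative f' x) (at x)" "smooth_on S f'"
  shows "smooth_on S f"
  unfolding smooth_on_def
proof
  fix k
  have "Ck_on k f' S" using assms(3) by (simp add: smooth_on_def)
  then show "Ck_on k f S"
    by (intro Ck_on_SucD[OF Ck_on_real_SucI[OF assms(1,2)]])
qed

lemma smooth_on_ident: "open S \<Longrightarrow> smooth_on S (\<lambda>x. x)"
  by (rule smooth_on_bounded_linear[OF _ bounded_linear_ident])

lemma smooth_on_inverse: "smooth_on (- {0::real}) inverse"
proof (rule Ck_on_autonomous_ode[where g = "\<lambda>y. (-1) * (y * y)" and T = UNIV])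
  show "smooth_on UNIV (\<lambda>y::real. (-1) * (y * y))"
    by (intro smooth_on_cmult smooth_on_mult smooth_on_ident) auto
qed (auto intro!: derivative_eq_intros simp: power2_eq_square)

lemma smooth_on_arctan: "smooth_on UNIV arctan"
proof (rule smooth_on_realI)
  show "smooth_on UNIV (\<lambda>x::real. inverse (1 + x * x))"
  proof (rule smooth_on_real_compose[OF _ _ smooth_on_inverse])
    show "smooth_on UNIV (\<lambda>x::real. 1 + x * x)"
      by (intro smooth_on_add smooth_on_const smooth_on_mult smooth_on_ident) auto
    show "range (\<lambda>x::real. 1 + x * x) \<subseteq> - {0}"
      by (auto simp: add_nonneg_eq_0_iff)
  qed auto
qed (auto intro!: derivative_eq_intros simp: power2_eq_square)

lemma smooth_on_tan: "smooth_on {-pi/2<..<pi/2} tan"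
proof (rule Ck_on_autonomous_ode[where g = "\<lambda>y. 1 + y * y" and T = UNIV])
  show "smooth_on UNIV (\<lambda>y::real. 1 + y * y)"
    by (intro smooth_on_add smooth_on_const smooth_on_mult smooth_on_ident) auto
  fix x :: real assume "x \<in> {-pi/2<..<pi/2}"
  then have "cos x \<noteq> 0" using cos_gt_zero_pi[of x] by auto
  then show "(tan has_real_derivative 1 + tan x * tan x) (at x)"
    by (auto intro!: derivative_eq_intros simp: tan_sec power_inverse simp flip: power2_eq_square)
qed auto

lemma smooth_on_has_derivative:
  "smooth_on S f \<Longrightarrow> x \<in> S \<Longrightarrow> (f has_derivative dif f x) (at x)"
  unfolding smooth_on_def by (drule spec[of _ "Suc 0"]) (auto intro: frechet_derivative_works_at)

lemma smooth_on_derivative: "smooth_on S f \<Longrightarrow> smooth_on S (\<lambda>x. dif f x v)"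
  unfolding smooth_on_def
proof
  fix k assume "\<forall>k. Ck_on k f S"
  then have "Ck_on (Suc k) f S" by blast
  then show "Ck_on k (\<lambda>x. dif f x v) S" by simp
qed

lemma smooth_on_imp_continuous_on: "smooth_on S f \<Longrightarrow> continuous_on S f"
  unfolding smooth_on_def by (drule spec[of _ 0]) simp

section \<open>Symmetry of the second derivative\<close>

text \<open>The mean value theorem in the direction \<open>a\<close>, and then in the direction \<open>b\<close>. The left-hand side
  of the equation is symmetric in \<open>a\<close> and \<open>b\<close>, which is what the next lemma exploits.\<close>

lemma second_difference_mean_value:
  fixes f :: "'a::real_normed_vector \<Rightarrow> real"
  assumes f: "\<And>y. y \<in> S \<Longrightarrow> (f has_derivative f' y) (at y)"
    and A: "\<And>y. y \<in> S \<Longrightarrow> ((\<lambda>y. f' y a) has_derivative A y) (at y)"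
    and S: "cball x (t * (norm a + norm b)) \<subseteq> S" and t: "t > 0"
  shows "\<exists>y\<in>cball x (t * (norm a + norm b)).
    f (x + t *\<^sub>R a + t *\<^sub>R b) - f (x + t *\<^sub>R a) - f (x + t *\<^sub>R b) + f x = t\<^sup>2 * A y b"
proof -
  have inB: "x + s *\<^sub>R a + r *\<^sub>R b \<in> cball x (t * (norm a + norm b))"
    if "0 \<le> s" "s \<le> t" "0 \<le> r" "r \<le> t" for s r
  proof -
    have "norm (s *\<^sub>R a + r *\<^sub>R b) \<le> s * norm a + r * norm b"
      using that by (intro order_trans[OF norm_triangle_ineq]) auto
    also have "\<dots> \<le> t * norm a + t * norm b"
      using that by (intro add_mono mult_right_mono) auto
    finally have "norm (s *\<^sub>R a + r *\<^sub>R b) \<le> t * (norm a + norm b)"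
      by (simp add: distrib_left)
    moreover have "dist x (x + s *\<^sub>R a + r *\<^sub>R b) = norm (s *\<^sub>R a + r *\<^sub>R b)"
      by (metis add.assoc add_diff_cancel_left' dist_commute dist_norm)
    ultimately show ?thesis by simp
  qed
  have fa: "((\<lambda>s. f (p + s *\<^sub>R a)) has_real_derivative f' (p + s *\<^sub>R a) a) (at s)"
    if "p + s *\<^sub>R a \<in> S" for p s
  proof -
    have "((\<lambda>s. f (p + s *\<^sub>R a)) has_derivative (\<lambda>h. f' (p + s *\<^sub>R a) (h *\<^sub>R a))) (at s)"
      by (rule has_derivative_compose[where g = f and f = "\<lambda>s. p + s *\<^sub>R a" and f' = "\<lambda>h. h *\<^sub>R a"])
        (auto intro!: derivative_eq_intros f that)
    moreover have "f' (p + s *\<^sub>R a) (h *\<^sub>R a) = f' (p + s *\<^sub>R a) a * h" for h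
      using linear_scale[OF has_derivative_linear[OF f[OF that]]] by simp
    ultimately show ?thesis by (simp add: has_field_derivative_def)
  qed
  have fb: "((\<lambda>r. f' (p + r *\<^sub>R b) a) has_real_derivative A (p + r *\<^sub>R b) b) (at r)"
    if "p + r *\<^sub>R b \<in> S" for p r
  proof -
    have "((\<lambda>r. f' (p + r *\<^sub>R b) a) has_derivative (\<lambda>h. A (p + r *\<^sub>R b) (h *\<^sub>R b))) (at r)"
      by (rule has_derivative_compose[where g = "\<lambda>y. f' y a" and f = "\<lambda>s. p + s *\<^sub>R b" and f' = "\<lambda>h. h *\<^sub>R b"])
        (auto intro!: derivative_eq_intros A that)
    moreover have "A (p + r *\<^sub>R b) (h *\<^sub>R b) = A (p + r *\<^sub>R b) b * h" for h
      using linear_scale[OF has_derivative_linear[OF A[OF that]]] by simp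
    ultimately show ?thesis by (simp add: has_field_derivative_def)
  qed
  define \<phi> where "\<phi> s = f ((x + t *\<^sub>R b) + s *\<^sub>R a) - f (x + s *\<^sub>R a)" for s
  have "\<exists>\<xi>>0. \<xi> < t \<and> \<phi> t - \<phi> 0 = (t - 0) * (f' ((x + t *\<^sub>R b) + \<xi> *\<^sub>R a) a - f' (x + \<xi> *\<^sub>R a) a)"
  proof (rule MVT2[OF t])
    fix s assume "0 \<le> s" "s \<le> t"
    then have "x + t *\<^sub>R b + s *\<^sub>R a \<in> S" "x + s *\<^sub>R a \<in> S"
      using inB[of s t] inB[of s 0] S t by (auto simp: algebra_simps)
    then show "(\<phi> has_real_derivative (f' ((x + t *\<^sub>R b) + s *\<^sub>R a) a - f' (x + s *\<^sub>R a) a)) (at s)"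
      unfolding \<phi>_def by (intro DERIV_diff fa)
  qed
  then obtain \<xi> where \<xi>: "0 < \<xi>" "\<xi> < t"
    "\<phi> t - \<phi> 0 = t * (f' ((x + t *\<^sub>R b) + \<xi> *\<^sub>R a) a - f' (x + \<xi> *\<^sub>R a) a)" by auto
  have "\<exists>\<eta>>0. \<eta> < t \<and> f' ((x + \<xi> *\<^sub>R a) + t *\<^sub>R b) a - f' ((x + \<xi> *\<^sub>R a) + 0 *\<^sub>R b) a
      = (t - 0) * A ((x + \<xi> *\<^sub>R a) + \<eta> *\<^sub>R b) b"
    by (rule MVT2[OF t fb]) (use inB \<xi> S t in auto)
  then obtain \<eta> where \<eta>: "0 < \<eta>" "\<eta> < t" 
    "f' ((x + \<xi> *\<^sub>R a) + t *\<^sub>R b) a - f' (x + \<xi> *\<^sub>R a) a = t * A ((x + \<xi> *\<^sub>R a) + \<eta> *\<^sub>R b) b" by auto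
  show ?thesis
  proof (rule bexI[OF _ inB[of \<xi> \<eta>]])
    show "f (x + t *\<^sub>R a + t *\<^sub>R b) - f (x + t *\<^sub>R a) - f (x + t *\<^sub>R b) + f x = t\<^sup>2 * A (x + \<xi> *\<^sub>R a + \<eta> *\<^sub>R b) b"
      using \<xi>(3) \<eta>(3) by (simp add: \<phi>_def power2_eq_square algebra_simps)
  qed (use \<xi> \<eta> in auto)
qed

text \<open>If the two mixed derivatives differed at \<open>x\<close>, a small second difference divided by \<open>t\<^sup>2\<close> would
  be close to both of them.\<close>

lemma second_derivative_symmetric_real:
  fixes f :: "'a::real_normed_vector \<Rightarrow> real"
  assumes f: "\<And>y. y \<in> S \<Longrightarrow> (f has_derivative f' y) (at y)"
    and A: "\<And>y. y \<in> S \<Longrightarrow> ((\<lambda>y. f' y a) has_derivative A y) (at y)"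
    and B: "\<And>y. y \<in> S \<Longrightarrow> ((\<lambda>y. f' y b) has_derivative B y) (at y)"
    and cA: "continuous_on S (\<lambda>y. A y b)" and cB: "continuous_on S (\<lambda>y. B y a)"
    and S: "open S" "x \<in> S"
  shows "A x b = B x a"
proof (rule ccontr)
  assume ne: "A x b \<noteq> B x a"
  define e where "e = \<bar>A x b - B x a\<bar> / 2"
  have e: "e > 0" using ne by (simp add: e_def)
  obtain d0 where d0: "d0 > 0" "cball x d0 \<subseteq> S" using S open_contains_cball by blast
  obtain d1 where d1: "d1 > 0" "\<And>y. y \<in> S \<Longrightarrow> dist y x < d1 \<Longrightarrow> dist (A y b) (A x b) < e"
    using cA S(2) e unfolding continuous_on_iff by metis
  obtain d2 where d2: "d2 > 0" "\<And>y. y \<in> S \<Longrightarrow> dist y x < d2 \<Longrightarrow> dist (B y a) (B x a) < e"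
    using cB S(2) e unfolding continuous_on_iff by metis
  define d where "d = min d0 (min (d1/2) (d2/2))"
  have d: "d > 0" "d \<le> d0" "d < d1" "d < d2" using d0 d1 d2 by (auto simp: d_def min_def)
  define t where "t = d / (norm a + norm b + 1)"
  have pos: "norm a + norm b + 1 > 0" by (smt (verit) norm_ge_zero)
  have t: "t > 0" using d pos by (simp add: t_def)
  have "t * (norm a + norm b) \<le> t * (norm a + norm b + 1)" using t by (intro mult_left_mono) auto
  also have "\<dots> = d" using pos by (simp add: t_def)
  finally have td: "t * (norm a + norm b) \<le> d" .
  have sub: "cball x (t * (norm a + norm b)) \<subseteq> cball x d" using td by auto
  have sub': "cball x (t * (norm a + norm b)) \<subseteq> S" "cball x (t * (norm b + norm a)) \<subseteq> S"
    using sub d0(2) subset_cball[OF d(2), of x] unfolding add.commute[of "norm b"] by blast+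
  obtain y where y: "y \<in> cball x d"
    "f (x + t *\<^sub>R a + t *\<^sub>R b) - f (x + t *\<^sub>R a) - f (x + t *\<^sub>R b) + f x = t\<^sup>2 * A y b"
    using second_difference_mean_value[OF f A sub'(1) t] sub by blast
  obtain z where z: "z \<in> cball x d"
    "f (x + t *\<^sub>R b + t *\<^sub>R a) - f (x + t *\<^sub>R b) - f (x + t *\<^sub>R a) + f x = t\<^sup>2 * B z a"
    using second_difference_mean_value[OF f B sub'(2) t] sub by (metis add.commute subsetD)
  have comm: "x + t *\<^sub>R b + t *\<^sub>R a = x + t *\<^sub>R a + t *\<^sub>R b" by (simp add: algebra_simps)
  have "t\<^sup>2 * A y b = t\<^sup>2 * B z a" using y(2) z(2) unfolding comm by linarith
  then have eq: "A y b = B z a" using t by simp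
  have "y \<in> S" "z \<in> S" using y(1) z(1) d(2) d0(2) by auto
  then have "dist (A y b) (A x b) < e" "dist (B z a) (B x a) < e"
    using d1(2)[of y] d2(2)[of z] y(1) z(1) d by (auto simp: dist_commute)
  then have "\<bar>B z a - A x b\<bar> < e" "\<bar>B z a - B x a\<bar> < e" by (simp_all add: eq dist_real_def)
  moreover have "\<bar>A x b - B x a\<bar> \<le> \<bar>B z a - A x b\<bar> + \<bar>B z a - B x a\<bar>" by arith
  ultimately show False by (simp add: e_def)
qed

text \<open>The vector-valued case follows by testing with linear functionals.\<close>

lemma smooth_on_second_derivative_symmetric:
  fixes f :: "'a::real_normed_vector \<Rightarrow> 'b::real_inner"
  assumes "smooth_on S f" "open S" "x \<in> S"
  shows "dif (\<lambda>y. dif f y a) x b = dif (\<lambda>y. dif f y b) x a"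
proof -
  have "dif (\<lambda>y. dif f y a) x b \<bullet> w = dif (\<lambda>y. dif f y b) x a \<bullet> w" for w
  proof (rule second_derivative_symmetric_real[where S = S and f = "\<lambda>y. f y \<bullet> w"
        and f' = "\<lambda>y v. dif f y v \<bullet> w" and A = "\<lambda>y v. dif (\<lambda>y. dif f y a) y v \<bullet> w"
        and B = "\<lambda>y v. dif (\<lambda>y. dif f y b) y v \<bullet> w"])
    show "continuous_on S (\<lambda>y. dif (\<lambda>y. dif f y a) y b \<bullet> w)" "continuous_on S (\<lambda>y. dif (\<lambda>y. dif f y b) y a \<bullet> w)"
      by (auto intro!: continuous_on_inner continuous_on_const smooth_on_imp_continuous_on[OF smooth_on_derivative[OF smooth_on_derivative[OF assms(1)]]])
  qed (auto intro!: has_derivative_inner_left smooth_on_has_derivative smooth_on_derivative assms)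
  then show ?thesis by (metis inner_commute vector_eq_ldot)
qed

section \<open>Local inverses\<close>

text \<open>In finite dimension, continuity of the directional derivatives is continuity in operator norm,
  the form in which the local injectivity theorem asks for it.\<close>

lemma continuous_derivative_onorm:
  fixes f' :: "'a::euclidean_space \<Rightarrow> 'a \<Rightarrow> 'b::real_normed_vector"
  assumes "open S" "a \<in> S" "\<And>x. x \<in> S \<Longrightarrow> bounded_linear (f' x)"
    and "\<And>v. continuous_on S (\<lambda>x. f' x v)" "e > 0"
  shows "\<exists>d>0. \<forall>x. dist a x < d \<longrightarrow> onorm (\<lambda>v. f' x v - f' a v) < e"
proof -
  have "continuous_on S (\<lambda>x. \<Sum>i\<in>Basis. norm (f' x i - f' a i))"
    by (intro continuous_intros assms)
  then obtain d where d: "d > 0"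
    "\<And>x. x \<in> S \<Longrightarrow> dist x a < d \<Longrightarrow> dist (\<Sum>i\<in>Basis. norm (f' x i - f' a i)) (\<Sum>i\<in>Basis. norm (f' a i - f' a i)) < e"
    using assms(2,5) unfolding continuous_on_iff by metis
  obtain d' where d': "d' > 0" "ball a d' \<subseteq> S" using assms(1,2) openE by blast
  show ?thesis
  proof (intro exI[of _ "min d d'"] conjI allI impI)
    fix x assume x: "dist a x < min d d'"
    then have xS: "x \<in> S" using d' by auto
    have "bounded_linear (\<lambda>v. f' x v - f' a v)"
      using assms(3)[OF xS] assms(3)[OF \<open>a \<in> S\<close>] by (rule bounded_linear_sub)
    then have "onorm (\<lambda>v. f' x v - f' a v) \<le> (\<Sum>i\<in>Basis. norm (f' x i - f' a i))"
      by (rule onorm_componentwise)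
    also have "\<dots> < e" using d(2)[OF xS] x by (simp add: dist_commute)
    finally show "onorm (\<lambda>v. f' x v - f' a v) < e" .
  qed (use d d' in auto)
qed

lemma smooth_immersion_locally_injective:
  fixes f :: "'a::euclidean_space \<Rightarrow> 'b::euclidean_space"
  assumes "open S" "smooth_on S f" "a \<in> S" "inj (dif f a)"
  obtains r where "r > 0" "ball a r \<subseteq> S" "inj_on f (ball a r)"
proof -
  have bl: "bounded_linear (dif f x)" if "x \<in> S" for x
    using smooth_on_has_derivative[OF assms(2) that] by (rule has_derivative_bounded_linear)
  then obtain g' where g': "linear g'" "g' \<circ> dif f a = id"
    using linear_injective_left_inverse[OF bounded_linear.linear assms(4)] assms(3) by blast
  show ?thesis
  proof (rule has_derivative_locally_injective[OF assms(3,1) linear_conv_bounded_linear[THEN iffD1, OF g'(1)]])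
    show "g' \<circ> dif f a = id" by (rule g')
    fix e :: real assume "e > 0"
    then show "\<exists>d>0. \<forall>x. dist a x < d \<longrightarrow> onorm (\<lambda>v. dif f x v - dif f a v) < e"
      by (intro continuous_derivative_onorm[OF assms(1,3) bl])
        (auto intro: smooth_on_imp_continuous_on smooth_on_derivative[OF assms(2)])
  qed (use smooth_on_has_derivative[OF assms(2)] that in auto)
qed

text \<open>Invariance of domain makes the image open and the inverse continuous; a continuous inverse is
  differentiable wherever the differential is invertible.\<close>

lemma smooth_local_inverse:
  fixes f :: "'a::euclidean_space \<Rightarrow> 'b::euclidean_space"
  assumes "open S" "smooth_on S f" "a \<in> S" "\<forall>x\<in>S. inj (dif f x)" "DIM('a) = DIM('b)"
  obtains r g where "r > 0" "ball a r \<subseteq> S" "open (f ` ball a r)" "continuous_on (f ` ball a r) g"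
    "\<forall>x\<in>ball a r. g (f x) = x"
    "\<forall>x\<in>ball a r. \<forall>g'. bounded_linear g' \<longrightarrow> g' \<circ> dif f x = id \<longrightarrow> (g has_derivative g') (at (f x))"
proof -
  obtain r where r: "r > 0" "ball a r \<subseteq> S" "inj_on f (ball a r)"
    by (rule smooth_immersion_locally_injective[OF assms(1-3) bspec[OF assms(4,3)]])
  have cont: "continuous_on (ball a r) f"
    using smooth_on_imp_continuous_on[OF smooth_on_subset[OF assms(2) r(2)]] .
  have op: "open (f ` ball a r)"
    by (rule invariance_of_domain_gen[OF open_ball cont r(3)]) (use assms(5) in simp)
  obtain g where g: "homeomorphism (ball a r) (f ` ball a r) f g"
    using invariance_of_domain_homeomorphism[OF open_ball cont _ r(3)] assms(5) by auto
  have gf: "g (f x) = x" if "x \<in> ball a r" for x using g that by (simp add: homeomorphism_def)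
  have cg: "continuous_on (f ` ball a r) g" using g by (simp add: homeomorphism_def)
  show ?thesis
  proof (rule that[OF r(1,2) op cg], use gf in blast, intro ballI allI impI)
    fix x g' assume x: "x \<in> ball a r" and g': "bounded_linear g'" "g' \<circ> dif f x = id"
    show "(g has_derivative g') (at (f x))"
    proof (rule has_derivative_inverse_basic[OF _ g' _ op])
      show "(f has_derivative dif f x) (at (g (f x)))"
        using smooth_on_has_derivative[OF assms(2)] x r(2) gf by auto
      show "continuous (at (f x)) g"
        using cg op x by (simp add: continuous_on_eq_continuous_at)
    qed (use x gf in auto)
  qed
qed

section \<open>Principal curvatures\<close>

text \<open>Inner products with the images \<open>L (b i)\<close> read off coordinates, so the vectors \<open>b i\<close> are
  independent, and there are enough of them to span.\<close>

lemma orthonormal_derivative_frame_expand: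
  fixes L :: "'a::euclidean_space \<Rightarrow> 'b::euclidean_space" and b :: "nat \<Rightarrow> 'a"
  assumes "linear L"
    and on: "\<forall>i<DIM('a). \<forall>j<DIM('a). L (b i) \<bullet> L (b j) = (if i = j then 1 else 0)"
  shows "inj_on b {..<DIM('a)}" "independent (b ` {..<DIM('a)})"
    and "x = (\<Sum>i<DIM('a). (L x \<bullet> L (b i)) *\<^sub>R b i)" and "inj L"
proof -
  let ?n = "DIM('a)"
  have coef: "L (\<Sum>i<?n. u i *\<^sub>R b i) \<bullet> L (b j) = u j" if "j < ?n" for u j
  proof -
    have "L (\<Sum>i<?n. u i *\<^sub>R b i) \<bullet> L (b j) = (\<Sum>i<?n. u i * (L (b i) \<bullet> L (b j)))"
      by (simp add: linear_sum[OF assms(1)] linear_scale[OF assms(1)] inner_sum_left)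
    also have "\<dots> = (\<Sum>i<?n. if i = j then u i else 0)"
      by (rule sum.cong) (use on that in auto)
    finally show ?thesis using that by simp
  qed
  show inj: "inj_on b {..<?n}"
  proof (rule inj_onI, rule ccontr)
    fix i j assume "i \<in> {..<?n}" "j \<in> {..<?n}" "b i = b j" "i \<noteq> j"
    then show False using on by (metis lessThan_iff zero_neq_one)
  qed
  show ind: "independent (b ` {..<?n})"
  proof (subst independent_explicit, intro conjI allI impI ballI)
    fix u v assume s: "(\<Sum>v\<in>b ` {..<?n}. u v *\<^sub>R v) = 0" and "v \<in> b ` {..<?n}"
    then obtain j where j: "j < ?n" "v = b j" by auto
    have "(\<Sum>i<?n. u (b i) *\<^sub>R b i) = 0" using s by (simp add: sum.reindex[OF inj])
    then show "u v = 0" using coef[of j "\<lambda>i. u (b i)"] j linear_0[OF assms(1)] by simp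
  qed auto
  have "dim (b ` {..<?n}) = ?n"
    using ind by (simp add: dim_eq_card_independent card_image[OF inj])
  then have span: "x \<in> span (b ` {..<?n})" for x using dim_eq_full by blast
  show ex: "x = (\<Sum>i<?n. (L x \<bullet> L (b i)) *\<^sub>R b i)" for x
  proof -
    obtain u where "x = (\<Sum>v\<in>b ` {..<?n}. u v *\<^sub>R v)"
      using span[of x] by (auto simp: span_finite)
    then have u: "x = (\<Sum>i<?n. u (b i) *\<^sub>R b i)" by (simp add: sum.reindex[OF inj])
    have "L x \<bullet> L (b j) = u (b j)" if "j < ?n" for j
      unfolding u by (rule coef[OF that])
    then show ?thesis using u by simp
  qed
  have "x = 0" if "L x = 0" for x
    using ex[of x] that by simp
  then show "inj L" using linear_injective_0[OF assms(1)] by blast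
qed

text \<open>The multiplicity of \<open>c\<close> among the principal curvatures is the dimension of an eigenspace,
  which does not mention the chosen frame; this is why the mean curvatures are well defined.\<close>

lemma principal_curvature_multiplicity:
  fixes F N :: "'a::euclidean_space \<Rightarrow> 'b::euclidean_space"
  assumes lin: "linear (dif F p)" "linear (dif N p)" and k: "principal_curvatures_at F N p k"
  shows "card {i \<in> {..<DIM('a)}. k i = c} = dim {x. dif N p x = - (c *\<^sub>R dif F p x)}"
proof -
  let ?n = "DIM('a)"
  obtain b :: "nat \<Rightarrow> 'a" where
    on: "\<forall>i<?n. \<forall>j<?n. dif F p (b i) \<bullet> dif F p (b j) = (if i = j then 1 else 0)"
    and ev: "\<forall>i<?n. dif N p (b i) = - (k i *\<^sub>R dif F p (b i))"
    using k unfolding principal_curvatures_at_def by blast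
  note frame = orthonormal_derivative_frame_expand[OF lin(1) on]
  let ?I = "{i \<in> {..<?n}. k i = c}" and ?E = "{x. dif N p x = - (c *\<^sub>R dif F p x)}"
  have "?E = span (b ` ?I)"
  proof (intro equalityI subsetI)
    fix x assume x: "x \<in> ?E"
    obtain u where u: "x = (\<Sum>i<?n. u i *\<^sub>R b i)"
      using frame(3)[of x] by (rule that[of "\<lambda>i. dif F p x \<bullet> dif F p (b i)"])
    have z: "u j *\<^sub>R b j = 0" if j: "j < ?n" "k j \<noteq> c" for j
    proof -
      have "0 = (dif N p x + c *\<^sub>R dif F p x) \<bullet> dif F p (b j)" using x by simp
      also have "dif N p x + c *\<^sub>R dif F p x = (\<Sum>i<?n. u i *\<^sub>R dif N p (b i)) + c *\<^sub>R (\<Sum>i<?n. u i *\<^sub>R dif F p (b i))"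
        unfolding u by (simp only: linear_sum[OF lin(1)] linear_sum[OF lin(2)] linear_scale[OF lin(1)] linear_scale[OF lin(2)])
      also have "\<dots> = (\<Sum>i<?n. u i *\<^sub>R (dif N p (b i) + c *\<^sub>R dif F p (b i)))"
        by (simp only: scaleR_sum_right scaleR_left_commute[of c] sum.distrib scaleR_add_right)
      also have "\<dots> \<bullet> dif F p (b j) = (\<Sum>i<?n. u i * ((dif N p (b i) + c *\<^sub>R dif F p (b i)) \<bullet> dif F p (b j)))"
        by (simp only: inner_sum_left inner_scaleR_left)
      also have "\<dots> = (\<Sum>i<?n. if i = j then u i * (c - k i) else 0)"
        by (rule sum.cong) (use on ev j in \<open>auto simp: inner_add_left algebra_simps\<close>)
      finally show ?thesis using j by simp
    qed
    have "x = (\<Sum>i\<in>?I. u i *\<^sub>R b i)"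
      unfolding u by (rule sum.mono_neutral_right) (use z in auto)
    then show "x \<in> span (b ` ?I)" by (auto intro!: span_sum span_scale intro: span_base)
  next
    have "subspace ?E"
      unfolding subspace_def
      by (auto simp: linear_0[OF lin(1)] linear_0[OF lin(2)] linear_add[OF lin(1)] linear_add[OF lin(2)]
          linear_scale[OF lin(1)] linear_scale[OF lin(2)] scaleR_add_right)
    moreover have "b ` ?I \<subseteq> ?E" using ev by auto
    ultimately have "span (b ` ?I) \<subseteq> ?E" by (intro span_minimal)
    then show "x \<in> ?E" if "x \<in> span (b ` ?I)" for x using that by (rule subsetD)
  qed
  moreover have "independent (b ` ?I)" by (rule independent_mono[OF frame(2)]) auto
  moreover have "card (b ` ?I) = card ?I"
    by (rule card_image, rule inj_on_subset[OF frame(1)]) auto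
  ultimately show ?thesis by (simp add: dim_eq_card_independent)
qed

lemma principal_curvatures_unique:
  fixes F N :: "'a::euclidean_space \<Rightarrow> 'b::euclidean_space"
  assumes "linear (dif F p)" "linear (dif N p)"
    and "principal_curvatures_at F N p k" "principal_curvatures_at F N p k'"
  obtains \<pi> where "\<pi> permutes {..<DIM('a)}" "\<forall>i<DIM('a). k i = k' (\<pi> i)"
proof -
  have "image_mset k (mset_set {..<DIM('a)}) = image_mset k' (mset_set {..<DIM('a)})"
  proof (rule multiset_eqI)
    fix c :: real
    have cnt: "count (image_mset h (mset_set {..<DIM('a)})) c = card {i \<in> {..<DIM('a)}. h i = c}" for h :: "nat \<Rightarrow> real"
      by (simp add: count_image_mset vimage_def Int_def) (metis (no_types, lifting))
    show "count (image_mset k (mset_set {..<DIM('a)})) c = count (image_mset k' (mset_set {..<DIM('a)})) c"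
      unfolding cnt principal_curvature_multiplicity[OF assms(1,2,3)]
        principal_curvature_multiplicity[OF assms(1,2,4)] ..
  qed
  then obtain \<pi> where "\<pi> permutes {..<DIM('a)}" "\<forall>i\<in>{..<DIM('a)}. k i = k' (\<pi> i)"
    by (rule image_mset_eq_implies_permutes[OF finite_lessThan])
  then show ?thesis using that by blast
qed

lemma elementary_symmetric_permute:
  assumes "\<pi> permutes {..<n}" "\<forall>i<n. k i = k' (\<pi> i)"
  shows "(\<Sum>S | S \<subseteq> {..<n} \<and> card S = r. \<Prod>i\<in>S. k i)
    = (\<Sum>S | S \<subseteq> {..<n} \<and> card S = r. \<Prod>i\<in>S. k' i :: real)"
proof (rule sum.reindex_bij_witness[where i = "\<lambda>S. inv \<pi> ` S" and j = "\<lambda>S. \<pi> ` S"])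
  note inj = permutes_inj[OF assms(1)]
  have im: "\<pi> ` S \<subseteq> {..<n}" "inv \<pi> ` S \<subseteq> {..<n}" if "S \<subseteq> {..<n}" for S
    using that permutes_in_image[OF assms(1)] permutes_in_image[OF permutes_inv[OF assms(1)]] by auto
  fix S assume S: "S \<in> {S. S \<subseteq> {..<n} \<and> card S = r}"
  show "inv \<pi> ` \<pi> ` S = S" "\<pi> ` inv \<pi> ` S = S"
    using permutes_inverses[OF assms(1)] by (auto simp: image_image)
  show "\<pi> ` S \<in> {S. S \<subseteq> {..<n} \<and> card S = r}" "inv \<pi> ` S \<in> {S. S \<subseteq> {..<n} \<and> card S = r}"
    using S im by (auto simp: card_image inj_on_subset[OF inj] inj_on_subset[OF permutes_inj[OF permutes_inv[OF assms(1)]]])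
  have "prod k' (\<pi> ` S) = (\<Prod>i\<in>S. k' (\<pi> i))"
    by (subst prod.reindex) (auto simp: inj_on_subset[OF inj])
  also have "\<dots> = prod k S" by (rule prod.cong) (use S assms(2) in auto)
  finally show "prod k' (\<pi> ` S) = prod k S" .
qed

lemma r_mean_curvature_eq:
  fixes F N :: "'a::euclidean_space \<Rightarrow> 'b::euclidean_space"
  assumes "linear (dif F p)" "linear (dif N p)" "principal_curvatures_at F N p k"
  shows "r_mean_curvature r F N p
    = (\<Sum>S | S \<subseteq> {..<DIM('a)} \<and> card S = r. \<Prod>i\<in>S. k i) / real (DIM('a) choose r)"
  unfolding r_mean_curvature_def
proof (rule the_equality)
  fix h assume "\<exists>k. principal_curvatures_at F N p k \<and>
    h = (\<Sum>S | S \<subseteq> {..<DIM('a)} \<and> card S = r. \<Prod>i\<in>S. k i) / real (DIM('a) choose r)"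
  then obtain k' where k': "principal_curvatures_at F N p k'"
    "h = (\<Sum>S | S \<subseteq> {..<DIM('a)} \<and> card S = r. \<Prod>i\<in>S. k' i) / real (DIM('a) choose r)" by blast
  obtain \<pi> where "\<pi> permutes {..<DIM('a)}" "\<forall>i<DIM('a). k' i = k (\<pi> i)"
    using principal_curvatures_unique[OF assms(1,2) k'(1) assms(3)] by blast
  then show "h = (\<Sum>S | S \<subseteq> {..<DIM('a)} \<and> card S = r. \<Prod>i\<in>S. k i) / real (DIM('a) choose r)"
    unfolding k'(2) by (simp only: elementary_symmetric_permute)
qed (use assms(3) in blast)

lemma subsets_of_card:
  "{S. S \<subseteq> {..<2::nat} \<and> card S = 1} = {{0}, {1}}"
  "{S. S \<subseteq> {..<2::nat} \<and> card S = 2} = {{0, 1}}"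
  "{S. S \<subseteq> {..<3::nat} \<and> card S = 2} = {{0, 1}, {0, 2}, {1, 2}}"
  "{S. S \<subseteq> {..<3::nat} \<and> card S = 3} = {{0, 1, 2}}"
proof -
  have 2: "{..<2::nat} = {0, 1}" and 3: "{..<3::nat} = {0, 1, 2}" by auto
  have eq: "{S. S \<subseteq> A \<and> card S = n} = {S \<in> Pow A. card S = n}" for A :: "nat set" and n by auto
  show "{S. S \<subseteq> {..<2::nat} \<and> card S = 1} = {{0}, {1}}"
    "{S. S \<subseteq> {..<2::nat} \<and> card S = 2} = {{0, 1}}"
    unfolding eq 2 by (auto simp: Pow_insert)
  show "{S. S \<subseteq> {..<3::nat} \<and> card S = 2} = {{0, 1}, {0, 2}, {1, 2}}"
    "{S. S \<subseteq> {..<3::nat} \<and> card S = 3} = {{0, 1, 2}}"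
    unfolding eq 3 by (auto simp: Pow_insert)
qed

lemma mean_curvatures_surface:
  fixes Y N :: "real^2 \<Rightarrow> real^3"
  assumes "linear (dif Y u)" "linear (dif N u)" "principal_curvatures_at Y N u k"
  shows "r_mean_curvature 1 Y N u = (k 0 + k 1) / 2" "r_mean_curvature 2 Y N u = k 0 * k 1"
proof -
  have d: "DIM(real^2) = 2" by simp
  show "r_mean_curvature 1 Y N u = (k 0 + k 1) / 2"
    unfolding r_mean_curvature_eq[OF assms] d subsets_of_card by simp
  show "r_mean_curvature 2 Y N u = k 0 * k 1"
    unfolding r_mean_curvature_eq[OF assms] d subsets_of_card by simp
qed

lemma mean_curvatures_hypersurface:
  fixes F N :: "(real^2) \<times> real \<Rightarrow> real^4"
  assumes "linear (dif F q)" "linear (dif N q)" "principal_curvatures_at F N q k"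
  shows "r_mean_curvature 2 F N q = (k 0 * k 1 + k 2 * (k 0 + k 1)) / 3"
    "r_mean_curvature 3 F N q = k 0 * k 1 * k 2"
proof -
  have d: "DIM((real^2) \<times> real) = 3" by simp
  have c: "(3::nat) choose 2 = 3" by (simp add: numeral_eq_Suc)
  show "r_mean_curvature 2 F N q = (k 0 * k 1 + k 2 * (k 0 + k 1)) / 3"
    unfolding r_mean_curvature_eq[OF assms] d subsets_of_card c
    by (simp add: doubleton_eq_iff algebra_simps)
  show "r_mean_curvature 3 F N q = k 0 * k 1 * k 2"
    unfolding r_mean_curvature_eq[OF assms] d subsets_of_card by simp
qed

text \<open>Reparametrizing by a local diffeomorphism moves the principal frame by the inverse
  differential and leaves the principal curvatures alone.\<close>

lemma principal_curvatures_reparametrize: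
  fixes F N :: "'a::euclidean_space \<Rightarrow> 'b::euclidean_space" and \<phi> \<psi> :: "'a \<Rightarrow> 'a"
  assumes F: "(F has_derivative dif F (\<phi> x)) (at (\<phi> x))" and N: "(N has_derivative dif N (\<phi> x)) (at (\<phi> x))"
    and phi: "(\<phi> has_derivative \<phi>') (at x)" and inv: "\<And>v. \<phi>' (\<psi>' v) = v"
    and k: "principal_curvatures_at F N (\<phi> x) k"
  shows "principal_curvatures_at (\<lambda>x. F (\<phi> x)) (\<lambda>x. N (\<phi> x)) x k"
proof -
  have d: "dif (\<lambda>x. F (\<phi> x)) x = (\<lambda>v. dif F (\<phi> x) (\<phi>' v))" "dif (\<lambda>x. N (\<phi> x)) x = (\<lambda>v. dif N (\<phi> x) (\<phi>' v))"
    by (rule frechet_derivative_eq, rule has_derivative_compose[OF phi F])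
      (rule frechet_derivative_eq, rule has_derivative_compose[OF phi N])
  obtain b where b:
    "\<forall>i<DIM('a). \<forall>j<DIM('a). dif F (\<phi> x) (b i) \<bullet> dif F (\<phi> x) (b j) = (if i = j then 1 else 0)"
    "\<forall>i<DIM('a). dif N (\<phi> x) (b i) = - (k i *\<^sub>R dif F (\<phi> x) (b i))"
    using k unfolding principal_curvatures_at_def by blast
  show ?thesis unfolding principal_curvatures_at_def d
    by (rule exI[of _ "\<lambda>i. \<psi>' (b i)"]) (use b in \<open>simp add: inv\<close>)
qed

section \<open>Surfaces in Euclidean three-space\<close>

lemma orthonormal_pair_expand:
  fixes P Q N x :: "real^3"
  assumes "P \<bullet> P = 1" "Q \<bullet> Q = 1" "P \<bullet> Q = 0" "P \<bullet> N = 0" "Q \<bullet> N = 0" "N \<noteq> 0" "x \<bullet> N = 0"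
  shows "x = (x \<bullet> P) *\<^sub>R P + (x \<bullet> Q) *\<^sub>R Q"
proof -
  have "P \<noteq> 0" "Q \<noteq> 0" "P \<noteq> Q" "P \<noteq> N" "Q \<noteq> N" using assms by auto
  moreover have "independent {P, Q, N}"
    by (rule pairwise_orthogonal_independent)
      (use assms calculation in \<open>auto simp: pairwise_def orthogonal_def inner_commute\<close>)
  ultimately have "dim {P, Q, N} = DIM(real^3)"
    by (simp add: dim_eq_card_independent)
  then have sp: "span {P, Q, N} = UNIV" using dim_eq_full by blast
  define z where "z = x - ((x \<bullet> P) *\<^sub>R P + (x \<bullet> Q) *\<^sub>R Q)"
  have "orthogonal z y" for y
  proof (rule orthogonal_to_span[of y "{P, Q, N}"])
    show "y \<in> span {P, Q, N}" using sp by simp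
    show "orthogonal z w" if "w \<in> {P, Q, N}" for w
      using that assms by (auto simp: z_def orthogonal_def inner_diff_left inner_diff_right inner_add_left inner_add_right inner_commute)
  qed
  then have "z = 0" using orthogonal_self by blast
  then show ?thesis by (simp add: z_def)
qed

lemma gauss_map_tangent:
  fixes Y N :: "'a::euclidean_space \<Rightarrow> 'b::euclidean_space"
  assumes "gauss_map_on U Y N" "open U" "u \<in> U"
  shows "dif N u v \<bullet> N u = 0"
proof -
  have N: "(N has_derivative dif N u) (at u)"
    using assms by (auto simp: gauss_map_on_def intro: smooth_on_has_derivative)
  have "((\<lambda>x. N x \<bullet> N x) has_derivative (\<lambda>v. N u \<bullet> dif N u v + dif N u v \<bullet> N u)) (at u)"
    by (rule has_derivative_inner[OF N N])
  moreover have "((\<lambda>x. N x \<bullet> N x) has_derivative (\<lambda>v. 0)) (at u)"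
    by (rule has_derivative_transform_within_open[OF has_derivative_const[of 1] assms(2,3)])
      (use assms(1) in \<open>auto simp: gauss_map_on_def norm_eq_1\<close>)
  ultimately have "(\<lambda>v. N u \<bullet> dif N u v + dif N u v \<bullet> N u) = (\<lambda>v. 0)"
    by (rule has_derivative_unique)
  then have "N u \<bullet> dif N u v + dif N u v \<bullet> N u = 0" by (rule fun_cong)
  then show ?thesis by (simp add: inner_commute)
qed

text \<open>Differentiating \<open>dY \<bullet> N = 0\<close> turns both sides into second derivatives of \<open>Y\<close>.\<close>

lemma second_fundamental_form_symmetric:
  fixes Y N :: "'a::euclidean_space \<Rightarrow> 'b::euclidean_space"
  assumes "smooth_on U Y" "gauss_map_on U Y N" "open U" "u \<in> U"
  shows "dif N u a \<bullet> dif Y u b = dif N u b \<bullet> dif Y u a"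
proof -
  have N: "(N has_derivative dif N u) (at u)"
    using assms by (auto simp: gauss_map_on_def intro: smooth_on_has_derivative)
  have *: "dif (\<lambda>y. dif Y y v) u w \<bullet> N u = - (dif Y u v \<bullet> dif N u w)" for v w
  proof -
    have Y: "((\<lambda>y. dif Y y v) has_derivative dif (\<lambda>y. dif Y y v) u) (at u)"
      by (rule smooth_on_has_derivative[OF smooth_on_derivative[OF assms(1)] assms(4)])
    have "((\<lambda>x. dif Y x v \<bullet> N x) has_derivative
        (\<lambda>w. dif Y u v \<bullet> dif N u w + dif (\<lambda>y. dif Y y v) u w \<bullet> N u)) (at u)"
      by (rule has_derivative_inner[OF Y N])
    moreover have "((\<lambda>x. dif Y x v \<bullet> N x) has_derivative (\<lambda>w. 0)) (at u)"
      by (rule has_derivative_transform_within_open[OF has_derivative_const[of 0] assms(3,4)])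
        (use assms(2) in \<open>auto simp: gauss_map_on_def\<close>)
    ultimately have "(\<lambda>w. dif Y u v \<bullet> dif N u w + dif (\<lambda>y. dif Y y v) u w \<bullet> N u) = (\<lambda>v. 0)"
      by (rule has_derivative_unique)
    then have "dif Y u v \<bullet> dif N u w + dif (\<lambda>y. dif Y y v) u w \<bullet> N u = 0" by (rule fun_cong)
    then show ?thesis by simp
  qed
  have "dif (\<lambda>y. dif Y y b) u a = dif (\<lambda>y. dif Y y a) u b"
    by (rule smooth_on_second_derivative_symmetric[OF assms(1,3,4)])
  then show ?thesis using *[of a b] *[of b a] by (simp add: inner_commute)
qed

text \<open>The shape operator is symmetric, so in an orthonormal basis of the tangent plane it is a
  symmetric matrix of size two, which a rotation diagonalizes.\<close>

lemma principal_curvatures_exist: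
  fixes Y N :: "real^2 \<Rightarrow> real^3"
  assumes "smooth_on U Y" "gauss_map_on U Y N" "open U" "u \<in> U" "inj (dif Y u)"
  shows "\<exists>k. principal_curvatures_at Y N u k"
proof -
  let ?Y = "dif Y u" and ?N = "dif N u"
  have lin: "linear ?Y" "linear ?N"
    using assms by (auto simp: gauss_map_on_def intro!: has_derivative_linear smooth_on_has_derivative)
  note add = linear_add[OF lin(1)] linear_add[OF lin(2)] linear_diff[OF lin(1)] linear_diff[OF lin(2)]
    linear_scale[OF lin(1)] linear_scale[OF lin(2)]
  have Y0: "?Y v = 0 \<longleftrightarrow> v = 0" for v using linear_injective_0[OF lin(1)] assms(5) linear_0[OF lin(1)] by auto
  have YN: "?Y v \<bullet> N u = 0" "N u \<noteq> 0" for v using assms(2,4) by (auto simp: gauss_map_on_def)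
  \<comment> \<open>Gram--Schmidt, transported to the tangent plane\<close>
  define a1 :: "real^2" where "a1 = (1 / norm (?Y (axis 1 1))) *\<^sub>R axis 1 1"
  define w where "w = axis 2 1 - (?Y (axis 2 1) \<bullet> ?Y a1) *\<^sub>R a1"
  define a2 where "a2 = (1 / norm (?Y w)) *\<^sub>R w"
  have ax: "axis 1 1 \<noteq> (0::real^2)" by (simp add: axis_eq_0_iff)
  have 11: "?Y a1 \<bullet> ?Y a1 = 1"
    unfolding a1_def add using Y0[of "axis 1 1"] ax by (simp add: dot_square_norm power2_eq_square)
  have "w $ 2 = 1" by (simp add: w_def a1_def axis_def)
  then have "w \<noteq> 0" by (metis zero_index zero_neq_one)
  then have w0: "?Y w \<noteq> 0" unfolding Y0 .
  have "?Y w = ?Y (axis 2 1) - (?Y (axis 2 1) \<bullet> ?Y a1) *\<^sub>R ?Y a1" unfolding w_def add ..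
  then have "?Y w \<bullet> ?Y a1 = 0" using 11 by (simp add: inner_diff_left)
  then have 12: "?Y a1 \<bullet> ?Y a2 = 0" by (simp add: a2_def add inner_commute)
  have 22: "?Y a2 \<bullet> ?Y a2 = 1"
    unfolding a2_def add using w0 by (simp add: dot_square_norm power2_eq_square)
  define p q r where "p = - (?N a1 \<bullet> ?Y a1)" and "q = - (?N a1 \<bullet> ?Y a2)" and "r = - (?N a2 \<bullet> ?Y a2)"
  have sym: "?N a2 \<bullet> ?Y a1 = - q"
    unfolding q_def using second_fundamental_form_symmetric[OF assms(1-4)] by simp
  have NN: "?N v \<bullet> N u = 0" for v by (rule gauss_map_tangent[OF assms(2-4)])
  note ex = orthonormal_pair_expand[OF 11 22 12 YN(1) YN(1) YN(2) NN]
  have N1: "?N a1 = - (p *\<^sub>R ?Y a1 + q *\<^sub>R ?Y a2)" 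
    by (subst ex) (simp add: p_def q_def)
  have N2: "?N a2 = - (q *\<^sub>R ?Y a1 + r *\<^sub>R ?Y a2)" 
    by (subst ex) (simp add: sym r_def)
  \<comment> \<open>the angle of rotation that diagonalizes the matrix \<open>[[p, q], [q, r]]\<close>\<close>
  obtain R t where t: "p - r = R * cos t" "2 * q = R * sin t"
    using polar_Ex[of "p - r" "2 * q"] by blast
  define c s where "c = cos (t/2)" and "s = sin (t/2)"
  have cs: "c * c + s * s = 1" by (simp add: c_def s_def flip: power2_eq_square)
  have ct: "cos t = c * c - s * s" "sin t = 2 * s * c"
    using cos_double[of "t/2"] sin_double[of "t/2"] by (simp_all add: c_def s_def power2_eq_square)
  have pq: "(p - r) * (2 * s * c) = 2 * q * (c * c - s * s)"
    unfolding t ct[symmetric] by simp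
  define b where "b i = (if i = 0 then c *\<^sub>R a1 + s *\<^sub>R a2 else (- s) *\<^sub>R a1 + c *\<^sub>R a2)" for i :: nat
  define k where "k i = (if i = 0 then p * c * c + 2 * q * s * c + r * s * s
    else p * s * s - 2 * q * s * c + r * c * c)" for i :: nat
  have lt2: "i < 2 \<longleftrightarrow> i = 0 \<or> i = 1" for i :: nat by auto
  have Yb: "?Y (b 0) = c *\<^sub>R ?Y a1 + s *\<^sub>R ?Y a2" "?Y (b 1) = (- s) *\<^sub>R ?Y a1 + c *\<^sub>R ?Y a2"
    using linear_scale[OF lin(1), of "- s"] by (simp_all add: b_def add del: scaleR_minus_left)
  have Nb: "?N (b 0) = c *\<^sub>R ?N a1 + s *\<^sub>R ?N a2" "?N (b 1) = (- s) *\<^sub>R ?N a1 + c *\<^sub>R ?N a2"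
    using linear_scale[OF lin(2), of "- s"] by (simp_all add: b_def add del: scaleR_minus_left)
  have e: "c * p + s * q = k 0 * c" "c * q + s * r = k 0 * s"
     "s * p - c * q = k 1 * s" "c * r - s * q = k 1 * c"
    unfolding k_def using cs pq by (simp_all, algebra+)
  have "?N (b 0) = - ((c * p + s * q) *\<^sub>R ?Y a1 + (c * q + s * r) *\<^sub>R ?Y a2)"
    unfolding Nb N1 N2 by (simp add: algebra_simps)
  then have N0': "?N (b 0) = - (k 0 *\<^sub>R ?Y (b 0))" unfolding e Yb by (simp add: algebra_simps)
  have "?N (b 1) = (s * p - c * q) *\<^sub>R ?Y a1 - (c * r - s * q) *\<^sub>R ?Y a2"
    unfolding Nb N1 N2 by (simp add: algebra_simps)
  then have N1': "?N (b 1) = - (k 1 *\<^sub>R ?Y (b 1))" unfolding e Yb by (simp add: algebra_simps)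
  have d: "DIM(real^2) = 2" by simp
  have "principal_curvatures_at Y N u k"
    unfolding principal_curvatures_at_def d lt2
  proof (rule exI[of _ b], intro conjI allI impI)
    fix i j :: nat assume "i = 0 \<or> i = 1" "j = 0 \<or> j = 1"
    then show "?Y (b i) \<bullet> ?Y (b j) = (if i = j then 1 else 0)"
      using cs 11 22 12 by (auto simp: Yb[simplified] inner_add_left inner_add_right inner_commute algebra_simps)
  next
    fix i :: nat assume "i = 0 \<or> i = 1"
    then show "?N (b i) = - (k i *\<^sub>R ?Y (b i))" using N0' N1' by auto
  qed
  then show ?thesis by blast
qed

lemma cross_of_combinations:
  "cross3 (\<alpha> *\<^sub>R P + \<beta> *\<^sub>R Q) (\<gamma> *\<^sub>R P + \<delta> *\<^sub>R Q) = (\<alpha> * \<delta> - \<beta> * \<gamma>) *\<^sub>R cross3 P Q"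
  using cross_skew[of Q P]
  by (simp add: cross_add_left cross_add_right cross_mult_left cross_mult_right algebra_simps)

text \<open>Both identities are the adjugate formulas for the shape operator: a bilinear alternating
  expression on a plane is a multiple of the area form. They express \<open>K\<close> and \<open>k\<^sub>0 + k\<^sub>1\<close> without
  reference to principal directions.\<close>

lemma gauss_map_cross_products:
  fixes Y N :: "real^2 \<Rightarrow> real^3"
  assumes lin: "linear (dif Y u)" "linear (dif N u)" and k: "principal_curvatures_at Y N u k"
  shows "cross3 (dif N u a) (dif N u c) = (k 0 * k 1) *\<^sub>R cross3 (dif Y u a) (dif Y u c)"
    and "cross3 (dif N u a) (dif Y u c) + cross3 (dif Y u a) (dif N u c)
      = - ((k 0 + k 1) *\<^sub>R cross3 (dif Y u a) (dif Y u c))"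
proof -
  obtain b :: "nat \<Rightarrow> real^2" where
    on: "\<forall>i<DIM(real^2). \<forall>j<DIM(real^2). dif Y u (b i) \<bullet> dif Y u (b j) = (if i = j then 1 else 0)"
    and ev: "\<forall>i<DIM(real^2). dif N u (b i) = - (k i *\<^sub>R dif Y u (b i))"
    using k unfolding principal_curvatures_at_def by blast
  have e: "dif N u (b 0) = - (k 0 *\<^sub>R dif Y u (b 0))" "dif N u (b 1) = - (k 1 *\<^sub>R dif Y u (b 1))"
    using ev by simp_all
  have ex: "\<exists>\<alpha> \<beta>. x = \<alpha> *\<^sub>R b 0 + \<beta> *\<^sub>R b 1" for x
  proof -
    have "x = (dif Y u x \<bullet> dif Y u (b 0)) *\<^sub>R b 0 + (dif Y u x \<bullet> dif Y u (b 1)) *\<^sub>R b 1"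
      using orthonormal_derivative_frame_expand(3)[OF lin(1) on, of x] by (simp add: numeral_2_eq_2)
    then show ?thesis by blast
  qed
  obtain \<alpha> \<beta> where a: "a = \<alpha> *\<^sub>R b 0 + \<beta> *\<^sub>R b 1" using ex by blast
  obtain \<gamma> \<delta> where c: "c = \<gamma> *\<^sub>R b 0 + \<delta> *\<^sub>R b 1" using ex by blast
  have Y: "dif Y u a = \<alpha> *\<^sub>R dif Y u (b 0) + \<beta> *\<^sub>R dif Y u (b 1)"
    "dif Y u c = \<gamma> *\<^sub>R dif Y u (b 0) + \<delta> *\<^sub>R dif Y u (b 1)"
    unfolding a c by (simp_all only: linear_add[OF lin(1)] linear_scale[OF lin(1)])
  have N: "dif N u a = (- \<alpha> * k 0) *\<^sub>R dif Y u (b 0) + (- \<beta> * k 1) *\<^sub>R dif Y u (b 1)"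
    "dif N u c = (- \<gamma> * k 0) *\<^sub>R dif Y u (b 0) + (- \<delta> * k 1) *\<^sub>R dif Y u (b 1)"
    unfolding a c linear_add[OF lin(2)] linear_scale[OF lin(2)] e by simp_all
  show "cross3 (dif N u a) (dif N u c) = (k 0 * k 1) *\<^sub>R cross3 (dif Y u a) (dif Y u c)"
    unfolding Y N cross_of_combinations by (simp add: algebra_simps)
  show "cross3 (dif N u a) (dif Y u c) + cross3 (dif Y u a) (dif N u c)
      = - ((k 0 + k 1) *\<^sub>R cross3 (dif Y u a) (dif Y u c))"
    unfolding Y N cross_of_combinations
    by (simp flip: scaleR_add_left scaleR_minus_left) (simp add: algebra_simps)
qed

section \<open>Curvatures of a rotated translational hypersurface\<close>

lemma linear_emb: "linear emb"
  by (rule linearI) (simp_all add: emb_def algebra_simps)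

lemma emb_inner [simp]: "emb x \<bullet> emb y = x \<bullet> y" "emb x \<bullet> e4 = 0" "e4 \<bullet> emb x = 0" "e4 \<bullet> e4 = 1"
  by (simp_all add: emb_def e4_def inner_vec_def sum_3 sum_4 axis_def)

lemmas emb_simps = linear_add[OF linear_emb] linear_scale[OF linear_emb] linear_0[OF linear_emb]
  linear_neg[OF linear_emb] linear_diff[OF linear_emb]

text \<open>In codimension one, the range of \<open>L\<close> and the unit normal \<open>n\<close> span the whole space, and
  \<open>m - (m \<bullet> n) n\<close> is orthogonal to both.\<close>

lemma unit_normal_unique:
  fixes L :: "'a::euclidean_space \<Rightarrow> 'b::euclidean_space"
  assumes "linear L" "inj L" "DIM('b) = Suc (DIM('a))"
    and "norm n = 1" "\<And>v. L v \<bullet> n = 0" "norm m = 1" "\<And>v. L v \<bullet> m = 0"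
  shows "m = (m \<bullet> n) *\<^sub>R n" "(m \<bullet> n)\<^sup>2 = 1"
proof -
  have nn: "n \<bullet> n = 1" "m \<bullet> m = 1" using assms(4,6) by (simp_all add: norm_eq_1)
  have "subspace (range L)" using assms(1) by (simp add: linear_subspace_image)
  then have spL: "span (range L) = range L" by (rule span_eq_iff[THEN iffD2])
  have "n \<notin> range L" using assms(5) nn by (metis imageE inner_zero_left zero_neq_one)
  then have "dim (insert n (range L)) = DIM('b)"
    using assms(3) dim_image_eq[OF assms(1), of UNIV] assms(2) by (simp add: dim_insert spL)
  then have sp: "span (insert n (range L)) = UNIV" using dim_eq_full by blast
  define z where "z = m - (m \<bullet> n) *\<^sub>R n"
  have "orthogonal z y" for y
  proof (rule orthogonal_to_span[of y "insert n (range L)"])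
    show "y \<in> span (insert n (range L))" using sp by simp
    show "orthogonal z w" if "w \<in> insert n (range L)" for w
      using that assms(5,7) nn by (auto simp: z_def orthogonal_def inner_diff_left inner_diff_right inner_commute)
  qed
  then have "z = 0" using orthogonal_self by blast
  then show eq: "m = (m \<bullet> n) *\<^sub>R n" by (simp add: z_def)
  have "m \<bullet> m = (m \<bullet> n) * (m \<bullet> n)" by (subst eq) (simp add: inner_commute)
  then show "(m \<bullet> n)\<^sup>2 = 1" using nn by (simp add: power2_eq_square)
qed

text \<open>The profile enters through explicit first and second derivatives, so that the same computation
  serves the given hypersurface, where they are derivatives of a smooth curve, and the two models,
  where they are trigonometric expressions.\<close>

locale profile_over_surface =
  fixes U :: "(real^2) set" and Y N :: "real^2 \<Rightarrow> real^3"
    and J :: "real set" and z1 z2 z1' z2' z1'' z2'' :: "real \<Rightarrow> real"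
    and W :: "((real^2) \<times> real) set" and T :: "real^4 \<Rightarrow> real^4" and t0 :: "real^4"
  assumes surface: "open U" "smooth_on U Y" "gauss_map_on U Y N" "\<And>u. u \<in> U \<Longrightarrow> inj (dif Y u)"
    and z: "\<And>w. w \<in> J \<Longrightarrow> (z1 has_real_derivative z1' w) (at w)"
      "\<And>w. w \<in> J \<Longrightarrow> (z2 has_real_derivative z2' w) (at w)"
      "\<And>w. w \<in> J \<Longrightarrow> (z1' has_real_derivative z1'' w) (at w)"
      "\<And>w. w \<in> J \<Longrightarrow> (z2' has_real_derivative z2'' w) (at w)"
      "\<And>w. w \<in> J \<Longrightarrow> (z1' w)\<^sup>2 + (z2' w)\<^sup>2 > 0"
    and dom: "open W" "W \<subseteq> U \<times> J"
    and regular: "\<And>u w k. (u, w) \<in> W \<Longrightarrow> principal_curvatures_at Y N u k \<Longrightarrow>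
      1 - z1 w * k 0 \<noteq> 0 \<and> 1 - z1 w * k 1 \<noteq> 0"
    and T: "orthogonal_transformation T"
begin

definition X :: "(real^2) \<times> real \<Rightarrow> real^4" where
  "X = (\<lambda>(u, w). t0 + T (emb (Y u) + z1 w *\<^sub>R emb (N u) + z2 w *\<^sub>R e4))"

definition len :: "real \<Rightarrow> real" where
  "len w = sqrt ((z1' w)\<^sup>2 + (z2' w)\<^sup>2)"

definition normal :: "(real^2) \<times> real \<Rightarrow> real^4" where
  "normal = (\<lambda>(u, w). T ((z2' w / len w) *\<^sub>R emb (N u) - (z1' w / len w) *\<^sub>R e4))"

text \<open>The numerator of the curvature of the plane curve \<open>(z1, z2)\<close>.\<close>

definition bending :: "real \<Rightarrow> real" where
  "bending w = z1'' w * z2' w - z1' w * z2'' w"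

lemma linT: "linear T" using T by (rule orthogonal_transformation_linear)

lemma T_inner [simp]: "T x \<bullet> T y = x \<bullet> y" using T by (simp add: orthogonal_transformation_def)

lemmas T_simps = linear_add[OF linT] linear_scale[OF linT] linear_neg[OF linT] linear_diff[OF linT]

lemma len: "w \<in> J \<Longrightarrow> len w > 0" "w \<in> J \<Longrightarrow> (len w)\<^sup>2 = (z1' w)\<^sup>2 + (z2' w)\<^sup>2"
  using z(5) by (auto simp: len_def less_imp_le)

lemma YN: 
  assumes "u \<in> U"
  shows "(Y has_derivative dif Y u) (at u)" "(N has_derivative dif N u) (at u)"
    "linear (dif Y u)" "linear (dif N u)" "dif Y u v \<bullet> N u = 0" "N u \<bullet> dif Y u v = 0" 
    "dif N u v \<bullet> N u = 0" "N u \<bullet> dif N u v = 0" "N u \<bullet> N u = 1"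
proof -
  show "(Y has_derivative dif Y u) (at u)" "(N has_derivative dif N u) (at u)"
    using surface assms by (auto simp: gauss_map_on_def intro: smooth_on_has_derivative)
  then show "linear (dif Y u)" "linear (dif N u)" by (auto intro: has_derivative_linear)
  show "dif Y u v \<bullet> N u = 0" "N u \<bullet> dif Y u v = 0" "N u \<bullet> N u = 1"
    using surface(3) assms by (auto simp: gauss_map_on_def inner_commute norm_eq_1)
  show "dif N u v \<bullet> N u = 0" "N u \<bullet> dif N u v = 0"
    using gauss_map_tangent[OF surface(3,1) assms] by (auto simp: inner_commute)
qed

lemma lift_derivative:
  assumes "(f has_derivative f') (at u)" "(g has_real_derivative g') (at w)"
  shows "((\<lambda>q. f (fst q)) has_derivative (\<lambda>p. f' (fst p))) (at (u, w))"
    "((\<lambda>q. g (snd q)) has_derivative (\<lambda>p. g' * snd p)) (at (u, w))"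
proof -
  show "((\<lambda>q. f (fst q)) has_derivative (\<lambda>p. f' (fst p))) (at (u, w))"
    by (rule has_derivative_compose[where f = fst and f' = fst and g = f])
      (use assms in \<open>auto intro!: derivative_eq_intros\<close>)
  show "((\<lambda>q. g (snd q)) has_derivative (\<lambda>p. g' * snd p)) (at (u, w))"
    by (rule has_derivative_compose[where f = snd and f' = snd and g = g])
      (use assms in \<open>auto intro!: derivative_eq_intros simp: has_field_derivative_def\<close>)
qed

lemma X_derivative:
  assumes "u \<in> U" "w \<in> J"
  shows "(X has_derivative (\<lambda>(a, s). T (emb (dif Y u a) + z1 w *\<^sub>R emb (dif N u a)
    + s *\<^sub>R (z1' w *\<^sub>R emb (N u) + z2' w *\<^sub>R e4)))) (at (u, w))"
proof -
  note blE = linear_conv_bounded_linear[THEN iffD1, OF linear_emb]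
  note blT = linear_conv_bounded_linear[THEN iffD1, OF linT]
  have "((\<lambda>q. t0 + T (emb (Y (fst q)) + z1 (snd q) *\<^sub>R emb (N (fst q)) + z2 (snd q) *\<^sub>R e4)) has_derivative
    (\<lambda>p. 0 + T ((emb (dif Y u (fst p)) + (z1 (snd (u, w)) *\<^sub>R emb (dif N u (fst p)) + (z1' w * snd p) *\<^sub>R emb (N (fst (u, w)))))
      + (z2' w * snd p) *\<^sub>R e4))) (at (u, w))"
    using assms z
    by (intro has_derivative_add has_derivative_const bounded_linear.has_derivative[OF blT]
        bounded_linear.has_derivative[OF blE] has_derivative_scaleR has_derivative_scaleR_left
        lift_derivative(1)[OF YN(1) z(1)] lift_derivative(1)[OF YN(2) z(1)]
        lift_derivative(2)[OF YN(1) z(1)] lift_derivative(2)[OF YN(1) z(2)])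
  then have "(X has_derivative
    (\<lambda>p. 0 + T ((emb (dif Y u (fst p)) + (z1 (snd (u, w)) *\<^sub>R emb (dif N u (fst p)) + (z1' w * snd p) *\<^sub>R emb (N (fst (u, w)))))
      + (z2' w * snd p) *\<^sub>R e4))) (at (u, w))"
    by (simp only: X_def case_prod_beta')
  then show ?thesis
    by (rule has_derivative_eq_rhs) (auto simp: fun_eq_iff T_simps algebra_simps)
qed

lemma normal_derivative:
  assumes "u \<in> U" "w \<in> J"
  shows "(normal has_derivative (\<lambda>(a, s). T ((z2' w / len w) *\<^sub>R emb (dif N u a)
    + s *\<^sub>R (- (bending w / (len w) ^ 3) *\<^sub>R (z1' w *\<^sub>R emb (N u) + z2' w *\<^sub>R e4))))) (at (u, w))"
proof -
  note blE = linear_conv_bounded_linear[THEN iffD1, OF linear_emb]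
  note blT = linear_conv_bounded_linear[THEN iffD1, OF linT]
  define l where "l = len w"
  have l: "l > 0" "l * l = z1' w * z1' w + z2' w * z2' w"
    using len[OF assms(2)] by (simp_all add: l_def power2_eq_square)
  have dl: "(len has_real_derivative ((z1' w * z1'' w + z2' w * z2'' w) / l)) (at w)"
  proof -
    have "((\<lambda>w. (z1' w)\<^sup>2 + (z2' w)\<^sup>2) has_real_derivative 2 * (z1' w * z1'' w + z2' w * z2'' w)) (at w)"
      using z(3,4)[OF assms(2)] by (auto intro!: derivative_eq_intros simp: algebra_simps)
    note sq = DERIV_chain2[OF DERIV_real_sqrt[OF z(5)[OF assms(2)]] this]
    have len_eq: "len = (\<lambda>w. sqrt ((z1' w)\<^sup>2 + (z2' w)\<^sup>2))" by (simp add: fun_eq_iff len_def)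
    have half: "inverse s / 2 * (2 * x) = x / s" for s x :: real
      by (metis divide_inverse mult.commute nonzero_mult_div_cancel_left times_divide_eq_right zero_neq_numeral)
    show ?thesis
      unfolding l_def len_eq by (rule DERIV_cong[OF sq half])
  qed
  have d2: "((\<lambda>w. z2' w / len w) has_real_derivative - (bending w / l ^ 3) * z1' w) (at w)"
  proof -
    have "((\<lambda>w. z2' w / len w) has_real_derivative
      (z2'' w * l - z2' w * ((z1' w * z1'' w + z2' w * z2'' w) / l)) / (l * l)) (at w)"
      using DERIV_divide[OF z(4)[OF assms(2)] dl] l by (simp add: l_def)
    moreover have "(z2'' w * l - z2' w * ((z1' w * z1'' w + z2' w * z2'' w) / l)) / (l * l)
      = (z2'' w * (l * l) - z2' w * (z1' w * z1'' w + z2' w * z2'' w)) / l ^ 3"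
      using l(1) by (simp add: field_simps power3_eq_cube)
    moreover have "z2'' w * (l * l) - z2' w * (z1' w * z1'' w + z2' w * z2'' w) = - bending w * z1' w"
      unfolding l(2) bending_def by algebra
    ultimately show ?thesis by simp
  qed
  have d1: "((\<lambda>w. z1' w / len w) has_real_derivative (bending w / l ^ 3) * z2' w) (at w)"
  proof -
    have "((\<lambda>w. z1' w / len w) has_real_derivative
      (z1'' w * l - z1' w * ((z1' w * z1'' w + z2' w * z2'' w) / l)) / (l * l)) (at w)"
      using DERIV_divide[OF z(3)[OF assms(2)] dl] l by (simp add: l_def)
    moreover have "(z1'' w * l - z1' w * ((z1' w * z1'' w + z2' w * z2'' w) / l)) / (l * l)
      = (z1'' w * (l * l) - z1' w * (z1' w * z1'' w + z2' w * z2'' w)) / l ^ 3"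
      using l(1) by (simp add: field_simps power3_eq_cube)
    moreover have "z1'' w * (l * l) - z1' w * (z1' w * z1'' w + z2' w * z2'' w) = bending w * z2' w"
      unfolding l(2) bending_def by algebra
    ultimately show ?thesis by simp
  qed
  have "((\<lambda>q. T ((z2' (snd q) / len (snd q)) *\<^sub>R emb (N (fst q)) - (z1' (snd q) / len (snd q)) *\<^sub>R e4)) has_derivative
    (\<lambda>p. T (((z2' (snd (u, w)) / len (snd (u, w))) *\<^sub>R emb (dif N u (fst p))
        + (- (bending w / l ^ 3) * z1' w * snd p) *\<^sub>R emb (N (fst (u, w))))
      - (((bending w / l ^ 3) * z2' w) * snd p) *\<^sub>R e4))) (at (u, w))"
    using assms
    by (intro has_derivative_diff bounded_linear.has_derivative[OF blT]
        bounded_linear.has_derivative[OF blE] has_derivative_scaleR has_derivative_scaleR_left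
        lift_derivative(1)[OF YN(2) z(1)] 
        lift_derivative(2)[OF YN(1) d1] lift_derivative(2)[OF YN(1) d2])
  then have "(normal has_derivative
    (\<lambda>p. T (((z2' (snd (u, w)) / len (snd (u, w))) *\<^sub>R emb (dif N u (fst p))
        + (- (bending w / l ^ 3) * z1' w * snd p) *\<^sub>R emb (N (fst (u, w))))
      - (((bending w / l ^ 3) * z2' w) * snd p) *\<^sub>R e4))) (at (u, w))"
    by (simp only: normal_def case_prod_beta')
  then show ?thesis
    by (rule has_derivative_eq_rhs) (auto simp: fun_eq_iff T_simps l_def algebra_simps)
qed

lemma normal_is_unit_normal:
  assumes "(u, w) \<in> W"
  shows "norm (normal (u, w)) = 1" "dif X (u, w) p \<bullet> normal (u, w) = 0"
proof -
  have uw: "u \<in> U" "w \<in> J" using assms dom by auto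
  note l = len[OF uw(2)]
  have "normal (u, w) \<bullet> normal (u, w) = ((z2' w)\<^sup>2 + (z1' w)\<^sup>2) / (len w)\<^sup>2"
    by (simp add: normal_def inner_diff_left inner_diff_right YN[OF uw(1)] power2_eq_square add_divide_distrib)
  also have "\<dots> = 1" unfolding l(2) using z(5)[OF uw(2)] by (subst add.commute, intro divide_self) linarith
  finally show "norm (normal (u, w)) = 1" by (simp add: norm_eq_1)
  show "dif X (u, w) p \<bullet> normal (u, w) = 0"
    using l(1)
    by (cases p) (simp add: frechet_derivative_eq[OF X_derivative[OF uw]] normal_def inner_diff_left
        inner_diff_right inner_add_left inner_add_right YN[OF uw(1)])
qed

definition curvature :: "(nat \<Rightarrow> real) \<Rightarrow> real \<Rightarrow> nat \<Rightarrow> real" where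
  "curvature k w i = (if i = 2 then bending w / len w ^ 3 else z2' w / len w * k i / (1 - z1 w * k i))"

text \<open>The principal frame consists of the principal directions of the directrix, rescaled by
  \<open>1 / (1 - z\<^sub>1 k\<^sub>i)\<close>, and the direction of the profile, whose curvature is the curvature of the
  plane curve \<open>(z1, z2)\<close>.\<close>

lemma principal_curvatures_normal:
  assumes "(u, w) \<in> W" and k: "principal_curvatures_at Y N u k"
  shows "principal_curvatures_at X normal (u, w) (curvature k w)"
proof -
  have uw: "u \<in> U" "w \<in> J" using assms dom by auto
  note l = len[OF uw(2)]
  obtain b :: "nat \<Rightarrow> real^2" where
    on: "\<forall>i<2. \<forall>j<2. dif Y u (b i) \<bullet> dif Y u (b j) = (if i = j then 1 else 0)"
    and ev: "\<forall>i<2. dif N u (b i) = - (k i *\<^sub>R dif Y u (b i))"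
    using k unfolding principal_curvatures_at_def by auto
  define d where "d i = 1 - z1 w * k i" for i
  have d: "d 0 \<noteq> 0" "d 1 \<noteq> 0" using regular[OF assms] by (simp_all add: d_def)
  define c :: "nat \<Rightarrow> (real^2) \<times> real" where
    "c i = (if i = 2 then (0, 1 / len w) else ((1 / d i) *\<^sub>R b i, 0))" for i
  have lt3: "i < 3 \<longleftrightarrow> i = 0 \<or> i = 1 \<or> i = 2" for i :: nat by auto
  note DX = frechet_derivative_eq[OF X_derivative[OF uw]] and Dn = frechet_derivative_eq[OF normal_derivative[OF uw]]
  have X01: "dif X (u, w) (c i) = T (emb (dif Y u (b i)))" if "i = 0 \<or> i = 1" for i
  proof -
    have "dif Y u ((1 / d i) *\<^sub>R b i) + z1 w *\<^sub>R dif N u ((1 / d i) *\<^sub>R b i) = (1 / d i * (1 - z1 w * k i)) *\<^sub>R dif Y u (b i)"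
      using ev that by (auto simp: linear_scale[OF YN(3)[OF uw(1)]] linear_scale[OF YN(4)[OF uw(1)]] algebra_simps)
    also have "\<dots> = dif Y u (b i)" using d that by (auto simp: d_def)
    finally have "dif Y u ((1 / d i) *\<^sub>R b i) + z1 w *\<^sub>R dif N u ((1 / d i) *\<^sub>R b i) = dif Y u (b i)" .
    moreover have "i \<noteq> 2" using that by auto
    ultimately show ?thesis unfolding DX c_def by (simp flip: emb_simps)
  qed
  have X2: "dif X (u, w) (c 2) = T ((1 / len w) *\<^sub>R (z1' w *\<^sub>R emb (N u) + z2' w *\<^sub>R e4))"
    unfolding DX c_def by (simp add: linear_0[OF YN(3)[OF uw(1)]] linear_0[OF YN(4)[OF uw(1)]] emb_simps)
  have n01: "dif normal (u, w) (c i) = - (curvature k w i *\<^sub>R dif X (u, w) (c i))" if "i = 0 \<or> i = 1" for i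
  proof -
    have "i \<noteq> 2" using that by auto
    then have "dif normal (u, w) (c i) = T ((z2' w / len w) *\<^sub>R emb (dif N u ((1 / d i) *\<^sub>R b i)))"
      unfolding Dn c_def by simp
    also have "dif N u ((1 / d i) *\<^sub>R b i) = (- (k i / d i)) *\<^sub>R dif Y u (b i)"
      using ev that by (auto simp: linear_scale[OF YN(4)[OF uw(1)]])
    finally show ?thesis unfolding X01[OF that] using \<open>i \<noteq> 2\<close>
      by (simp add: emb_simps T_simps curvature_def d_def)
  qed
  have n2: "dif normal (u, w) (c 2) = - (curvature k w 2 *\<^sub>R dif X (u, w) (c 2))"
  proof -
    have "dif normal (u, w) (c 2) = T ((1 / len w) *\<^sub>R (- (bending w / (len w) ^ 3) *\<^sub>R (z1' w *\<^sub>R emb (N u) + z2' w *\<^sub>R e4)))"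
      unfolding Dn c_def by (simp add: linear_0[OF YN(4)[OF uw(1)]] linear_0[OF linear_emb])
    then show ?thesis unfolding X2 by (simp add: T_simps curvature_def mult.commute)
  qed
  have X22: "dif X (u, w) (c 2) \<bullet> dif X (u, w) (c 2) = 1"
  proof -
    have "dif X (u, w) (c 2) \<bullet> dif X (u, w) (c 2) = ((z1' w)\<^sup>2 + (z2' w)\<^sup>2) / (len w)\<^sup>2"
      unfolding X2 by (simp add: inner_add_left inner_add_right YN(9)[OF uw(1)] power2_eq_square add_divide_distrib)
    also have "\<dots> = 1" unfolding l(2) using z(5)[OF uw(2)] by (intro divide_self) linarith
    finally show ?thesis .
  qed
  have X02: "dif X (u, w) (c i) \<bullet> dif X (u, w) (c 2) = 0" "dif X (u, w) (c 2) \<bullet> dif X (u, w) (c i) = 0"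
    if "i = 0 \<or> i = 1" for i
    unfolding X2 X01[OF that] by (simp_all add: inner_add_left inner_add_right YN(5,6)[OF uw(1)])
  have X0: "dif X (u, w) (c i) \<bullet> dif X (u, w) (c j) = (if i = j then 1 else 0)"
    if "i = 0 \<or> i = 1" "j = 0 \<or> j = 1" for i j
    unfolding X01[OF that(1)] X01[OF that(2)] using on that by auto
  have dm: "DIM((real^2) \<times> real) = 3" by simp
  show ?thesis unfolding principal_curvatures_at_def dm lt3
  proof (rule exI[of _ c], intro conjI allI impI)
    fix i j :: nat assume "i = 0 \<or> i = 1 \<or> i = 2" "j = 0 \<or> j = 1 \<or> j = 2"
    then consider "i = 0 \<or> i = 1" "j = 0 \<or> j = 1" | "i = 2" "j = 0 \<or> j = 1" | "i = 0 \<or> i = 1" "j = 2" | "i = 2" "j = 2"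
      by blast
    then show "dif X (u, w) (c i) \<bullet> dif X (u, w) (c j) = (if i = j then 1 else 0)"
      using X0 X02 X22 by cases auto
  next
    fix i :: nat assume "i = 0 \<or> i = 1 \<or> i = 2"
    then consider "i = 0 \<or> i = 1" | "i = 2" by blast
    then show "dif normal (u, w) (c i) = - (curvature k w i *\<^sub>R dif X (u, w) (c i))"
      using n01 n2 by cases blast+
  qed
qed

lemma X_immersed:
  assumes "(u, w) \<in> W"
  shows "inj (dif X (u, w))" "linear (dif X (u, w))" "linear (dif normal (u, w))"
proof -
  have uw: "u \<in> U" "w \<in> J" using assms dom by auto
  obtain k where k: "principal_curvatures_at Y N u k"
    using principal_curvatures_exist[OF surface(2,3,1) uw(1) surface(4)[OF uw(1)]] by blast
  show lin: "linear (dif X (u, w))" "linear (dif normal (u, w))"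
    using has_derivative_linear[OF X_derivative[OF uw]] has_derivative_linear[OF normal_derivative[OF uw]]
    by (simp_all add: frechet_derivative_eq[OF X_derivative[OF uw]] frechet_derivative_eq[OF normal_derivative[OF uw]])
  show "inj (dif X (u, w))"
    using principal_curvatures_normal[OF assms k] orthonormal_derivative_frame_expand(4)[OF lin(1)]
    unfolding principal_curvatures_at_def by metis
qed

text \<open>A continuous unit normal is locally the explicit one or its negative, so it has the same
  principal curvatures up to a common sign.\<close>

lemma principal_curvatures_any_normal:
  assumes q: "(u, w) \<in> W" and k: "principal_curvatures_at Y N u k"
    and F: "\<And>p. p \<in> W \<Longrightarrow> F p = X p"
    and \<eta>: "continuous_on W \<eta>" "\<And>p. p \<in> W \<Longrightarrow> norm (\<eta> p) = 1"
      "\<And>p v. p \<in> W \<Longrightarrow> dif F p v \<bullet> \<eta> p = 0"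
  obtains \<sigma> where "\<sigma>\<^sup>2 = 1" "principal_curvatures_at F \<eta> (u, w) (\<lambda>i. \<sigma> * curvature k w i)"
    "linear (dif F (u, w))" "linear (dif \<eta> (u, w))"
proof -
  have dF: "dif F p = dif X p" if p: "p \<in> W" for p
  proof -
    have "(X has_derivative dif X p) (at p)"
      using p dom differentiableI[OF X_derivative] by (cases p) (auto intro!: frechet_derivative_works_at)
    then have "(F has_derivative dif X p) (at p)"
      by (rule has_derivative_transform_within_open[OF _ dom(1) p]) (simp add: F)
    then show ?thesis by (rule frechet_derivative_eq)
  qed
  have eq: "\<eta> p = (\<eta> p \<bullet> normal p) *\<^sub>R normal p" "(\<eta> p \<bullet> normal p)\<^sup>2 = 1" if p: "p \<in> W" for p
  proof -
    obtain u w where uw: "p = (u, w)" by (cases p)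
    have d: "DIM(real^4) = Suc (DIM((real^2) \<times> real))" by simp
    show "\<eta> p = (\<eta> p \<bullet> normal p) *\<^sub>R normal p" "(\<eta> p \<bullet> normal p)\<^sup>2 = 1"
      using unit_normal_unique[OF X_immersed(2,1) d, of u w "normal p" "\<eta> p"] p
        normal_is_unit_normal \<eta>(2,3)[OF p] unfolding uw dF[OF p, unfolded uw] by auto
  qed
  have "continuous_on W normal"
    using dom by (auto intro!: continuous_at_imp_continuous_on has_derivative_continuous[OF normal_derivative])
  then have cont: "continuous_on W (\<lambda>p. \<eta> p \<bullet> normal p)" using \<eta>(1) by (intro continuous_on_inner)
  define \<sigma> where "\<sigma> = \<eta> (u, w) \<bullet> normal (u, w)"
  obtain r where r: "r > 0" "ball (u, w) r \<subseteq> W" using dom(1) q openE by blast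
  have const: "\<eta> p = \<sigma> *\<^sub>R normal p" if p: "p \<in> ball (u, w) r" for p
  proof -
    have "(\<lambda>p. \<eta> p \<bullet> normal p) constant_on ball (u, w) r"
    proof (rule continuous_finite_range_constant)
      show "continuous_on (ball (u, w) r) (\<lambda>p. \<eta> p \<bullet> normal p)" using cont r(2) by (rule continuous_on_subset)
      have "(\<lambda>p. \<eta> p \<bullet> normal p) ` ball (u, w) r \<subseteq> {-1, 1}"
        using eq(2) r(2) by (auto simp: power2_eq_1_iff)
      then show "finite ((\<lambda>p. \<eta> p \<bullet> normal p) ` ball (u, w) r)" by (rule finite_subset) simp
    qed simp
    then have "\<eta> p \<bullet> normal p = \<sigma>"
      using p r(1) unfolding \<sigma>_def constant_on_def by (metis centre_in_ball)
    then show ?thesis using eq(1)[of p] p r(2) by auto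
  qed
  have uw: "u \<in> U" "w \<in> J" using q dom by auto
  have "(normal has_derivative dif normal (u, w)) (at (u, w))"
    using differentiableI[OF normal_derivative[OF uw]] by (rule frechet_derivative_works_at)
  then have "((\<lambda>p. \<sigma> *\<^sub>R normal p) has_derivative (\<lambda>v. \<sigma> *\<^sub>R dif normal (u, w) v)) (at (u, w))"
    by (rule has_derivative_scaleR_right)
  then have "(\<eta> has_derivative (\<lambda>v. \<sigma> *\<^sub>R dif normal (u, w) v)) (at (u, w))"
    by (rule has_derivative_transform_within_open[OF _ open_ball, of _ _ _ _ _ r]) (use r const in auto)
  then have d\<eta>: "dif \<eta> (u, w) = (\<lambda>v. \<sigma> *\<^sub>R dif normal (u, w) v)" "linear (\<lambda>v. \<sigma> *\<^sub>R dif normal (u, w) v)"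
    by (auto intro: frechet_derivative_eq has_derivative_linear)
  have "principal_curvatures_at F \<eta> (u, w) (\<lambda>i. \<sigma> * curvature k w i)"
  proof -
    obtain c :: "nat \<Rightarrow> (real^2) \<times> real" where
      c: "\<forall>i<3. \<forall>j<3. dif X (u, w) (c i) \<bullet> dif X (u, w) (c j) = (if i = j then 1 else 0)"
      "\<forall>i<3. dif normal (u, w) (c i) = - (curvature k w i *\<^sub>R dif X (u, w) (c i))"
      using principal_curvatures_normal[OF q k] unfolding principal_curvatures_at_def by auto
    show ?thesis unfolding principal_curvatures_at_def dF[OF q] d\<eta>(1)
      by (rule exI[of _ c]) (use c in simp)
  qed
  then show ?thesis
    using that[of \<sigma>] eq(2)[OF q] X_immersed(2)[OF q] d\<eta> dF[OF q] by (simp add: \<sigma>_def)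
qed

text \<open>The sign of the normal disappears because both conditions are homogeneous. The first one is
  \<open>3 H\<^sub>2\<close> multiplied by \<open>(1 - z\<^sub>1 k\<^sub>0) (1 - z\<^sub>1 k\<^sub>1) |z'|\<^sup>4\<close>.\<close>

lemma mean_curvatures_any_normal:
  assumes q: "(u, w) \<in> W" and k: "principal_curvatures_at Y N u k"
    and F: "\<And>p. p \<in> W \<Longrightarrow> F p = X p"
    and \<eta>: "continuous_on W \<eta>" "\<And>p. p \<in> W \<Longrightarrow> norm (\<eta> p) = 1"
      "\<And>p v. p \<in> W \<Longrightarrow> dif F p v \<bullet> \<eta> p = 0"
  shows "r_mean_curvature 2 F \<eta> (u, w) = 0 \<longleftrightarrow>
      z2' w * (z2' w * (k 0 * k 1) * ((z1' w)\<^sup>2 + (z2' w)\<^sup>2)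
        + bending w * (k 0 + k 1 - 2 * z1 w * (k 0 * k 1))) = 0"
    and "r_mean_curvature 3 F \<eta> (u, w) = 0 \<longleftrightarrow> z2' w = 0 \<or> k 0 * k 1 = 0 \<or> bending w = 0"
proof -
  obtain \<sigma> where \<sigma>: "\<sigma>\<^sup>2 = 1" "principal_curvatures_at F \<eta> (u, w) (\<lambda>i. \<sigma> * curvature k w i)"
    "linear (dif F (u, w))" "linear (dif \<eta> (u, w))"
    by (rule principal_curvatures_any_normal[OF assms])
  note H = mean_curvatures_hypersurface[OF \<sigma>(3,4,2)]
  have w: "w \<in> J" using q dom by auto
  define l where "l = len w"
  have l: "l > 0" "l\<^sup>2 = (z1' w)\<^sup>2 + (z2' w)\<^sup>2" using len[OF w] by (simp_all add: l_def)
  define d0 d1 where "d0 = 1 - z1 w * k 0" and "d1 = 1 - z1 w * k 1"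
  have d: "d0 \<noteq> 0" "d1 \<noteq> 0" using regular[OF q k] by (simp_all add: d0_def d1_def)
  have c: "curvature k w 0 = z2' w / l * k 0 / d0" "curvature k w (Suc 0) = z2' w / l * k 1 / d1"
    "curvature k w 2 = bending w / l ^ 3"
    by (simp_all add: curvature_def l_def d0_def d1_def)
  have s0: "\<sigma> \<noteq> 0" using \<sigma>(1) by auto
  have "3 * (d0 * d1 * l ^ 4 * r_mean_curvature 2 F \<eta> (u, w))
    = \<sigma>\<^sup>2 * (z2' w * (z2' w * (k 0 * k 1) * l\<^sup>2 + bending w * (k 0 * d1 + k 1 * d0)))"
    unfolding H using d l(1) by (simp add: c field_simps power2_eq_square power3_eq_cube power4_eq_xxxx)
  also have "k 0 * d1 + k 1 * d0 = k 0 + k 1 - 2 * z1 w * (k 0 * k 1)"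
    by (simp add: d0_def d1_def algebra_simps)
  finally show "r_mean_curvature 2 F \<eta> (u, w) = 0 \<longleftrightarrow>
      z2' w * (z2' w * (k 0 * k 1) * ((z1' w)\<^sup>2 + (z2' w)\<^sup>2)
        + bending w * (k 0 + k 1 - 2 * z1 w * (k 0 * k 1))) = 0"
    using d l s0 by (metis mult_eq_0_iff mult_cancel_right2 \<sigma>(1) power_eq_0_iff zero_neq_numeral less_irrefl mult_1)
  show "r_mean_curvature 3 F \<eta> (u, w) = 0 \<longleftrightarrow> z2' w = 0 \<or> k 0 * k 1 = 0 \<or> bending w = 0"
    unfolding H using d l(1) s0 by (auto simp: c)
qed

end

section \<open>The profile equation\<close>

text \<open>Writing \<open>\<rho> = z\<^sub>1 - c\<close> and \<open>p = z\<^sub>1' / z\<^sub>2'\<close> for the slope, the equation says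
  \<open>2 \<rho> p' = z\<^sub>2' (1 + p\<^sup>2)\<close>, so \<open>(1 + p\<^sup>2) / \<rho>\<close> is a first integral. If its value is \<open>1 / C\<close>,
  then \<open>p' = z\<^sub>2' / (2 C)\<close> and \<open>p\<close> is an affine function of \<open>z\<^sub>2\<close>: the profile is a parabola.\<close>

lemma profile_parabola:
  fixes z1 z2 z1' z2' z1'' z2'' :: "real \<Rightarrow> real"
  assumes J: "open J" "connected J"
    and z: "\<And>w. w \<in> J \<Longrightarrow> (z1 has_real_derivative z1' w) (at w)"
      "\<And>w. w \<in> J \<Longrightarrow> (z2 has_real_derivative z2' w) (at w)"
      "\<And>w. w \<in> J \<Longrightarrow> (z1' has_real_derivative z1'' w) (at w)"
      "\<And>w. w \<in> J \<Longrightarrow> (z2' has_real_derivative z2'' w) (at w)"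
    and nz: "\<And>w. w \<in> J \<Longrightarrow> z2' w \<noteq> 0"
    and eq: "\<And>w. w \<in> J \<Longrightarrow> z2' w * ((z1' w)\<^sup>2 + (z2' w)\<^sup>2)
      = 2 * (z1 w - c) * (z1'' w * z2' w - z1' w * z2'' w)"
  obtains C C2 where "C \<noteq> 0" "\<And>w. w \<in> J \<Longrightarrow> z1 w - c = C * (1 + ((z2 w - C2) / (2 * C))\<^sup>2)"
proof (cases "J = {}")
  case True
  then show ?thesis using that[of 1] by auto
next
  case False
  define p where "p w = z1' w / z2' w" for w
  define b where "b w = z1'' w * z2' w - z1' w * z2'' w" for w
  have pz: "z1' w = p w * z2' w" if "w \<in> J" for w using nz[OF that] by (simp add: p_def)
  have dp: "(p has_real_derivative b w / (z2' w)\<^sup>2) (at w)" if "w \<in> J" for w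
    unfolding p_def[abs_def] b_def using DERIV_divide[OF z(3)[OF that] z(4)[OF that] nz[OF that]]
    by (simp add: power2_eq_square)
  have slope: "z2' w * (1 + (p w)\<^sup>2) = 2 * (z1 w - c) * (b w / (z2' w)\<^sup>2)" if w: "w \<in> J" for w
  proof -
    have "(z2' w)\<^sup>2 * (z2' w * (1 + (p w)\<^sup>2)) = 2 * (z1 w - c) * b w"
      using eq[OF w] unfolding b_def pz[OF w] by (simp add: algebra_simps power2_eq_square)
    then show ?thesis using nz[OF w] by (simp add: field_simps)
  qed
  have pos: "1 + (p w)\<^sup>2 > 0" for w by (simp add: add_pos_nonneg)
  have rho: "z1 w - c \<noteq> 0" if w: "w \<in> J" for w
    using slope[OF w] nz[OF w] pos[of w] by auto
  have "(\<lambda>w. (1 + (p w)\<^sup>2) / (z1 w - c)) constant_on J"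
  proof (rule has_field_derivative_0_imp_constant_on[OF _ J(2,1)])
    fix w assume w: "w \<in> J"
    define d where "d = b w / (z2' w)\<^sup>2"
    have "((\<lambda>w. (1 + (p w)\<^sup>2) / (z1 w - c)) has_real_derivative
      (2 * p w * d * (z1 w - c) - (1 + (p w)\<^sup>2) * z1' w) / ((z1 w - c) * (z1 w - c))) (at w)"
      using dp[OF w] z(1)[OF w] rho[OF w] unfolding d_def[symmetric]
      by (auto intro!: derivative_eq_intros)
    moreover have "2 * p w * d * (z1 w - c) - (1 + (p w)\<^sup>2) * z1' w = 0"
      using slope[OF w] unfolding d_def[symmetric] pz[OF w] by algebra
    ultimately show "((\<lambda>w. (1 + (p w)\<^sup>2) / (z1 w - c)) has_real_derivative 0) (at w)" by simp
  qed
  then obtain e where e: "\<And>w. w \<in> J \<Longrightarrow> (1 + (p w)\<^sup>2) / (z1 w - c) = e"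
    unfolding constant_on_def by blast
  have e0: "e \<noteq> 0" using e False pos rho by (metis divide_eq_0_iff ex_in_conv less_irrefl)
  define C where "C = 1 / e"
  have rC: "z1 w - c = C * (1 + (p w)\<^sup>2)" if "w \<in> J" for w
    using e0 e[OF that] rho[OF that] by (auto simp: C_def field_simps)
  have C0: "C \<noteq> 0" using e0 by (simp add: C_def)
  have "(\<lambda>w. z2 w - 2 * C * p w) constant_on J"
  proof (rule has_field_derivative_0_imp_constant_on[OF _ J(2,1)])
    fix w assume w: "w \<in> J"
    have "((\<lambda>w. z2 w - 2 * C * p w) has_real_derivative z2' w - 2 * C * (b w / (z2' w)\<^sup>2)) (at w)"
      using dp[OF w] z(2)[OF w] by (auto intro!: derivative_eq_intros)
    moreover have "z2' w * (1 + (p w)\<^sup>2) = 2 * C * (b w / (z2' w)\<^sup>2) * (1 + (p w)\<^sup>2)"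
      using slope[OF w] rC[OF w] by simp
    then have "z2' w = 2 * C * (b w / (z2' w)\<^sup>2)"
      using pos[of w] by (metis less_irrefl mult_right_cancel)
    ultimately show "((\<lambda>w. z2 w - 2 * C * p w) has_real_derivative 0) (at w)" by simp
  qed
  then obtain C2 where C2: "\<And>w. w \<in> J \<Longrightarrow> z2 w - 2 * C * p w = C2"
    unfolding constant_on_def by blast
  show ?thesis
  proof (rule that[OF C0])
    fix w assume w: "w \<in> J"
    have "p w = (z2 w - C2) / (2 * C)" using C2[OF w] C0 by (simp add: field_simps)
    then show "z1 w - c = C * (1 + ((z2 w - C2) / (2 * C))\<^sup>2)" using rC[OF w] by simp
  qed
qed

section \<open>Unique continuation for minimal surfaces\<close>

text \<open>The differential of stereographic projection at \<open>n\<close>, up to the factor \<open>(1 - n\<^sub>3)\<^sup>-\<^sup>2\<close>.\<close>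

definition stereo_diff :: "real^3 \<Rightarrow> real^3 \<Rightarrow> complex" where
  "stereo_diff n t = (1 - n $ 3) *\<^sub>R Complex (t $ 1) (t $ 2) + (t $ 3) *\<^sub>R Complex (n $ 1) (n $ 2)"

text \<open>The component \<open>j\<close> of \<open>y - \<i> (n \<times> y)\<close>; on the plane orthogonal to \<open>n\<close>, rotation by a right
  angle in \<open>y\<close> becomes multiplication by \<open>\<i>\<close>.\<close>

definition complexify :: "3 \<Rightarrow> real^3 \<Rightarrow> real^3 \<Rightarrow> complex" where
  "complexify j n y = Complex (y $ j) (- (cross3 n y $ j))"

text \<open>Stereographic projection is conformal and, as a map from the sphere with outward normal \<open>n\<close>,
  reverses orientation; hence the factor \<open>- \<i>\<close>.\<close>

lemma stereo_diff_conformal: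
  assumes "n \<bullet> n = 1" "n \<bullet> t = 0"
  shows "stereo_diff n (cross3 n t) = - \<i> * stereo_diff n t"
    and "(cmod (stereo_diff n t))\<^sup>2 = (1 - n $ 3)\<^sup>2 * (t \<bullet> t)"
proof -
  have n: "n $ 1 * n $ 1 + n $ 2 * n $ 2 + n $ 3 * n $ 3 = 1"
    and nt: "n $ 1 * t $ 1 + n $ 2 * t $ 2 + n $ 3 * t $ 3 = 0"
    using assms by (simp_all add: inner_vec_def sum_3)
  have "(1 - n $ 3) * (n $ 2 * t $ 3 - n $ 3 * t $ 2) + (n $ 1 * t $ 2 - n $ 2 * t $ 1) * n $ 1
    = (1 - n $ 3) * t $ 2 + t $ 3 * n $ 2"
    using n nt by algebra
  moreover have "(1 - n $ 3) * (n $ 3 * t $ 1 - n $ 1 * t $ 3) + (n $ 1 * t $ 2 - n $ 2 * t $ 1) * n $ 2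
    = - ((1 - n $ 3) * t $ 1 + t $ 3 * n $ 1)"
    using n nt by algebra
  ultimately show "stereo_diff n (cross3 n t) = - \<i> * stereo_diff n t"
    by (simp add: complex_eq_iff stereo_diff_def cross_components algebra_simps)
  have "((1 - n $ 3) * t $ 1 + t $ 3 * n $ 1)\<^sup>2 + ((1 - n $ 3) * t $ 2 + t $ 3 * n $ 2)\<^sup>2
    = (1 - n $ 3)\<^sup>2 * (t $ 1 * t $ 1 + t $ 2 * t $ 2 + t $ 3 * t $ 3)"
    using n nt by algebra
  then show "(cmod (stereo_diff n t))\<^sup>2 = (1 - n $ 3)\<^sup>2 * (t \<bullet> t)"
    by (simp add: cmod_power2 stereo_diff_def inner_vec_def sum_3)
qed

lemma stereo_diff_linear: "stereo_diff n (a *\<^sub>R x + b *\<^sub>R y) = a *\<^sub>R stereo_diff n x + b *\<^sub>R stereo_diff n y"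
  by (simp add: stereo_diff_def complex_eq_iff algebra_simps)

lemma complexify_linear: "complexify j n (a *\<^sub>R x + b *\<^sub>R y) = a *\<^sub>R complexify j n x + b *\<^sub>R complexify j n y"
  by (simp add: complexify_def complex_eq_iff cross_add_right cross_mult_right algebra_simps)

lemma tangent_expand:
  fixes n t x :: "real^3"
  assumes "n \<bullet> n = 1" "n \<bullet> t = 0" "t \<noteq> 0" "n \<bullet> x = 0"
  shows "\<exists>\<alpha> \<beta>. x = \<alpha> *\<^sub>R t + \<beta> *\<^sub>R cross3 n t"
proof -
  define P where "P = (1 / norm t) *\<^sub>R t"
  have P: "P \<bullet> P = 1" "n \<bullet> P = 0"
    using assms by (simp_all add: P_def dot_square_norm power2_eq_square)
  have "cross3 n P \<bullet> cross3 n P = 1"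
    using norm_cross_dot[of n P] P assms(1) by (simp add: dot_square_norm power_mult_distrib flip: power2_norm_eq_inner)
  then have "x = (x \<bullet> P) *\<^sub>R P + (x \<bullet> cross3 n P) *\<^sub>R cross3 n P"
    by (intro orthonormal_pair_expand[where N = n])
      (use assms P in \<open>auto simp: inner_commute dot_cross_self\<close>)
  then have "x = ((x \<bullet> P) / norm t) *\<^sub>R t + ((x \<bullet> cross3 n P) / norm t) *\<^sub>R cross3 n t"
    by (simp add: P_def cross_mult_right)
  then show ?thesis by blast
qed

text \<open>If \<open>y = S t\<close> and \<open>s = S t\<^sub>1\<close> for a symmetric trace-free endomorphism \<open>S\<close> of the tangent
  plane, then \<open>S\<close> anticommutes with the rotation by a right angle. Complexified differentials of
  \<open>Y\<close> are therefore complex multiples of the differential of stereographic projection.\<close>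

lemma tracefree_complex_linear:
  fixes n t1 s t y :: "real^3"
  assumes n: "n \<bullet> n = 1" and tan: "n \<bullet> t1 = 0" "n \<bullet> s = 0" "n \<bullet> t = 0" "n \<bullet> y = 0" and t1: "t1 \<noteq> 0"
    and rel: "cross3 t1 y = cross3 t s" "t1 \<bullet> y = t \<bullet> s"
  shows "complexify j n y * stereo_diff n t1 = complexify j n s * stereo_diff n t"
proof -
  define r where "r = cross3 n t1"
  obtain \<alpha> \<beta> where t: "t = \<alpha> *\<^sub>R t1 + \<beta> *\<^sub>R r" unfolding r_def using tangent_expand[OF n tan(1) t1 tan(3)] by blast
  obtain \<gamma> \<delta> where s: "s = \<gamma> *\<^sub>R t1 + \<delta> *\<^sub>R r" unfolding r_def using tangent_expand[OF n tan(1) t1 tan(2)] by blast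
  obtain y1 y2 where y: "y = y1 *\<^sub>R t1 + y2 *\<^sub>R r" unfolding r_def using tangent_expand[OF n tan(1) t1 tan(4)] by blast
  have m: "t1 \<bullet> t1 \<noteq> 0" "t1 \<bullet> r = 0" "r \<bullet> t1 = 0" "r \<bullet> r = t1 \<bullet> t1"
    using t1 norm_cross_dot[of n t1] n tan(1)
    by (simp_all add: r_def dot_cross_self power_mult_distrib flip: power2_norm_eq_inner)
  have c: "cross3 t1 r = (t1 \<bullet> t1) *\<^sub>R n" "cross3 n r = - t1"
    using n tan(1) by (simp_all add: r_def Lagrange inner_commute)
  have "y1 * (t1 \<bullet> t1) = (\<alpha> * \<gamma> + \<beta> * \<delta>) * (t1 \<bullet> t1)"
    using rel(2) unfolding t s y by (simp add: inner_add_left inner_add_right m algebra_simps)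
  then have y1: "y1 = \<alpha> * \<gamma> + \<beta> * \<delta>" using m by simp
  have "cross3 t1 y = y2 *\<^sub>R cross3 t1 r" unfolding y by (simp add: cross_add_right cross_mult_right)
  moreover have "cross3 t s = (\<alpha> * \<delta> - \<beta> * \<gamma>) *\<^sub>R cross3 t1 r" unfolding t s by (rule cross_of_combinations)
  ultimately have "y2 *\<^sub>R (t1 \<bullet> t1) *\<^sub>R n = (\<alpha> * \<delta> - \<beta> * \<gamma>) *\<^sub>R (t1 \<bullet> t1) *\<^sub>R n" using rel(1) unfolding c(1) by metis
  moreover have "(t1 \<bullet> t1) *\<^sub>R n \<noteq> 0" using m n by auto
  ultimately have y2: "y2 = \<alpha> * \<delta> - \<beta> * \<gamma>" using scaleR_cancel_right by blast
  have r: "stereo_diff n r = - \<i> * stereo_diff n t1" "complexify j n r = \<i> * complexify j n t1"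
    unfolding r_def using stereo_diff_conformal[OF n tan(1)] c(2)
    by (simp_all add: complexify_def complex_eq_iff r_def)
  show ?thesis
    unfolding t s y stereo_diff_linear complexify_linear r y1 y2
    by (simp add: scaleR_conv_of_real algebra_simps)
qed

lemma bounded_linear_Complex_nth: "bounded_linear (\<lambda>x::real^3. Complex (x $ 1) (x $ 2))"
  by (rule linear_conv_bounded_linear[THEN iffD1], rule linearI) (simp_all add: complex_eq_iff)

lemma bounded_linear_Complex_nth_minus_nth: "bounded_linear (\<lambda>(x::real^3, y::real^3). Complex (x $ j) (- (y $ j)))"
  by (rule linear_conv_bounded_linear[THEN iffD1], rule linearI) (auto simp: complex_eq_iff)

lemma bounded_bilinear_cross3: "bounded_bilinear cross3"
  using bilinear_conv_bounded_bilinear bilinear_cross by blast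

definition stereo :: "real^3 \<Rightarrow> complex" where
  "stereo n = inverse (1 - n $ 3) *\<^sub>R Complex (n $ 1) (n $ 2)"

lemma stereo_smooth:
  assumes "open A" "smooth_on A N" "\<forall>u\<in>A. N u $ 3 \<noteq> 1"
  shows "smooth_on A (\<lambda>u. stereo (N u))"
    and "u \<in> A \<Longrightarrow> dif (\<lambda>u. stereo (N u)) u v = (1 / (1 - N u $ 3)\<^sup>2) *\<^sub>R stereo_diff (N u) (dif N u v)"
proof -
  have blm: "bounded_linear (\<lambda>x::real^3. - x $ 3)"
    by (rule bounded_linear_minus[OF bounded_linear_vec_nth])
  have "smooth_on A (\<lambda>u. 1 + - N u $ 3)"
    by (rule smooth_on_add[OF assms(1) smooth_on_const smooth_on_bounded_linear_compose[OF assms(1) blm assms(2)]])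
  then have "smooth_on A (\<lambda>u. inverse (1 + - N u $ 3))"
    by (intro smooth_on_real_compose[OF assms(1) _ smooth_on_inverse]) (use assms(3) in auto)
  from smooth_on_bilinear[OF assms(1) bounded_bilinear_scaleR this
      smooth_on_bounded_linear_compose[OF assms(1) bounded_linear_Complex_nth assms(2)]]
  show "smooth_on A (\<lambda>u. stereo (N u))" by (simp add: stereo_def)
  assume u: "u \<in> A"
  have N: "(N has_derivative dif N u) (at u)" using assms(2) u by (rule smooth_on_has_derivative)
  have c: "1 - N u $ 3 \<noteq> 0" using assms(3) u by simp
  have i: "((\<lambda>u. inverse (1 - N u $ 3)) has_derivative
      (\<lambda>v. inverse (1 - N u $ 3) * (dif N u v $ 3) * inverse (1 - N u $ 3))) (at u)"
    using c by (auto intro!: derivative_eq_intros bounded_linear.has_derivative[OF bounded_linear_vec_nth] N)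
  have "((\<lambda>u. stereo (N u)) has_derivative
      (\<lambda>v. inverse (1 - N u $ 3) *\<^sub>R Complex (dif N u v $ 1) (dif N u v $ 2)
        + (inverse (1 - N u $ 3) * (dif N u v $ 3) * inverse (1 - N u $ 3)) *\<^sub>R Complex (N u $ 1) (N u $ 2))) (at u)"
    unfolding stereo_def
    by (rule has_derivative_scaleR[OF i bounded_linear.has_derivative[OF bounded_linear_Complex_nth N]])
  moreover have key: "inverse c *\<^sub>R p + (inverse c * s * inverse c) *\<^sub>R q = (1 / c\<^sup>2) *\<^sub>R (c *\<^sub>R p + s *\<^sub>R q)"
    if "c \<noteq> 0" for c s :: real and p q :: complex
    using that by (simp add: scaleR_add_right power2_eq_square divide_inverse mult_ac)
  note frechet_derivative_eq[OF calculation]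
  then show "dif (\<lambda>u. stereo (N u)) u v = (1 / (1 - N u $ 3)\<^sup>2) *\<^sub>R stereo_diff (N u) (dif N u v)"
    using key[OF c] by (simp only: stereo_diff_def)
qed

text \<open>In the coordinate \<open>\<zeta>\<close> obtained from the Gauss map by stereographic projection, the
  coefficient \<open>f\<close> of \<open>dY\<^sub>j - \<i> (N \<times> dY)\<^sub>j = f d\<zeta>\<close> is holomorphic, because the
  left-hand side is a closed form. This is the Weierstrass representation.\<close>

locale tracefree_surface =
  fixes A :: "(real^2) set" and Y N :: "real^2 \<Rightarrow> real^3"
  assumes A: "open A" and smooth: "smooth_on A Y" "smooth_on A N"
    and unit: "\<And>u. u \<in> A \<Longrightarrow> N u \<bullet> N u = 1"
    and injN: "\<And>u. u \<in> A \<Longrightarrow> inj (dif N u)"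
    and tangent: "\<And>u v. u \<in> A \<Longrightarrow> N u \<bullet> dif N u v = 0" "\<And>u v. u \<in> A \<Longrightarrow> N u \<bullet> dif Y u v = 0"
    and tracefree: "\<And>u a b. u \<in> A \<Longrightarrow> cross3 (dif N u a) (dif Y u b) = cross3 (dif N u b) (dif Y u a)"
    and symmetric: "\<And>u a b. u \<in> A \<Longrightarrow> dif N u a \<bullet> dif Y u b = dif N u b \<bullet> dif Y u a"
begin

lemma linear_dif: "u \<in> A \<Longrightarrow> linear (dif N u)" "u \<in> A \<Longrightarrow> linear (dif Y u)"
  using smooth by (auto intro: has_derivative_linear smooth_on_has_derivative)

lemma dN_nonzero: "u \<in> A \<Longrightarrow> v \<noteq> 0 \<Longrightarrow> dif N u v \<noteq> 0"
  using linear_dif injN linear_injective_0 by blast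

definition \<Omega> :: "3 \<Rightarrow> real^2 \<Rightarrow> real^2 \<Rightarrow> complex" where
  "\<Omega> j v u = complexify j (N u) (dif Y u v)"

lemma \<Omega>_derivative:
  assumes "u \<in> A"
  shows "(\<Omega> j b has_derivative (\<lambda>a. Complex (dif (\<lambda>u. dif Y u b) u a $ j)
    (- ((cross3 (N u) (dif (\<lambda>u. dif Y u b) u a) + cross3 (dif N u a) (dif Y u b)) $ j)))) (at u)"
proof -
  have N: "(N has_derivative dif N u) (at u)" using smooth(2) assms by (rule smooth_on_has_derivative)
  have Y: "((\<lambda>u. dif Y u b) has_derivative dif (\<lambda>u. dif Y u b) u) (at u)"
    using smooth_on_derivative[OF smooth(1)] assms by (rule smooth_on_has_derivative)
  have "((\<lambda>u. (\<lambda>(x, y). Complex (x $ j) (- (y $ j))) (dif Y u b, cross3 (N u) (dif Y u b))) has_derivative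
    (\<lambda>a. (\<lambda>(x, y). Complex (x $ j) (- (y $ j))) (dif (\<lambda>u. dif Y u b) u a,
      cross3 (N u) (dif (\<lambda>u. dif Y u b) u a) + cross3 (dif N u a) (dif Y u b)))) (at u)"
    by (rule bounded_linear.has_derivative[OF bounded_linear_Complex_nth_minus_nth
      has_derivative_Pair[OF Y bounded_bilinear.FDERIV[OF bounded_bilinear_cross3 N Y]]])
  then show ?thesis by (simp add: \<Omega>_def[abs_def] complexify_def)
qed

text \<open>The second derivatives of \<open>Y\<close> cancel by symmetry, and what remains of \<open>d(N \<times> dY)\<close> is the
  trace of the endomorphism that takes \<open>dN\<close> to \<open>dY\<close>.\<close>

lemma \<Omega>_closed:
  assumes "u \<in> A"
  shows "dif (\<Omega> j b) u a = dif (\<Omega> j a) u b"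
proof -
  have "dif (\<lambda>u. dif Y u b) u a = dif (\<lambda>u. dif Y u a) u b"
    by (rule smooth_on_second_derivative_symmetric[OF smooth(1) A assms])
  then show ?thesis
    unfolding frechet_derivative_eq[OF \<Omega>_derivative[OF assms]] using tracefree[OF assms, of a b] by simp
qed

text \<open>Closedness of \<open>f d\<zeta>\<close> says that \<open>df\<close> is a complex multiple of \<open>d\<zeta>\<close>, that is, \<open>f\<close> is a
  holomorphic function of \<open>\<zeta>\<close>. The identity theorem on the connected image of a ball does the rest.\<close>

lemma local_unique_continuation:
  assumes a: "a \<in> A" and pole: "N a $ 3 \<noteq> 1"
  shows "\<exists>r>0. ball a r \<subseteq> A \<and> (\<forall>S. open S \<longrightarrow> S \<noteq> {} \<longrightarrow> S \<subseteq> ball a r \<longrightarrow>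
     (\<forall>u\<in>S. \<forall>v. dif Y u v = 0) \<longrightarrow> (\<forall>u\<in>ball a r. \<forall>v. dif Y u v = 0))"
proof -
  define A0 where "A0 = {u \<in> A. N u $ 3 \<noteq> 1}"
  define \<zeta> where "\<zeta> u = stereo (N u)" for u
  have "continuous_on A (\<lambda>u. N u $ 3)" by (intro continuous_intros smooth_on_imp_continuous_on smooth)
  then have "open (A \<inter> (\<lambda>u. N u $ 3) -` (- {1}))" by (rule continuous_open_preimage[OF _ A]) auto
  also have "A \<inter> (\<lambda>u. N u $ 3) -` (- {1}) = A0" by (auto simp: A0_def)
  finally have A0: "open A0" "A0 \<subseteq> A" "a \<in> A0" "\<forall>u\<in>A0. N u $ 3 \<noteq> 1"
    using a pole by (auto simp: A0_def)
  note st = stereo_smooth[OF A0(1) smooth_on_subset[OF smooth(2) A0(2)] A0(4), folded \<zeta>_def]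
  have \<zeta>0: "dif \<zeta> u v \<noteq> 0" if "u \<in> A0" "v \<noteq> 0" for u v
  proof
    assume "dif \<zeta> u v = 0"
    then have "stereo_diff (N u) (dif N u v) = 0" using st(2)[OF that(1)] A0(4) that(1) by simp
    then have "dif N u v = 0"
      using stereo_diff_conformal(2)[of "N u" "dif N u v"] unit tangent(1) A0 that(1) by auto
    then show False using dN_nonzero that A0 by blast
  qed
  define e where "e = (axis 1 1 :: real^2)"
  have e: "e \<noteq> 0" by (simp add: e_def axis_eq_0_iff)
  define f where "f j u = \<Omega> j e u / dif \<zeta> u e" for j u
  have \<Omega>f: "\<Omega> j v u = f j u * dif \<zeta> u v" if u: "u \<in> A0" for j u v
  proof -
    have uA: "u \<in> A" using u A0 by auto
    have "complexify j (N u) (dif Y u v) * stereo_diff (N u) (dif N u e)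
      = complexify j (N u) (dif Y u e) * stereo_diff (N u) (dif N u v)"
      by (rule tracefree_complex_linear)
        (use unit tangent tracefree symmetric dN_nonzero[OF _ e] uA in auto)
    then have "\<Omega> j v u * dif \<zeta> u e = \<Omega> j e u * dif \<zeta> u v"
      unfolding st(2)[OF u] \<Omega>_def by simp
    then show ?thesis using \<zeta>0[OF u e] by (simp add: f_def field_simps)
  qed
  have d\<zeta>: "((\<lambda>u. dif \<zeta> u v) has_derivative dif (\<lambda>u. dif \<zeta> u v) u) (at u)" if "u \<in> A0" for u v
    using smooth_on_has_derivative[OF smooth_on_derivative[OF st(1)] that] .
  have df: "(f j has_derivative dif (f j) u) (at u)" if u: "u \<in> A0" for j u
  proof -
    have "(\<lambda>u. \<Omega> j e u / dif \<zeta> u e) differentiable (at u)"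
      using differentiableI[OF \<Omega>_derivative] differentiableI[OF d\<zeta>[OF u]] u A0 \<zeta>0[OF u e]
      by (intro differentiable_divide) auto
    then show ?thesis unfolding f_def[abs_def] by (rule frechet_derivative_works_at)
  qed
  have CR: "dif (f j) u b = dif (f j) u e / dif \<zeta> u e * dif \<zeta> u b" if u: "u \<in> A0" for j u b
  proof -
    have d: "dif (\<Omega> j v) u w = f j u * dif (\<lambda>u. dif \<zeta> u v) u w + dif (f j) u w * dif \<zeta> u v" for v w
    proof -
      have "(\<Omega> j v has_derivative (\<lambda>w. f j u * dif (\<lambda>u. dif \<zeta> u v) u w + dif (f j) u w * dif \<zeta> u v)) (at u)"
        by (rule has_derivative_transform_within_open[OF has_derivative_mult[OF df[OF u] d\<zeta>[OF u]] A0(1) u])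
          (simp add: \<Omega>f)
      then show ?thesis by (rule fun_cong[OF frechet_derivative_eq])
    qed
    have "dif (\<lambda>u. dif \<zeta> u e) u b = dif (\<lambda>u. dif \<zeta> u b) u e"
      by (rule smooth_on_second_derivative_symmetric[OF st(1) A0(1) u])
    moreover have "dif (\<Omega> j e) u b = dif (\<Omega> j b) u e" using \<Omega>_closed u A0 by blast
    ultimately have "dif (f j) u b * dif \<zeta> u e = dif (f j) u e * dif \<zeta> u b" unfolding d by simp
    then show ?thesis using \<zeta>0[OF u e] by (simp add: field_simps)
  qed
  have lin\<zeta>: "linear (dif \<zeta> u)" if "u \<in> A0" for u
    using smooth_on_has_derivative[OF st(1) that] by (rule has_derivative_linear)
  have inj\<zeta>: "\<forall>u\<in>A0. inj (dif \<zeta> u)"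
    using linear_injective_0[OF lin\<zeta>] \<zeta>0 by blast
  have dim: "DIM(real^2) = DIM(complex)" by simp
  obtain r g where r: "r > 0" "ball a r \<subseteq> A0" "open (\<zeta> ` ball a r)" "continuous_on (\<zeta> ` ball a r) g"
    and gz: "\<forall>x\<in>ball a r. g (\<zeta> x) = x"
    and dgz: "\<forall>x\<in>ball a r. \<forall>g'. bounded_linear g' \<longrightarrow> g' \<circ> dif \<zeta> x = id \<longrightarrow> (g has_derivative g') (at (\<zeta> x))"
    by (rule smooth_local_inverse[OF A0(1) st(1) A0(3) inj\<zeta> dim])
  have g: "g (\<zeta> x) = x" if "x \<in> ball a r" for x using gz that by blast
  have hol: "(\<lambda>z. f j (g z)) holomorphic_on \<zeta> ` ball a r" for j
  proof (rule holomorphic_on_open[OF r(3), THEN iffD2], intro ballI)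
    fix z assume "z \<in> \<zeta> ` ball a r"
    then obtain u where u: "u \<in> ball a r" "z = \<zeta> u" by blast
    have uA: "u \<in> A0" using u r by auto
    obtain g' where g': "linear g'" "g' \<circ> dif \<zeta> u = id"
      using linear_injective_left_inverse[OF lin\<zeta>[OF uA]] inj\<zeta> uA by blast
    have "surj (dif \<zeta> u)"
      using inj\<zeta> uA linear_injective_imp_surjective[OF lin\<zeta>[OF uA]] dim by auto
    then have g'r: "dif \<zeta> u (g' w) = w" for w using g'(2) by (metis comp_apply id_apply surjD)
    have dg: "(g has_derivative g') (at z)"
      unfolding u(2) using dgz u(1) linear_conv_bounded_linear[THEN iffD1, OF g'(1)] g'(2) by blast
    have gz: "g z = u" using g u by simp
    have "(f j has_derivative dif (f j) u) (at (g z))" unfolding gz by (rule df[OF uA])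
    from has_derivative_compose[OF dg this]
    have "((\<lambda>z. f j (g z)) has_derivative (\<lambda>w. dif (f j) u (g' w))) (at z)" .
    moreover have "(\<lambda>w. dif (f j) u (g' w)) = (*) (dif (f j) u e / dif \<zeta> u e)"
      by (rule ext) (subst CR[OF uA], simp add: g'r)
    ultimately show "\<exists>f'. ((\<lambda>z. f j (g z)) has_field_derivative f') (at z)"
      unfolding has_field_derivative_def by metis
  qed
  have conn: "connected (\<zeta> ` ball a r)"
    by (intro connected_continuous_image convex_connected convex_ball continuous_on_subset[OF smooth_on_imp_continuous_on[OF st(1)] r(2)])
  show ?thesis
  proof (intro exI[of _ r] conjI allI impI ballI)
    show "r > 0" by (rule r(1))
    show "ball a r \<subseteq> A" using r(2) A0(2) by blast
    fix S u v
    assume S: "open S" "S \<noteq> {}" "S \<subseteq> ball a r" "\<forall>u\<in>S. \<forall>v. dif Y u v = 0" and u: "u \<in> ball a r"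
    have uA: "u \<in> A0" using u r by auto
    have "\<zeta> ` S = \<zeta> ` ball a r \<inter> g -` S"
    proof (intro equalityI subsetI)
      fix z assume "z \<in> \<zeta> ` ball a r \<inter> g -` S"
      then obtain x where "x \<in> ball a r" "z = \<zeta> x" "g z \<in> S" by auto
      then show "z \<in> \<zeta> ` S" using g by auto
    qed (use g S(3) in auto)
    then have opS: "open (\<zeta> ` S)" using continuous_open_preimage[OF r(4,3) S(1)] by simp
    have "f j u = 0" for j
    proof -
      have "(\<lambda>z. f j (g z)) (\<zeta> u) = (\<lambda>z. 0) (\<zeta> u)"
      proof (rule analytic_continuation_open[OF opS r(3) _ conn _ hol])
        fix z assume "z \<in> \<zeta> ` S"
        then obtain x where x: "x \<in> S" "z = \<zeta> x" by blast
        have "g z = x" using g x S(3) by auto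
        moreover have "f j x = 0"
        proof -
          have "complexify j (N x) 0 = 0" by (simp add: complexify_def complex_eq_iff)
          then show ?thesis using S(4) x(1) by (simp add: f_def \<Omega>_def)
        qed
        ultimately show "f j (g z) = 0" by simp
      qed (use S u in auto)
      then show ?thesis using g[OF u] by simp
    qed
    then have "\<Omega> j v u = 0" for j using \<Omega>f[OF uA] by simp
    then show "dif Y u v = 0"
      by (simp add: \<Omega>_def complexify_def complex_eq_iff vec_eq_iff)
  qed
qed

end

text \<open>By the local result, a point near which \<open>dY\<close> vanishes on some open set has a neighbourhood on
  which it vanishes; so the interior of the zero set of \<open>dY\<close> is open and closed in \<open>A\<close>.\<close>

lemma tracefree_surface_unique_continuation:
  assumes "tracefree_surface A Y N" "connected A"
    and S: "open S" "S \<noteq> {}" "S \<subseteq> A" "\<And>u v. u \<in> S \<Longrightarrow> dif Y u v = 0" and u: "u \<in> A"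
  shows "dif Y u v = 0"
proof -
  interpret tracefree_surface A Y N by fact
  have neg: "tracefree_surface A Y (\<lambda>u. - N u)"
  proof -
    have d: "dif (\<lambda>u. - N u) u = (\<lambda>v. - dif N u v)" if "u \<in> A" for u
      by (rule frechet_derivative_eq[OF has_derivative_minus[OF smooth_on_has_derivative[OF smooth(2) that]]])
    have "smooth_on A (\<lambda>u. - N u)"
      by (rule smooth_on_bounded_linear_compose[OF A bounded_linear_minus[OF bounded_linear_ident] smooth(2)])
    moreover have "inj (\<lambda>v. - dif N u v)" if "u \<in> A" for u
      using injN[OF that] by (simp add: inj_def)
    ultimately show ?thesis
      using A smooth(1) unit tangent tracefree symmetric by unfold_locales (simp_all add: d)
  qed
  \<comment> \<open>The projection point of the stereographic chart is avoided by replacing \<open>N\<close> by \<open>-N\<close>.\<close>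
  have local: "\<exists>r>0. ball a r \<subseteq> A \<and> (\<forall>S. open S \<longrightarrow> S \<noteq> {} \<longrightarrow> S \<subseteq> ball a r \<longrightarrow>
     (\<forall>u\<in>S. \<forall>v. dif Y u v = 0) \<longrightarrow> (\<forall>u\<in>ball a r. \<forall>v. dif Y u v = 0))" if a: "a \<in> A" for a
  proof (cases "N a $ 3 = 1")
    case False
    show ?thesis by (rule local_unique_continuation[OF a False])
  next
    case True
    then have "(- N a) $ 3 \<noteq> 1" by simp
    then show ?thesis by (rule tracefree_surface.local_unique_continuation[OF neg a])
  qed
  define Z where "Z = interior {u. \<forall>v. dif Y u v = 0}"
  have "(\<lambda>u. u \<in> Z) constant_on A"
  proof (rule locally_constant_imp_constant[OF assms(2)])
    fix a assume a: "a \<in> A"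
    obtain r where r: "r > 0" "ball a r \<subseteq> A"
      and uc: "\<And>S. open S \<Longrightarrow> S \<noteq> {} \<Longrightarrow> S \<subseteq> ball a r \<Longrightarrow> \<forall>u\<in>S. \<forall>v. dif Y u v = 0 \<Longrightarrow> \<forall>u\<in>ball a r. \<forall>v. dif Y u v = 0"
      using local[OF a] by blast
    have "Z \<inter> ball a r = {} \<or> ball a r \<subseteq> Z"
    proof (rule disjCI)
      assume "\<not> ball a r \<subseteq> Z"
      then have "\<not> (\<forall>u\<in>ball a r. \<forall>v. dif Y u v = 0)"
        unfolding Z_def using interior_maximal[of "ball a r" "{u. \<forall>v. dif Y u v = 0}"] by auto
      moreover have "\<forall>u\<in>Z \<inter> ball a r. \<forall>v. dif Y u v = 0"
        unfolding Z_def using interior_subset[of "{u. \<forall>v. dif Y u v = 0}"] by auto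
      moreover have "open (Z \<inter> ball a r)" by (simp add: Z_def open_Int)
      ultimately show "Z \<inter> ball a r = {}"
        using uc[of "Z \<inter> ball a r", OF _ _ Int_lower2] by metis
    qed
    moreover have "a \<in> ball a r" using r(1) by simp
    ultimately have "\<forall>x\<in>ball a r. (x \<in> Z) = (a \<in> Z)" by blast
    moreover have "openin (top_of_set A) (ball a r)" using r(2) by (simp add: openin_open_eq A)
    ultimately show "\<exists>T. openin (top_of_set A) T \<and> a \<in> T \<and> (\<forall>x\<in>T. (x \<in> Z) = (a \<in> Z))"
      using \<open>a \<in> ball a r\<close> by blast
  qed
  then obtain c where c: "\<And>u. u \<in> A \<Longrightarrow> (u \<in> Z) = c" unfolding constant_on_def by blast
  have "S \<subseteq> Z" unfolding Z_def by (rule interior_maximal[OF _ S(1)]) (use S(4) in auto)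
  moreover obtain x where "x \<in> S" using S(2) by blast
  ultimately have "x \<in> Z" "x \<in> A" using S(3) by blast+
  then have "u \<in> Z" using c[of x] c[OF u] by blast
  then have "u \<in> {u. \<forall>v. dif Y u v = 0}" unfolding Z_def by (rule subsetD[OF interior_subset])
  then show ?thesis by simp
qed

section \<open>Changes of parameters\<close>

text \<open>The left inverse in the definition is a right inverse as well, because \<open>\<phi>\<close> maps onto \<open>V\<close>.\<close>

lemma diffeomorphism_derivative:
  fixes \<phi> :: "'a::euclidean_space \<Rightarrow> 'a"
  assumes \<phi>: "diffeomorphism_betw W V \<phi>" and x: "x \<in> W"
  obtains \<phi>' \<psi>' where "(\<phi> has_derivative \<phi>') (at x)" "\<And>v. \<phi>' (\<psi>' v) = v" "\<phi> x \<in> V"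
proof -
  obtain \<psi> where W: "open W" "open V" "smooth_on W \<phi>" "\<phi> ` W = V" and \<psi>: "smooth_on V \<psi>" "\<And>x. x \<in> W \<Longrightarrow> \<psi> (\<phi> x) = x"
    using \<phi> unfolding diffeomorphism_betw_def by blast
  have y: "\<phi> x \<in> V" using W x by blast
  have \<phi>': "(\<phi> has_derivative dif \<phi> x) (at x)" using W(3) x by (rule smooth_on_has_derivative)
  have \<psi>': "(\<psi> has_derivative dif \<psi> (\<phi> x)) (at (\<phi> x))" using \<psi>(1) y by (rule smooth_on_has_derivative)
  have "(\<phi> has_derivative dif \<phi> x) (at (\<psi> (\<phi> x)))" using \<phi>' \<psi>(2)[OF x] by simp
  from has_derivative_compose[OF \<psi>' this]
  have "((\<lambda>y. \<phi> (\<psi> y)) has_derivative (\<lambda>v. dif \<phi> x (dif \<psi> (\<phi> x) v))) (at (\<phi> x))" .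
  moreover have "((\<lambda>y. \<phi> (\<psi> y)) has_derivative (\<lambda>v. v)) (at (\<phi> x))"
    by (rule has_derivative_transform_within_open[OF has_derivative_ident W(2) y]) (use W(4) \<psi>(2) in force)
  ultimately have "(\<lambda>v. dif \<phi> x (dif \<psi> (\<phi> x) v)) = (\<lambda>v. v)" by (rule has_derivative_unique)
  then have "dif \<phi> x (dif \<psi> (\<phi> x) v) = v" for v by (rule fun_cong)
  with \<phi>' y show ?thesis using that by blast
qed

lemma r_mean_curvature_reparametrize:
  fixes F N :: "'a::euclidean_space \<Rightarrow> 'b::euclidean_space" and \<phi> \<phi>' \<psi>' :: "'a \<Rightarrow> 'a"
  assumes "(F has_derivative dif F (\<phi> x)) (at (\<phi> x))" "(N has_derivative dif N (\<phi> x)) (at (\<phi> x))"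
    and "(\<phi> has_derivative \<phi>') (at x)" "\<And>v. \<phi>' (\<psi>' v) = v"
    and k: "principal_curvatures_at F N (\<phi> x) k"
  shows "r_mean_curvature r (\<lambda>x. F (\<phi> x)) (\<lambda>x. N (\<phi> x)) x = r_mean_curvature r F N (\<phi> x)"
proof -
  have lin: "linear (dif F (\<phi> x))" "linear (dif N (\<phi> x))"
    using assms(1,2) by (auto intro: has_derivative_linear)
  have d: "linear (dif (\<lambda>x. F (\<phi> x)) x)" "linear (dif (\<lambda>x. N (\<phi> x)) x)"
    using has_derivative_compose[OF assms(3,1)] has_derivative_compose[OF assms(3,2)]
    by (metis frechet_derivative_eq has_derivative_linear)+
  show ?thesis
    using r_mean_curvature_eq[OF lin k] r_mean_curvature_eq[OF d principal_curvatures_reparametrize[where \<phi>' = \<phi>' and \<psi>' = \<psi>', OF assms]] by simp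
qed

text \<open>On a parabolic profile the height \<open>z\<^sub>2 = C\<^sub>2 + 2 C\<^sub>1 tan \<theta>\<close> is a regular parameter, so
  \<open>\<theta>\<close> can replace the given parameter of the profile.\<close>

lemma tangent_reparametrization:
  fixes z2 z2' :: "real \<Rightarrow> real" and U :: "'a::euclidean_space set"
  assumes U: "open U" and J: "open J" "w0 \<in> J" and C1: "C1 > 0"
    and profile: "smooth_on J z2" "\<forall>w\<in>J. (z2 has_real_derivative z2' w) (at w)" "\<forall>w\<in>J. z2' w \<noteq> 0"
  obtains \<Theta> J0 h where "\<Theta> \<subseteq> {-pi/2<..<pi/2}" "w0 \<in> J0" "J0 \<subseteq> J"
    "\<forall>\<theta>\<in>\<Theta>. h \<theta> \<in> J0 \<and> C2 + 2 * C1 * tan \<theta> = z2 (h \<theta>)"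
    "diffeomorphism_betw (U \<times> \<Theta>) (U \<times> J0) (\<lambda>(u, \<theta>). (u, h \<theta>))"
proof -
  have z2: "smooth_on J z2" "\<And>w. w \<in> J \<Longrightarrow> (z2 has_real_derivative z2' w) (at w)" "\<And>w. w \<in> J \<Longrightarrow> z2' w \<noteq> 0"
    using profile by blast+
  have dz: "dif z2 w = (*) (z2' w)" if "w \<in> J" for w
    using z2(2)[OF that] by (auto simp: has_field_derivative_def intro: frechet_derivative_eq)
  have inj: "\<forall>w\<in>J. inj (dif z2 w)" using dz z2(3) by (auto simp: inj_def)
  obtain r g where r: "r > 0" "ball w0 r \<subseteq> J" "open (z2 ` ball w0 r)" "continuous_on (z2 ` ball w0 r) g"
    and g: "\<forall>x\<in>ball w0 r. g (z2 x) = x"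
    and dg: "\<forall>x\<in>ball w0 r. \<forall>g'. bounded_linear g' \<longrightarrow> g' \<circ> dif z2 x = id \<longrightarrow> (g has_derivative g') (at (z2 x))"
    by (rule smooth_local_inverse[OF J(1) z2(1) J(2) inj]) simp
  define B where "B = ball w0 r"
  have B: "open B" "B \<subseteq> J" "w0 \<in> B" using r by (auto simp: B_def)
  have gB: "g y \<in> B" "z2 (g y) = y" if "y \<in> z2 ` B" for y using that g by (auto simp: B_def)
  have "smooth_on (z2 ` B) g"
  proof (rule Ck_on_autonomous_ode[where T = B and g = "\<lambda>x. inverse (z2' x)"])
    show "open (z2 ` B)" using r by (simp add: B_def)
    show "g ` (z2 ` B) \<subseteq> B" using gB by blast
    have "smooth_on J z2'"
      by (rule smooth_on_cong[OF J(1) smooth_on_derivative[OF z2(1), of 1]]) (simp add: dz)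
    then have sz: "smooth_on B z2'" using B(2) by (rule smooth_on_subset)
    show "smooth_on B (\<lambda>x. inverse (z2' x))"
      by (rule smooth_on_real_compose[OF B(1) _ smooth_on_inverse sz]) (use z2(3) B(2) in auto)
    fix y assume "y \<in> z2 ` B"
    then obtain x where x: "x \<in> B" "y = z2 x" by blast
    have "x \<in> J" using x B by blast
    then have "(*) (inverse (z2' x)) \<circ> dif z2 x = id" using dz z2(3) by (auto simp: fun_eq_iff)
    then have "(g has_derivative (*) (inverse (z2' x))) (at (z2 x))"
      using dg x(1) bounded_linear_mult_right unfolding B_def by blast
    moreover have "g y = x" using g x by (simp add: B_def)
    ultimately show "(g has_real_derivative inverse (z2' (g y))) (at y)"
      by (simp add: has_field_derivative_def x(2))
  qed
  note sg = this
  define t where "t \<theta> = C2 + 2 * C1 * tan \<theta>" for \<theta>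
  define a where "a w = arctan ((z2 w - C2) / (2 * C1))" for w
  have st: "smooth_on {-pi/2<..<pi/2} t"
    unfolding t_def[abs_def] mult.assoc
    by (intro smooth_on_add smooth_on_const smooth_on_cmult smooth_on_tan) auto
  define \<Theta> where "\<Theta> = {-pi/2<..<pi/2} \<inter> t -` (z2 ` B)"
  have op\<Theta>: "open \<Theta>" unfolding \<Theta>_def
    by (rule continuous_open_preimage[OF smooth_on_imp_continuous_on[OF st]]) (use r in \<open>auto simp: B_def\<close>)
  define h where "h \<theta> = g (t \<theta>)" for \<theta>
  have sh: "smooth_on \<Theta> h" unfolding h_def[abs_def]
    by (rule smooth_on_real_compose[OF op\<Theta> _ sg smooth_on_subset[OF st]]) (auto simp: \<Theta>_def)
  have sa: "smooth_on B a"
    unfolding a_def[abs_def]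
  proof (rule smooth_on_real_compose[OF B(1) _ smooth_on_arctan])
    have "smooth_on B (\<lambda>w. 1 / (2 * C1) * (z2 w + - C2))"
      by (intro smooth_on_cmult smooth_on_add smooth_on_const smooth_on_subset[OF z2(1) B(2)] B(1))
    then show "smooth_on B (\<lambda>w. (z2 w - C2) / (2 * C1))" by (simp add: field_simps)
  qed simp
  have ta: "t (a w) = z2 w" for w using C1 by (simp add: t_def a_def tan_arctan)
  have a\<Theta>: "a w \<in> \<Theta>" if "w \<in> B" for w
    using that arctan_bounded[of "(z2 w - C2) / (2 * C1)"] ta[of w] by (auto simp: \<Theta>_def a_def)
  have ha: "h (a w) = w" if "w \<in> B" for w using that g by (simp add: h_def ta B_def)
  have hB: "h \<theta> \<in> B" "z2 (h \<theta>) = t \<theta>" if "\<theta> \<in> \<Theta>" for \<theta> using that gB by (auto simp: \<Theta>_def h_def)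
  have ah: "a (h \<theta>) = \<theta>" if "\<theta> \<in> \<Theta>" for \<theta>
    using that C1 hB(2)[OF that] by (auto simp: a_def t_def \<Theta>_def intro!: arctan_tan)
  have prod: "smooth_on (U \<times> S) (\<lambda>(u, w). (u, f w))" if "open S" "smooth_on S f" for S :: "real set" and f :: "real \<Rightarrow> real"
  proof -
    have o: "open (U \<times> S)" using U that(1) by (rule open_Times)
    have "smooth_on (U \<times> S) (\<lambda>p. f (snd p))"
      by (rule smooth_on_real_compose[OF o _ that(2) smooth_on_bounded_linear[OF o bounded_linear_snd]]) auto
    from smooth_on_Pair[OF o smooth_on_bounded_linear[OF o bounded_linear_fst] this]
    show ?thesis by (simp add: case_prod_beta')
  qed
  show ?thesis
  proof (rule that[of \<Theta> B h])
    show "\<Theta> \<subseteq> {-pi/2<..<pi/2}" by (auto simp: \<Theta>_def)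
    show "w0 \<in> B" "B \<subseteq> J" by (rule B)+
    show "\<forall>\<theta>\<in>\<Theta>. h \<theta> \<in> B \<and> C2 + 2 * C1 * tan \<theta> = z2 (h \<theta>)" using hB by (simp add: t_def)
    have "(\<lambda>(u, \<theta>). (u, h \<theta>)) ` (U \<times> \<Theta>) = U \<times> B"
    proof (intro equalityI subsetI)
      fix p assume "p \<in> U \<times> B"
      then obtain u w where p: "p = (u, w)" "u \<in> U" "w \<in> B" by blast
      then show "p \<in> (\<lambda>(u, \<theta>). (u, h \<theta>)) ` (U \<times> \<Theta>)"
        using a\<Theta> ha by (intro image_eqI[of _ _ "(u, a w)"]) auto
    qed (use hB in auto)
    moreover have "\<exists>\<psi>. smooth_on (U \<times> B) \<psi> \<and> (\<forall>x\<in>U \<times> \<Theta>. \<psi> ((\<lambda>(u, \<theta>). (u, h \<theta>)) x) = x)"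
      by (rule exI[of _ "\<lambda>(u, w). (u, a w)"]) (use prod[OF B(1) sa] ah in auto)
    ultimately show "diffeomorphism_betw (U \<times> \<Theta>) (U \<times> B) (\<lambda>(u, \<theta>). (u, h \<theta>))"
      unfolding diffeomorphism_betw_def using prod[OF op\<Theta> sh] U op\<Theta> B(1) by (auto intro: open_Times)
  qed
qed

section \<open>The two models have vanishing second mean curvature\<close>

lemma cos_nonzero: "\<theta> \<in> {-pi/2<..<pi/2} \<Longrightarrow> cos \<theta> \<noteq> 0"
  using cos_gt_zero_pi[of \<theta>] by auto

lemma sec_squared: "cos \<theta> \<noteq> 0 \<Longrightarrow> sec \<theta> ^ 2 = 1 + (tan \<theta>)\<^sup>2"
  by (simp add: sec_def tan_sec power_divide inverse_eq_divide power_one_over)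

text \<open>Both models are described at once: the directrix is minimal for \<open>c = 0\<close>, and it is a sphere
  of radius \<open>r\<close> with outward normal for \<open>c = r\<close>; in both cases \<open>k\<^sub>0 + k\<^sub>1 + 2 c k\<^sub>0 k\<^sub>1 = 0\<close>.\<close>

lemma parabolic_profile_zero_curvature:
  fixes Y N :: "real^2 \<Rightarrow> real^3"
  assumes C1: "C1 > 0" and B: "rigid_motion B"
    and Y: "immersion_on U Y" "gauss_map_on U Y N"
    and W: "open W" "W \<subseteq> U \<times> {-pi/2<..<pi/2}"
    and weingarten: "\<And>u k. u \<in> U \<Longrightarrow> principal_curvatures_at Y N u k \<Longrightarrow> k 0 + k 1 + 2 * c * (k 0 * k 1) = 0"
    and regular: "\<And>u \<theta> k. (u, \<theta>) \<in> W \<Longrightarrow> principal_curvatures_at Y N u k \<Longrightarrow>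
      1 - (C1 * sec \<theta> ^ 2 - c) * k 0 \<noteq> 0 \<and> 1 - (C1 * sec \<theta> ^ 2 - c) * k 1 \<noteq> 0"
    and G: "\<And>u \<theta>. (u, \<theta>) \<in> W \<Longrightarrow>
      G (u, \<theta>) = B (emb (Y u) + (C1 * sec \<theta> ^ 2 - c) *\<^sub>R emb (N u) + (C2 + 2 * C1 * tan \<theta>) *\<^sub>R e4)"
    and \<eta>: "continuous_on W \<eta>" "\<And>p. p \<in> W \<Longrightarrow> norm (\<eta> p) = 1" "\<And>p v. p \<in> W \<Longrightarrow> dif G p v \<bullet> \<eta> p = 0"
    and q: "(u, \<theta>) \<in> W"
  shows "r_mean_curvature 2 G \<eta> (u, \<theta>) = 0"
proof -
  obtain R t0 where R: "orthogonal_transformation R" "\<And>x. B x = t0 + R x"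
    using B unfolding rigid_motion_def by metis
  define z1 z1' z1'' z2' z2'' where "z1 \<theta> = C1 * sec \<theta> ^ 2 - c"
    and "z1' \<theta> = 2 * C1 * (1 + (tan \<theta>)\<^sup>2) * tan \<theta>"
    and "z1'' \<theta> = 2 * C1 * (1 + 3 * (tan \<theta>)\<^sup>2) * (1 + (tan \<theta>)\<^sup>2)"
    and "z2' \<theta> = 2 * C1 * (1 + (tan \<theta>)\<^sup>2)"
    and "z2'' \<theta> = 4 * C1 * tan \<theta> * (1 + (tan \<theta>)\<^sup>2)" for \<theta>
  have dtan: "(tan has_real_derivative 1 + (tan \<theta>)\<^sup>2) (at \<theta>)" if "\<theta> \<in> {-pi/2<..<pi/2}" for \<theta>
    using DERIV_tan[OF cos_nonzero[OF that]] cos_nonzero[OF that] by (simp add: tan_sec power_inverse)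
  interpret profile_over_surface U Y N "{-pi/2<..<pi/2}" z1 "\<lambda>\<theta>. C2 + 2 * C1 * tan \<theta>" z1' z2' z1'' z2'' W R t0
  proof
    show "open U" "smooth_on U Y" "\<And>u. u \<in> U \<Longrightarrow> inj (dif Y u)" using Y(1) by (auto simp: immersion_on_def)
    show "gauss_map_on U Y N" "open W" "W \<subseteq> U \<times> {-pi/2<..<pi/2}" "orthogonal_transformation R" by fact+
    show "1 - z1 w * k 0 \<noteq> 0 \<and> 1 - z1 w * k 1 \<noteq> 0" if "(u, w) \<in> W" "principal_curvatures_at Y N u k" for u w k
      using regular[OF that] by (simp add: z1_def)
    fix w :: real assume w: "w \<in> {-pi/2<..<pi/2}"
    have "((\<lambda>\<theta>. C1 * (1 + (tan \<theta>)\<^sup>2) - c) has_real_derivative z1' w) (at w)"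
      by (rule derivative_eq_intros dtan[OF w] refl | simp add: z1'_def)+
    then show "(z1 has_real_derivative z1' w) (at w)"
      by (rule has_field_derivative_transform_within_open[OF _ open_greaterThanLessThan w])
        (use sec_squared cos_nonzero in \<open>auto simp: z1_def\<close>)
    show "((\<lambda>\<theta>. C2 + 2 * C1 * tan \<theta>) has_real_derivative z2' w) (at w)"
      by (rule derivative_eq_intros dtan[OF w] refl | simp add: z2'_def)+
    show "(z1' has_real_derivative z1'' w) (at w)"
      unfolding z1'_def[abs_def]
      by (rule derivative_eq_intros dtan[OF w] refl)+ (simp add: z1''_def algebra_simps power2_eq_square)
    show "(z2' has_real_derivative z2'' w) (at w)"
      unfolding z2'_def[abs_def]
      by (rule derivative_eq_intros dtan[OF w] refl)+ (simp add: z2''_def algebra_simps power2_eq_square)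
    have "1 + (tan w)\<^sup>2 > 0" by (simp add: add_pos_nonneg)
    then have "z2' w \<noteq> 0" using C1 by (simp add: z2'_def)
    then show "(z1' w)\<^sup>2 + (z2' w)\<^sup>2 > 0" by (simp add: add_nonneg_pos)
  qed
  have uU: "u \<in> U" using q W by auto
  have th: "cos \<theta> \<noteq> 0" using q W cos_nonzero by blast
  obtain k where k: "principal_curvatures_at Y N u k"
    using principal_curvatures_exist[OF surface(2,3,1) uU surface(4)[OF uU]] by blast
  have GX: "G p = X p" if "p \<in> W" for p
    using that G by (cases p) (simp add: X_def R(2) z1_def)
  define s where "s = 1 + (tan \<theta>)\<^sup>2"
  have z1: "z1 \<theta> = C1 * s - c" using sec_squared[OF th] by (simp add: z1_def s_def)
  have "bending \<theta> = 4 * C1\<^sup>2 * s ^ 3"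
    unfolding bending_def z1'_def z1''_def z2'_def z2''_def s_def by algebra
  moreover have "(z1' \<theta>)\<^sup>2 + (z2' \<theta>)\<^sup>2 = 4 * C1\<^sup>2 * s ^ 3"
    unfolding z1'_def z2'_def s_def by algebra
  moreover have "z2' \<theta> = 2 * C1 * s" by (simp add: z2'_def s_def)
  ultimately have "z2' \<theta> * (k 0 * k 1) * ((z1' \<theta>)\<^sup>2 + (z2' \<theta>)\<^sup>2)
        + bending \<theta> * (k 0 + k 1 - 2 * z1 \<theta> * (k 0 * k 1))
      = 4 * C1\<^sup>2 * s ^ 3 * (k 0 + k 1 + 2 * c * (k 0 * k 1))"
    unfolding z1 by algebra
  then show ?thesis
    using mean_curvatures_any_normal(1)[OF q k GX \<eta>] weingarten[OF uU k] by simp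
qed

text \<open>The value of \<open>H\<^sub>2\<close> at \<open>q\<close> can be computed in the parametrization \<open>X = F \<circ> \<phi>\<close>, with the normal
  \<open>\<eta> \<circ> \<phi>\<close>.\<close>

lemma parametrizes_near_zero_curvature:
  fixes F \<eta> :: "(real^2) \<times> real \<Rightarrow> real^4"
  assumes p: "parametrizes_near D F q W X"
    and F: "\<And>p. p \<in> D \<Longrightarrow> (F has_derivative dif F p) (at p)" and \<eta>: "gauss_map_on D F \<eta>"
    and k: "principal_curvatures_at F \<eta> q k"
    and zero: "\<And>G \<eta>' x. open W \<Longrightarrow> (\<And>p. p \<in> W \<Longrightarrow> G p = X p) \<Longrightarrow> continuous_on W \<eta>' \<Longrightarrow>
      (\<And>p. p \<in> W \<Longrightarrow> norm (\<eta>' p) = 1) \<Longrightarrow> (\<And>p v. p \<in> W \<Longrightarrow> dif G p v \<bullet> \<eta>' p = 0) \<Longrightarrow> x \<in> W \<Longrightarrow>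
      r_mean_curvature 2 G \<eta>' x = 0"
  shows "r_mean_curvature 2 F \<eta> q = 0"
proof -
  obtain V \<phi> where V: "V \<subseteq> D" "q \<in> V" and \<phi>: "diffeomorphism_betw W V \<phi>" and X: "\<And>x. x \<in> W \<Longrightarrow> X x = F (\<phi> x)"
    using p unfolding parametrizes_near_def by blast
  have \<phi>W: "open W" "smooth_on W \<phi>" "\<phi> ` W = V" using \<phi> by (auto simp: diffeomorphism_betw_def)
  then obtain x where x: "x \<in> W" "\<phi> x = q" using V(2) by blast
  have d\<eta>: "(\<eta> has_derivative dif \<eta> p) (at p)" if "p \<in> D" for p
    using \<eta> that by (auto simp: gauss_map_on_def intro: smooth_on_has_derivative)
  have \<phi>D: "\<phi> y \<in> D" if "y \<in> W" for y using that \<phi>W V by blast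
  have "r_mean_curvature 2 (\<lambda>x. F (\<phi> x)) (\<lambda>x. \<eta> (\<phi> x)) x = 0"
  proof (rule zero[OF \<phi>W(1) _ _ _ _ x(1)])
    show "F (\<phi> y) = X y" if "y \<in> W" for y using X[OF that] by simp
    show "continuous_on W (\<lambda>x. \<eta> (\<phi> x))"
      by (rule continuous_on_compose2[OF smooth_on_imp_continuous_on smooth_on_imp_continuous_on[OF \<phi>W(2)]])
        (use \<eta> \<phi>D in \<open>auto simp: gauss_map_on_def\<close>)
    show "norm (\<eta> (\<phi> y)) = 1" if "y \<in> W" for y
      using \<eta> \<phi>D[OF that] by (simp add: gauss_map_on_def)
    show "dif (\<lambda>x. F (\<phi> x)) y v \<bullet> \<eta> (\<phi> y) = 0" if y: "y \<in> W" for y v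
    proof -
      obtain \<phi>' \<psi>' where "(\<phi> has_derivative \<phi>') (at y)" by (rule diffeomorphism_derivative[OF \<phi> y])
      note frechet_derivative_eq[OF has_derivative_compose[OF this F[OF \<phi>D[OF y]]]]
      moreover have "dif F (\<phi> y) w \<bullet> \<eta> (\<phi> y) = 0" for w
        using \<eta> \<phi>D[OF y] unfolding gauss_map_on_def by blast
      ultimately show ?thesis by simp
    qed
  qed
  moreover obtain \<phi>' \<psi>' where "(\<phi> has_derivative \<phi>') (at x)" "\<And>v. \<phi>' (\<psi>' v) = v"
    using diffeomorphism_derivative[OF \<phi> x(1)] by metis
  from r_mean_curvature_reparametrize[OF F[OF \<phi>D[OF x(1)]] d\<eta>[OF \<phi>D[OF x(1)]] this k[folded x(2)], of 2]
  have "r_mean_curvature 2 (\<lambda>x. F (\<phi> x)) (\<lambda>x. \<eta> (\<phi> x)) x = r_mean_curvature 2 F \<eta> q" by (simp only: x(2))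
  ultimately show ?thesis by simp
qed

lemma minimal_type_zero_curvature:
  assumes C1: "C1 > 0" and B: "rigid_motion B" and Y: "minimal_surface_on U Y N"
    and W: "W \<subseteq> minimal_type_domain C1 U Y N" "open W"
    and G: "\<And>p. p \<in> W \<Longrightarrow> G p = (B \<circ> minimal_type_map C1 C2 Y N) p"
    and \<eta>: "continuous_on W \<eta>" "\<And>p. p \<in> W \<Longrightarrow> norm (\<eta> p) = 1" "\<And>p v. p \<in> W \<Longrightarrow> dif G p v \<bullet> \<eta> p = 0"
    and x: "x \<in> W"
  shows "r_mean_curvature 2 G \<eta> x = 0"
proof -
  obtain u \<theta> where q: "x = (u, \<theta>)" by (cases x)
  have Y': "immersion_on U Y" "gauss_map_on U Y N" using Y by (auto simp: minimal_surface_on_def)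
  have lin: "linear (dif Y u)" "linear (dif N u)" if "u \<in> U" for u
    using Y' that by (auto simp: immersion_on_def gauss_map_on_def intro!: has_derivative_linear smooth_on_has_derivative)
  have H: "k 0 + k 1 = 0" if "u \<in> U" "principal_curvatures_at Y N u k" for u k
    using mean_curvatures_surface(1)[OF lin[OF that(1)] that(2)] Y that(1) by (simp add: minimal_surface_on_def)
  show ?thesis unfolding q
  proof (rule parabolic_profile_zero_curvature[OF C1 B Y' W(2), where c = 0 and ?C2.0 = C2])
    show "W \<subseteq> U \<times> {-pi/2<..<pi/2}" using W(1) by (auto simp: minimal_type_domain_def)
    show "k 0 + k 1 + 2 * 0 * (k 0 * k 1) = 0" if "u \<in> U" "principal_curvatures_at Y N u k" for u k
      using H[OF that] by simp
    show "G (u, \<theta>) = B (emb (Y u) + (C1 * (sec \<theta>)\<^sup>2 - 0) *\<^sub>R emb (N u) + (C2 + 2 * C1 * tan \<theta>) *\<^sub>R e4)"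
      if "(u, \<theta>) \<in> W" for u \<theta>
      using G[OF that] by (simp add: minimal_type_map_def)
    show "1 - (C1 * (sec \<theta>)\<^sup>2 - 0) * k 0 \<noteq> 0 \<and> 1 - (C1 * (sec \<theta>)\<^sup>2 - 0) * k 1 \<noteq> 0"
      if q: "(u, \<theta>) \<in> W" and k: "principal_curvatures_at Y N u k" for u \<theta> k
    proof -
      have u: "u \<in> U" and ne: "1 + C1\<^sup>2 * gaussian_curvature Y N u * sec \<theta> ^ 4 \<noteq> 0"
        using W(1) q by (auto simp: minimal_type_domain_def)
      have K: "gaussian_curvature Y N u = k 0 * k 1"
        unfolding gaussian_curvature_def using mean_curvatures_surface(2)[OF lin[OF u] k] .
      have "1 + C1\<^sup>2 * (k 0 * k 1) * sec \<theta> ^ 4 = (1 - C1 * (sec \<theta>)\<^sup>2 * k 0) * (1 - C1 * (sec \<theta>)\<^sup>2 * k 1)"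
        using H[OF u k] by algebra
      then show ?thesis using ne unfolding K by auto
    qed
  qed (use \<eta> x q in auto)
qed

lemma sphere_gauss_map:
  assumes Y: "sphere_parametrization_on U r Y" and r: "r > 0"
  shows "gauss_map_on U Y (\<lambda>u. (1 / r) *\<^sub>R Y u)"
    and "u \<in> U \<Longrightarrow> principal_curvatures_at Y (\<lambda>u. (1 / r) *\<^sub>R Y u) u k \<Longrightarrow> k 0 = - 1 / r \<and> k 1 = - 1 / r"
proof -
  have U: "open U" "smooth_on U Y" "\<And>u. u \<in> U \<Longrightarrow> norm (Y u) = r"
    using Y by (auto simp: sphere_parametrization_on_def immersion_on_def)
  have dY: "(Y has_derivative dif Y u) (at u)" if "u \<in> U" for u using U(2) that by (rule smooth_on_has_derivative)
  have tan: "dif Y u v \<bullet> Y u = 0" if u: "u \<in> U" for u v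
  proof -
    have "((\<lambda>u. Y u \<bullet> Y u) has_derivative (\<lambda>v. 0)) (at u)"
      by (rule has_derivative_transform_within_open[OF has_derivative_const[of "r\<^sup>2"] U(1) u])
        (use U(3) in \<open>simp flip: power2_norm_eq_inner\<close>)
    from has_derivative_unique[OF has_derivative_inner[OF dY[OF u] dY[OF u]] this]
    have "Y u \<bullet> dif Y u v + dif Y u v \<bullet> Y u = 0" by (rule fun_cong)
    then show ?thesis by (simp add: inner_commute)
  qed
  show "gauss_map_on U Y (\<lambda>u. (1 / r) *\<^sub>R Y u)"
    unfolding gauss_map_on_def using smooth_on_cscaleR[OF U(1,2)] tan U(3) r by simp
  assume u: "u \<in> U" and k: "principal_curvatures_at Y (\<lambda>u. (1 / r) *\<^sub>R Y u) u k"
  obtain b where b: "\<forall>i<DIM(real^2). \<forall>j<DIM(real^2). dif Y u (b i) \<bullet> dif Y u (b j) = (if i = j then 1 else 0)"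
    "\<forall>i<DIM(real^2). dif (\<lambda>u. (1 / r) *\<^sub>R Y u) u (b i) = - (k i *\<^sub>R dif Y u (b i))"
    using k unfolding principal_curvatures_at_def by blast
  have d: "dif (\<lambda>u. (1 / r) *\<^sub>R Y u) u = (\<lambda>v. (1 / r) *\<^sub>R dif Y u v)"
    by (rule frechet_derivative_eq[OF has_derivative_scaleR_right[OF dY[OF u]]])
  have "k i = - 1 / r" if "i < 2" for i
  proof -
    have 1: "dif Y u (b i) \<bullet> dif Y u (b i) = 1" using b(1) that by simp
    have "(1 / r) *\<^sub>R dif Y u (b i) = - (k i *\<^sub>R dif Y u (b i))" using b(2) that by (simp add: d)
    then have "((1 / r) *\<^sub>R dif Y u (b i)) \<bullet> dif Y u (b i) = (- (k i *\<^sub>R dif Y u (b i))) \<bullet> dif Y u (b i)" by simp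
    then show ?thesis using 1 by simp
  qed
  then show "k 0 = - 1 / r \<and> k 1 = - 1 / r" by simp
qed

lemma sphere_type_zero_curvature:
  assumes C1: "C1 > 0" and B: "rigid_motion B" and r: "r > 0" and Y: "sphere_parametrization_on U r Y"
    and W: "W \<subseteq> sphere_type_domain C1 U" "open W"
    and G: "\<And>p. p \<in> W \<Longrightarrow> G p = (B \<circ> sphere_type_map C1 C2 r Y) p"
    and \<eta>: "continuous_on W \<eta>" "\<And>p. p \<in> W \<Longrightarrow> norm (\<eta> p) = 1" "\<And>p v. p \<in> W \<Longrightarrow> dif G p v \<bullet> \<eta> p = 0"
    and x: "x \<in> W"
  shows "r_mean_curvature 2 G \<eta> x = 0"
proof -
  obtain u \<theta> where q: "x = (u, \<theta>)" by (cases x)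
  have Y': "immersion_on U Y" using Y by (auto simp: sphere_parametrization_on_def)
  note N = sphere_gauss_map[OF Y r]
  show ?thesis unfolding q
  proof (rule parabolic_profile_zero_curvature[OF C1 B Y' N(1) W(2), where c = r and ?C2.0 = C2])
    show "W \<subseteq> U \<times> {-pi/2<..<pi/2}" using W(1) by (auto simp: sphere_type_domain_def)
    show "k 0 + k 1 + 2 * r * (k 0 * k 1) = 0"
      if "u \<in> U" "principal_curvatures_at Y (\<lambda>u. (1 / r) *\<^sub>R Y u) u k" for u k
    proof -
      have "k 0 = - 1 / r" "k 1 = - 1 / r" using N(2)[OF that] by auto
      then have "k 0 + k 1 + 2 * r * (k 0 * k 1) = (- 1 / r) + (- 1 / r) + 2 * r * ((- 1 / r) * (- 1 / r))"
        by (simp only:)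
      then show ?thesis using r by simp
    qed
    show "G (u, \<theta>) = B (emb (Y u) + (C1 * (sec \<theta>)\<^sup>2 - r) *\<^sub>R emb ((1 / r) *\<^sub>R Y u) + (C2 + 2 * C1 * tan \<theta>) *\<^sub>R e4)"
      if "(u, \<theta>) \<in> W" for u \<theta>
    proof -
      have "emb (Y u) + (C1 * (sec \<theta>)\<^sup>2 - r) *\<^sub>R emb ((1 / r) *\<^sub>R Y u) = (C1 * (sec \<theta>)\<^sup>2 / r) *\<^sub>R emb (Y u)"
        using r by (simp add: linear_scale[OF linear_emb] diff_divide_distrib scaleR_diff_left)
      then show ?thesis using G[OF that] by (simp add: sphere_type_map_def)
    qed
    show "1 - (C1 * (sec \<theta>)\<^sup>2 - r) * k 0 \<noteq> 0 \<and> 1 - (C1 * (sec \<theta>)\<^sup>2 - r) * k 1 \<noteq> 0"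
      if q: "(u, \<theta>) \<in> W" and k: "principal_curvatures_at Y (\<lambda>u. (1 / r) *\<^sub>R Y u) u k" for u \<theta> k
    proof -
      have u: "u \<in> U" and ne: "C1 * (sec \<theta>)\<^sup>2 \<noteq> 0"
        using W(1) q by (auto simp: sphere_type_domain_def)
      have "1 - (C1 * (sec \<theta>)\<^sup>2 - r) * (- 1 / r) = C1 * (sec \<theta>)\<^sup>2 / r" using r by (simp add: field_simps)
      then show ?thesis using N(2)[OF u k] ne r by simp
    qed
  qed (use \<eta> x q in auto)
qed

section \<open>Parallel surfaces\<close>

lemma cross_with_orthogonal_zero:
  fixes n p q :: "real^3"
  assumes "n \<bullet> p = 0" "n \<bullet> q = 0" "n \<bullet> n = 1" "cross3 p q \<bullet> n = 0"
  shows "cross3 p q = 0"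
proof -
  have "cross3 n (cross3 p q) = 0" using assms by (simp add: Lagrange)
  then show ?thesis using norm_and_cross_eq_0[of n "cross3 p q"] assms(3,4) by (auto simp: inner_commute)
qed

text \<open>A vector product of tangent vectors is normal, so a vanishing area would make the two
  coordinate directions of the immersion dependent.\<close>

lemma area_nonzero:
  fixes Y N :: "real^2 \<Rightarrow> real^3"
  assumes lin: "linear (dif Y u)" and inj: "inj (dif Y u)"
    and n: "N u \<bullet> N u = 1" "\<And>v. N u \<bullet> dif Y u v = 0"
  shows "cross3 (dif Y u (axis 1 1)) (dif Y u (axis 2 1)) \<bullet> N u \<noteq> 0"
proof
  let ?p = "dif Y u (axis 1 1)" and ?q = "dif Y u (axis 2 1)"
  assume "cross3 ?p ?q \<bullet> N u = 0"
  then have "cross3 ?p ?q = 0" by (rule cross_with_orthogonal_zero[OF n(2) n(2) n(1)])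
  then have "(?p \<bullet> ?q) *\<^sub>R ?p - (?p \<bullet> ?p) *\<^sub>R ?q = 0" using Lagrange[of ?p ?p ?q] by simp
  then have "dif Y u ((?p \<bullet> ?q) *\<^sub>R axis 1 1 - (?p \<bullet> ?p) *\<^sub>R axis 2 1) = dif Y u 0"
    by (simp add: linear_diff[OF lin] linear_scale[OF lin] linear_0[OF lin])
  then have eq: "(?p \<bullet> ?q) *\<^sub>R axis 1 1 - (?p \<bullet> ?p) *\<^sub>R axis 2 1 = (0::real^2)" using inj by (auto dest: injD)
  have "((?p \<bullet> ?q) *\<^sub>R axis 1 1 - (?p \<bullet> ?p) *\<^sub>R axis 2 1 :: real^2) $ 2 = - (?p \<bullet> ?p)"
    by (simp add: axis_def)
  then have "?p = 0" using eq by simp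
  then have "axis 1 1 = (0::real^2)" using inj linear_0[OF lin] by (metis injD)
  then show False by (simp add: axis_eq_0_iff)
qed

lemma principal_curvatures_scale_normal:
  fixes Y N :: "'a::euclidean_space \<Rightarrow> 'b::euclidean_space"
  assumes "(N has_derivative dif N u) (at u)" "principal_curvatures_at Y N u k"
  shows "principal_curvatures_at Y (\<lambda>u. s *\<^sub>R N u) u (\<lambda>i. s * k i)"
proof -
  have d: "dif (\<lambda>u. s *\<^sub>R N u) u = (\<lambda>v. s *\<^sub>R dif N u v)"
    by (rule frechet_derivative_eq[OF has_derivative_scaleR_right[OF assms(1)]])
  obtain b where b: "\<forall>i<DIM('a). \<forall>j<DIM('a). dif Y u (b i) \<bullet> dif Y u (b j) = (if i = j then 1 else 0)"
    "\<forall>i<DIM('a). dif N u (b i) = - (k i *\<^sub>R dif Y u (b i))"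
    using assms(2) unfolding principal_curvatures_at_def by blast
  show ?thesis unfolding principal_curvatures_at_def d
    by (rule exI[of _ b], intro conjI b(1)) (use b(2) in simp)
qed

text \<open>If \<open>(1/k\<^sub>0 + 1/k\<^sub>1) / 2 = c\<close>, the surface at distance \<open>c\<close> is minimal wherever it is
  immersed; it fails to be immersed only by having zero differential, at umbilics with
  \<open>k\<^sub>0 = k\<^sub>1 = 1/c\<close>.\<close>

lemma parallel_surface_curvatures:
  fixes Y N :: "real^2 \<Rightarrow> real^3"
  assumes dY: "(Y has_derivative dif Y u) (at u)" and dN: "(N has_derivative dif N u) (at u)"
    and k: "principal_curvatures_at Y N u k" and K: "k 0 * k 1 \<noteq> 0" and c: "k 0 + k 1 = 2 * c * (k 0 * k 1)"
  shows "dif (\<lambda>u. Y u + c *\<^sub>R N u) u = (\<lambda>v. dif Y u v + c *\<^sub>R dif N u v)"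
    and "dif (\<lambda>u. Y u + c *\<^sub>R N u) u v \<noteq> 0 \<Longrightarrow> 1 - c * k 0 \<noteq> 0 \<and> 1 - c * k 1 \<noteq> 0 \<and>
      inj (dif (\<lambda>u. Y u + c *\<^sub>R N u) u) \<and>
      principal_curvatures_at (\<lambda>u. Y u + c *\<^sub>R N u) N u (\<lambda>i. k i / (1 - c * k i))"
proof -
  have der: "((\<lambda>u. Y u + c *\<^sub>R N u) has_derivative (\<lambda>v. dif Y u v + c *\<^sub>R dif N u v)) (at u)"
    by (intro has_derivative_add has_derivative_scaleR_right dY dN)
  show d: "dif (\<lambda>u. Y u + c *\<^sub>R N u) u = (\<lambda>v. dif Y u v + c *\<^sub>R dif N u v)"
    by (rule frechet_derivative_eq[OF der])
  have lin: "linear (dif Y u)" "linear (dif N u)" using dY dN by (auto intro: has_derivative_linear)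
  obtain b :: "nat \<Rightarrow> real^2" where
    on: "\<forall>i<DIM(real^2). \<forall>j<DIM(real^2). dif Y u (b i) \<bullet> dif Y u (b j) = (if i = j then 1 else 0)"
    and ev: "\<forall>i<DIM(real^2). dif N u (b i) = - (k i *\<^sub>R dif Y u (b i))"
    using k unfolding principal_curvatures_at_def by blast
  define L where "L v = dif Y u v + c *\<^sub>R dif N u v" for v
  have linL: "linear L" unfolding L_def[abs_def] using has_derivative_linear[OF der] .
  have Lb: "L (b i) = (1 - c * k i) *\<^sub>R dif Y u (b i)" if "i < 2" for i
    using ev that by (simp add: L_def algebra_simps)
  assume v: "dif (\<lambda>u. Y u + c *\<^sub>R N u) u v \<noteq> 0"
  have prod: "k 1 * (1 - c * k 0) + k 0 * (1 - c * k 1) = 0" using c by (simp add: algebra_simps)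
  have k0: "k 0 \<noteq> 0" "k 1 \<noteq> 0" using K by auto
  have d01: "1 - c * k 0 \<noteq> 0 \<and> 1 - c * k 1 \<noteq> 0"
  proof (rule ccontr)
    assume "\<not> (1 - c * k 0 \<noteq> 0 \<and> 1 - c * k 1 \<noteq> 0)"
    then have z: "1 - c * k 0 = 0" "1 - c * k 1 = 0" using prod k0 by auto
    have "v = (dif Y u v \<bullet> dif Y u (b 0)) *\<^sub>R b 0 + (dif Y u v \<bullet> dif Y u (b 1)) *\<^sub>R b 1"
      using orthonormal_derivative_frame_expand(3)[OF lin(1) on, of v] by (simp add: numeral_2_eq_2)
    then obtain x y where xy: "v = x *\<^sub>R b 0 + y *\<^sub>R b 1" by blast
    have "L v = 0" unfolding xy linear_add[OF linL] linear_scale[OF linL] using Lb[of 0] Lb[of 1] z by simp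
    then show False using v unfolding d L_def by simp
  qed
  define b' where "b' i = (1 / (1 - c * k i)) *\<^sub>R b i" for i
  have di: "1 - c * k i \<noteq> 0" if "i < 2" for i using that d01 by (cases "i = 0") (auto simp: less_2_cases_iff)
  have Lb': "L (b' i) = dif Y u (b i)" if "i < 2" for i
    using Lb[OF that] di[OF that] by (simp add: b'_def linear_scale[OF linL])
  have Nb': "dif N u (b' i) = - ((k i / (1 - c * k i)) *\<^sub>R L (b' i))" if "i < 2" for i
    using ev that unfolding Lb'[OF that] by (simp add: b'_def linear_scale[OF lin(2)])
  have on': "\<forall>i<DIM(real^2). \<forall>j<DIM(real^2). L (b' i) \<bullet> L (b' j) = (if i = j then 1 else 0)"
    using on Lb' by simp
  have dL: "dif (\<lambda>u. Y u + c *\<^sub>R N u) u = L" unfolding d L_def[abs_def] ..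
  have "principal_curvatures_at (\<lambda>u. Y u + c *\<^sub>R N u) N u (\<lambda>i. k i / (1 - c * k i))"
    unfolding principal_curvatures_at_def dL by (rule exI[of _ b'], intro conjI on') (use Nb' in simp)
  then show "1 - c * k 0 \<noteq> 0 \<and> 1 - c * k 1 \<noteq> 0 \<and> inj (dif (\<lambda>u. Y u + c *\<^sub>R N u) u) \<and>
      principal_curvatures_at (\<lambda>u. Y u + c *\<^sub>R N u) N u (\<lambda>i. k i / (1 - c * k i))"
    using d01 orthonormal_derivative_frame_expand(4)[OF linL on'] unfolding dL by blast
qed

section \<open>Hypersurfaces with nonvanishing third mean curvature\<close>

locale nondegenerate_hypersurface = profile_over_surface U Y N J z1 z2 z1' z2' z1'' z2'' W T t0
  for U Y N J z1 z2 z1' z2' z1'' z2'' W T t0 +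
  fixes F \<eta> :: "(real^2) \<times> real \<Rightarrow> real^4"
  assumes FX: "\<And>p. p \<in> W \<Longrightarrow> F p = X p"
    and \<eta>: "gauss_map_on W F \<eta>"
    and cont: "continuous_on J z1''" "continuous_on J z2''"
    and J: "open J" "smooth_on J z2"
    and H3: "\<And>q. q \<in> W \<Longrightarrow> r_mean_curvature 3 F \<eta> q \<noteq> 0"
begin

text \<open>The principal curvatures need not depend continuously on the point, but these determinants in
  the coordinate frame do. They are \<open>k\<^sub>0 k\<^sub>1\<close>, \<open>- (k\<^sub>0 + k\<^sub>1)\<close> and \<open>1\<close>, each multiplied by the
  area density.\<close>

definition detN :: "real^2 \<Rightarrow> real" where
  "detN u = cross3 (dif N u (axis 1 1)) (dif N u (axis 2 1)) \<bullet> N u"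

definition mixed :: "real^2 \<Rightarrow> real" where
  "mixed u = (cross3 (dif N u (axis 1 1)) (dif Y u (axis 2 1)) + cross3 (dif Y u (axis 1 1)) (dif N u (axis 2 1))) \<bullet> N u"

definition area :: "real^2 \<Rightarrow> real" where
  "area u = cross3 (dif Y u (axis 1 1)) (dif Y u (axis 2 1)) \<bullet> N u"

lemma \<eta>_facts: "continuous_on W \<eta>" "\<And>p. p \<in> W \<Longrightarrow> norm (\<eta> p) = 1" "\<And>p v. p \<in> W \<Longrightarrow> dif F p v \<bullet> \<eta> p = 0"
proof -
  show "continuous_on W \<eta>" using \<eta> by (auto simp: gauss_map_on_def intro: smooth_on_imp_continuous_on)
  show "norm (\<eta> p) = 1" if "p \<in> W" for p using \<eta> that unfolding gauss_map_on_def by blast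
  show "dif F p v \<bullet> \<eta> p = 0" if "p \<in> W" for p v using \<eta> that unfolding gauss_map_on_def by blast
qed

lemma exists_principal:
  assumes "u \<in> U"
  obtains k where "principal_curvatures_at Y N u k"
  using principal_curvatures_exist[OF surface(2,3,1) assms surface(4)[OF assms]] by blast

lemma area_scaled:
  assumes "u \<in> U" "principal_curvatures_at Y N u k"
  shows "detN u = k 0 * k 1 * area u" "mixed u = - ((k 0 + k 1) * area u)" "area u \<noteq> 0"
proof -
  note g = gauss_map_cross_products[OF YN(3,4)[OF assms(1)] assms(2)]
  show "detN u = k 0 * k 1 * area u" "mixed u = - ((k 0 + k 1) * area u)"
    unfolding detN_def mixed_def area_def g by simp_all
  show "area u \<noteq> 0" unfolding area_def
    by (rule area_nonzero[where N = N and u = u, OF YN(3)[OF assms(1)] surface(4)[OF assms(1)] YN(9)[OF assms(1)] YN(6)[OF assms(1)]])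
qed

lemma nondegenerate:
  assumes "(u, w) \<in> W"
  shows "z2' w \<noteq> 0" "detN u \<noteq> 0" "bending w \<noteq> 0"
proof -
  have u: "u \<in> U" using assms dom by auto
  obtain k where k: "principal_curvatures_at Y N u k" by (rule exists_principal[OF u])
  have "\<not> (z2' w = 0 \<or> k 0 * k 1 = 0 \<or> bending w = 0)"
    using mean_curvatures_any_normal(2)[OF assms k FX \<eta>_facts] H3[OF assms] by simp
  then show "z2' w \<noteq> 0" "detN u \<noteq> 0" "bending w \<noteq> 0" using area_scaled[OF u k] by auto
qed

lemma H2_zero_iff:
  assumes "(u, w) \<in> W"
  shows "r_mean_curvature 2 F \<eta> (u, w) = 0 \<longleftrightarrow>
    z2' w * detN u * ((z1' w)\<^sup>2 + (z2' w)\<^sup>2) - bending w * (mixed u + 2 * z1 w * detN u) = 0"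
proof -
  have u: "u \<in> U" using assms dom by auto
  obtain k where k: "principal_curvatures_at Y N u k" by (rule exists_principal[OF u])
  note a = area_scaled[OF u k]
  have "z2' w * detN u * ((z1' w)\<^sup>2 + (z2' w)\<^sup>2) - bending w * (mixed u + 2 * z1 w * detN u)
    = area u * (z2' w * (k 0 * k 1) * ((z1' w)\<^sup>2 + (z2' w)\<^sup>2)
        + bending w * (k 0 + k 1 - 2 * z1 w * (k 0 * k 1)))"
    unfolding a(1,2) by (simp add: algebra_simps)
  then show ?thesis
    using mean_curvatures_any_normal(1)[OF assms k FX \<eta>_facts] nondegenerate(1)[OF assms] a(3) by simp
qed

lemma F_derivative: "p \<in> W \<Longrightarrow> (F has_derivative dif F p) (at p)"
proof -
  assume p: "p \<in> W"
  obtain u w where uw: "p = (u, w)" "u \<in> U" "w \<in> J" using p dom by auto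
  have "F differentiable (at p)"
    using has_derivative_transform_within_open[OF X_derivative[OF uw(2,3)] dom(1) p[unfolded uw(1)], of F] FX
    unfolding uw(1) differentiable_def by metis
  then show ?thesis by (rule frechet_derivative_works_at)
qed

lemma F_principal:
  assumes "q \<in> W"
  shows "\<exists>k. principal_curvatures_at F \<eta> q k"
proof -
  obtain u w where q: "q = (u, w)" "u \<in> U" using assms dom by auto
  obtain k where k: "principal_curvatures_at Y N u k" by (rule exists_principal[OF q(2)])
  show ?thesis
    using principal_curvatures_any_normal[OF assms[unfolded q(1)] k FX \<eta>_facts] unfolding q(1) by metis
qed

text \<open>By \<open>H2_zero_iff\<close> the set where \<open>H\<^sub>2 = 0\<close> is the zero set of a continuous function, hence
  closed.\<close>

lemma H2_zero_on_closure:
  assumes G: "G \<subseteq> W" "W \<subseteq> closure G" and zero: "\<And>q. q \<in> G \<Longrightarrow> r_mean_curvature 2 F \<eta> q = 0" and q: "q \<in> W"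
  shows "r_mean_curvature 2 F \<eta> q = 0"
proof -
  define \<Phi> where "\<Phi> q = z2' (snd q) * detN (fst q) * ((z1' (snd q))\<^sup>2 + (z2' (snd q))\<^sup>2)
    - bending (snd q) * (mixed (fst q) + 2 * z1 (snd q) * detN (fst q))" for q
  have iff: "r_mean_curvature 2 F \<eta> q = 0 \<longleftrightarrow> \<Phi> q = 0" if "q \<in> W" for q
    using H2_zero_iff[of "fst q" "snd q"] that by (simp add: \<Phi>_def)
  have sN: "smooth_on U N" using surface(3) by (simp add: gauss_map_on_def)
  have der: "continuous_on U (\<lambda>u. dif Y u v)" "continuous_on U (\<lambda>u. dif N u v)" "continuous_on U N" for v
    using surface(2) sN by (auto intro!: smooth_on_imp_continuous_on smooth_on_derivative)
  have cU: "continuous_on U detN" "continuous_on U mixed"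
    unfolding detN_def[abs_def] mixed_def[abs_def]
    by (intro continuous_on_inner continuous_on_cross continuous_on_add der)+
  have cz: "continuous_on J z1" "continuous_on J z2'" "continuous_on J z1'"
    using z by (auto intro!: continuous_at_imp_continuous_on DERIV_isCont)
  have cb: "continuous_on J bending"
    unfolding bending_def[abs_def] by (intro continuous_on_diff continuous_on_mult cz cont)
  have cf: "continuous_on W (\<lambda>q. f (fst q))" if "continuous_on U f" for f :: "real^2 \<Rightarrow> real"
    by (rule continuous_on_compose2[OF that continuous_on_fst[OF continuous_on_id]]) (use dom in auto)
  have cs: "continuous_on W (\<lambda>q. f (snd q))" if "continuous_on J f" for f :: "real \<Rightarrow> real"
    by (rule continuous_on_compose2[OF that continuous_on_snd[OF continuous_on_id]]) (use dom in auto)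
  have "continuous_on W \<Phi>" unfolding \<Phi>_def
    by (intro continuous_intros cf cs cU cz cb)
  then have "closedin (top_of_set W) {q \<in> W. \<Phi> q = 0}"
    by (rule continuous_closedin_preimage_constant)
  then obtain S where S: "closed S" "{q \<in> W. \<Phi> q = 0} = W \<inter> S" unfolding closedin_closed by blast
  have "G \<subseteq> S" using S(2) G(1) zero iff by blast
  then have "W \<subseteq> S" using closure_minimal[OF _ S(1)] G(2) by blast
  then show ?thesis using S(2) q iff by blast
qed

lemma models_have_zero_curvature:
  assumes C1: "C1 > 0" and type: "locally_minimal_type C1 C2 W F \<or> locally_sphere_type C1 C2 W F" and q: "q \<in> W"
  shows "r_mean_curvature 2 F \<eta> q = 0"
  using type
proof
  assume "locally_minimal_type C1 C2 W F"
  then obtain B G where B: "rigid_motion B" and G: "G \<subseteq> W" "W \<subseteq> closure G"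
    and loc: "\<forall>q\<in>G. \<exists>U Y N W'. minimal_surface_on U Y N \<and> W' \<subseteq> minimal_type_domain C1 U Y N \<and>
      parametrizes_near W F q W' (B \<circ> minimal_type_map C1 C2 Y N)"
    unfolding locally_minimal_type_def by blast
  show ?thesis
  proof (rule H2_zero_on_closure[OF G _ q])
    fix p assume p: "p \<in> G"
    then obtain U' Y' N' W' where Y': "minimal_surface_on U' Y' N'" "W' \<subseteq> minimal_type_domain C1 U' Y' N'"
      and par: "parametrizes_near W F p W' (B \<circ> minimal_type_map C1 C2 Y' N')" using loc by blast
    obtain k where k: "principal_curvatures_at F \<eta> p k" using F_principal p G(1) by blast
    show "r_mean_curvature 2 F \<eta> p = 0"
    proof (rule parametrizes_near_zero_curvature[OF par _ \<eta> k])
      show "(F has_derivative dif F p) (at p)" if "p \<in> W" for p using that by (rule F_derivative)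
    next
      fix H \<nu> x
      assume a: "open W'" "\<And>p. p \<in> W' \<Longrightarrow> H p = (B \<circ> minimal_type_map C1 C2 Y' N') p" "continuous_on W' \<nu>"
        "\<And>p. p \<in> W' \<Longrightarrow> norm (\<nu> p) = 1" "\<And>p v. p \<in> W' \<Longrightarrow> dif H p v \<bullet> \<nu> p = 0" "x \<in> W'"
      show "r_mean_curvature 2 H \<nu> x = 0"
        by (rule minimal_type_zero_curvature[OF C1 B Y' a])
    qed
  qed
next
  assume "locally_sphere_type C1 C2 W F"
  then obtain B where B: "rigid_motion B" and loc: "\<forall>q\<in>W. \<exists>U r Y W'. r > 0 \<and> sphere_parametrization_on U r Y \<and>
      W' \<subseteq> sphere_type_domain C1 U \<and> parametrizes_near W F q W' (B \<circ> sphere_type_map C1 C2 r Y)"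
    unfolding locally_sphere_type_def by blast
  obtain U' r Y' W' where Y': "r > 0" "sphere_parametrization_on U' r Y'" "W' \<subseteq> sphere_type_domain C1 U'"
    and par: "parametrizes_near W F q W' (B \<circ> sphere_type_map C1 C2 r Y')" using loc q by blast
  obtain k where k: "principal_curvatures_at F \<eta> q k" using F_principal[OF q] by blast
  show ?thesis
  proof (rule parametrizes_near_zero_curvature[OF par _ \<eta> k])
    show "(F has_derivative dif F p) (at p)" if "p \<in> W" for p using that by (rule F_derivative)
  next
    fix H \<nu> x
    assume a: "open W'" "\<And>p. p \<in> W' \<Longrightarrow> H p = (B \<circ> sphere_type_map C1 C2 r Y') p" "continuous_on W' \<nu>"
      "\<And>p. p \<in> W' \<Longrightarrow> norm (\<nu> p) = 1" "\<And>p v. p \<in> W' \<Longrightarrow> dif H p v \<bullet> \<nu> p = 0" "x \<in> W'"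
    show "r_mean_curvature 2 H \<nu> x = 0"
      by (rule sphere_type_zero_curvature[OF C1 B Y' a])
  qed
qed

end

section \<open>Hypersurfaces with vanishing second mean curvature\<close>

locale zero_H2_hypersurface = nondegenerate_hypersurface +
  assumes H2: "\<And>q. q \<in> W \<Longrightarrow> r_mean_curvature 2 F \<eta> q = 0"
    and W_conn: "connected W"
begin

definition P :: "(real^2) set" where
  "P = fst ` W"

definition Q :: "real set" where
  "Q = snd ` W"

lemma P: "open P" "connected P" "P \<subseteq> U"
  using dom W_conn unfolding P_def by (auto intro!: open_image_fst connected_continuous_image continuous_intros)

lemma Q: "open Q" "connected Q" "Q \<subseteq> J"
  using dom W_conn unfolding Q_def by (auto intro!: open_image_snd connected_continuous_image continuous_intros)

text \<open>\<open>H\<^sub>2 = 0\<close> separates the variables: \<open>(1/k\<^sub>0 + 1/k\<^sub>1) / 2\<close>, a function on the directrix,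
  equals a function on the profile, hence both are a constant \<open>c\<close> on a connected domain.\<close>

lemma separated:
  obtains c where "\<And>u. u \<in> P \<Longrightarrow> mixed u = - (2 * c * detN u)"
    "\<And>w. w \<in> Q \<Longrightarrow> z2' w * ((z1' w)\<^sup>2 + (z2' w)\<^sup>2) = 2 * (z1 w - c) * bending w"
proof -
  define f where "f u = - mixed u / (2 * detN u)" for u
  define g where "g w = z1 w - z2' w * ((z1' w)\<^sup>2 + (z2' w)\<^sup>2) / (2 * bending w)" for w
  have fg: "f u = g w" if "(u, w) \<in> W" for u w
  proof -
    have "z2' w * detN u * ((z1' w)\<^sup>2 + (z2' w)\<^sup>2) = bending w * (mixed u + 2 * z1 w * detN u)"
      using H2_zero_iff[OF that] H2[OF that] by simp
    then have "mixed u * bending w = (z2' w * ((z1' w)\<^sup>2 + (z2' w)\<^sup>2) - 2 * z1 w * bending w) * detN u"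
      by (simp add: algebra_simps)
    then have "mixed u / detN u = (z2' w * ((z1' w)\<^sup>2 + (z2' w)\<^sup>2) - 2 * z1 w * bending w) / bending w"
      using nondegenerate[OF that] by (simp add: frac_eq_eq)
    then show ?thesis using nondegenerate[OF that] by (simp add: f_def g_def diff_divide_distrib)
  qed
  have "(\<lambda>p. f (fst p)) constant_on W"
  proof (rule locally_constant_imp_constant[OF W_conn])
    fix p assume p: "p \<in> W"
    obtain A B where AB: "open A" "open B" "p \<in> A \<times> B" "A \<times> B \<subseteq> W"
      using dom(1) p by (rule open_prod_elim)
    have "f (fst x) = f (fst p)" if xAB: "x \<in> A \<times> B" for x
    proof -
      obtain u w where x: "x = (u, w)" "u \<in> A" "w \<in> B" using xAB by blast
      obtain u' w' where p': "p = (u', w')" "u' \<in> A" "w' \<in> B" using AB(3) by blast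
      have "(u, w') \<in> W" "(u', w') \<in> W" using x p' AB(4) by auto
      then have "f u = g w'" "f u' = g w'" using fg by auto
      then show ?thesis by (simp add: x p')
    qed
    moreover have "openin (top_of_set W) (A \<times> B)"
      using AB open_Times by (metis open_openin_trans openin_open_eq dom(1))
    ultimately show "\<exists>T. openin (top_of_set W) T \<and> p \<in> T \<and> (\<forall>x\<in>T. f (fst x) = f (fst p))"
      using AB(3) by blast
  qed
  then obtain c where c: "\<And>p. p \<in> W \<Longrightarrow> f (fst p) = c" unfolding constant_on_def by blast
  show ?thesis
  proof (rule that[of c])
    fix u assume "u \<in> P"
    then obtain w where uw: "(u, w) \<in> W" by (auto simp: P_def)
    then have "f u = c" using c by force
    then show "mixed u = - (2 * c * detN u)" using nondegenerate(2)[OF uw] by (simp add: f_def field_simps)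
  next
    fix w assume "w \<in> Q"
    then obtain u where uw: "(u, w) \<in> W" by (auto simp: Q_def)
    then have "g w = c" using c fg by force
    then show "z2' w * ((z1' w)\<^sup>2 + (z2' w)\<^sup>2) = 2 * (z1 w - c) * bending w"
      using nondegenerate(3)[OF uw] by (simp add: g_def field_simps)
  qed
qed

end

text \<open>From here on the separation constant \<open>c\<close> and the integration constants \<open>C\<close> and \<open>C\<^sub>2\<close> of the
  profile are fixed. The sign of \<open>C\<close> is carried by \<open>sg\<close> and is moved to the normal.\<close>

locale parabolic_hypersurface = zero_H2_hypersurface +
  fixes c C C2 :: real
  assumes mixed: "\<And>u. u \<in> P \<Longrightarrow> mixed u = - (2 * c * detN u)"
    and C: "C \<noteq> 0"
    and parabola: "\<And>w. w \<in> Q \<Longrightarrow> z1 w - c = C * (1 + ((z2 w - C2) / (2 * C))\<^sup>2)"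
begin

lemma weingarten:
  assumes "u \<in> P" "principal_curvatures_at Y N u k"
  shows "k 0 * k 1 \<noteq> 0" "k 0 + k 1 = 2 * c * (k 0 * k 1)"
proof -
  obtain w where uw: "(u, w) \<in> W" using assms(1) by (auto simp: P_def)
  have u: "u \<in> U" using assms(1) P(3) by blast
  note a = area_scaled[OF u assms(2)]
  show "k 0 * k 1 \<noteq> 0" using nondegenerate(2)[OF uw] a by auto
  have "(k 0 + k 1) * area u = 2 * c * (k 0 * k 1) * area u"
    using mixed[OF assms(1)] unfolding a(1,2) by (simp only: neg_equal_iff_equal mult.assoc)
  then show "k 0 + k 1 = 2 * c * (k 0 * k 1)" using mult_right_cancel[OF a(3)] by blast
qed

definition Yc :: "real^2 \<Rightarrow> real^3" where
  "Yc u = Y u + c *\<^sub>R N u"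

lemma sN: "smooth_on U N" using surface(3) by (simp add: gauss_map_on_def)

lemma smooth_Yc: "smooth_on U Yc"
  unfolding Yc_def[abs_def]
  by (intro smooth_on_add smooth_on_cscaleR surface sN)

lemma dYc: "u \<in> U \<Longrightarrow> dif Yc u = (\<lambda>v. dif Y u v + c *\<^sub>R dif N u v)"
  unfolding Yc_def[abs_def]
  by (rule frechet_derivative_eq) (intro has_derivative_add has_derivative_scaleR_right YN)

lemma Yc_curvatures:
  assumes "u \<in> P" "principal_curvatures_at Y N u k" "dif Yc u v \<noteq> 0"
  shows "1 - c * k 0 \<noteq> 0" "1 - c * k 1 \<noteq> 0" "inj (dif Yc u)"
    "principal_curvatures_at Yc N u (\<lambda>i. k i / (1 - c * k i))"
proof -
  have u: "u \<in> U" using assms(1) P(3) by blast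
  show "1 - c * k 0 \<noteq> 0" "1 - c * k 1 \<noteq> 0" "inj (dif Yc u)"
    "principal_curvatures_at Yc N u (\<lambda>i. k i / (1 - c * k i))"
    using parallel_surface_curvatures(2)[OF YN(1,2)[OF u] assms(2) weingarten[OF assms(1,2)]] assms(3)
    unfolding Yc_def[abs_def] by blast+
qed

text \<open>If \<open>dN v = 0\<close>, symmetry of the second fundamental form makes \<open>dY v\<close> orthogonal to every
  principal direction, whose curvature is nonzero.\<close>

lemma inj_dN:
  assumes "u \<in> P"
  shows "inj (dif N u)"
proof -
  have u: "u \<in> U" using assms P(3) by blast
  obtain k where k: "principal_curvatures_at Y N u k" by (rule exists_principal[OF u])
  have K: "k 0 * k 1 \<noteq> 0" by (rule weingarten[OF assms k])
  have "v = 0" if v: "dif N u v = 0" for v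
  proof -
    obtain b :: "nat \<Rightarrow> real^2" where
      on: "\<forall>i<DIM(real^2). \<forall>j<DIM(real^2). dif Y u (b i) \<bullet> dif Y u (b j) = (if i = j then 1 else 0)"
      and ev: "\<forall>i<DIM(real^2). dif N u (b i) = - (k i *\<^sub>R dif Y u (b i))"
      using k unfolding principal_curvatures_at_def by blast
    have "dif Y u v \<bullet> dif Y u (b i) = 0" if "i < 2" for i
    proof -
      have "dif N u (b i) \<bullet> dif Y u v = dif N u v \<bullet> dif Y u (b i)"
        by (rule second_fundamental_form_symmetric[OF surface(2,3,1) u])
      then have "k i * (dif Y u (b i) \<bullet> dif Y u v) = 0" using v ev that by simp
      moreover have "k i \<noteq> 0" using K that by (auto simp: less_2_cases_iff)
      ultimately show ?thesis by (simp add: inner_commute)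
    qed
    then show ?thesis
      using orthonormal_derivative_frame_expand(3)[OF YN(3)[OF u] on, of v] by simp
  qed
  then show ?thesis using linear_injective_0[OF YN(4)[OF u]] by blast
qed

text \<open>With \<open>K = k\<^sub>0 k\<^sub>1\<close>, the trace condition is \<open>- (k\<^sub>0 + k\<^sub>1) + 2 c K = 0\<close> multiplied by the area
  form.\<close>

lemma Yc_tracefree: "tracefree_surface P Yc N"
proof
  show "open P" by (rule P)
  show "smooth_on P Yc" "smooth_on P N" using smooth_on_subset[OF _ P(3)] smooth_Yc sN by auto
  fix u assume uP: "u \<in> P"
  then have u: "u \<in> U" using P(3) by blast
  show "N u \<bullet> N u = 1" "inj (dif N u)" using YN(9)[OF u] inj_dN[OF uP] by auto
  fix v
  show "N u \<bullet> dif N u v = 0" "N u \<bullet> dif Yc u v = 0"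
    using YN[OF u] by (simp_all add: dYc[OF u] inner_add_right)
  fix a b
  show "dif N u a \<bullet> dif Yc u b = dif N u b \<bullet> dif Yc u a"
    using second_fundamental_form_symmetric[OF surface(2,3,1) u, of a b]
    by (simp add: dYc[OF u] inner_add_right inner_commute)
  obtain k where k: "principal_curvatures_at Y N u k" by (rule exists_principal[OF u])
  note g = gauss_map_cross_products[OF YN(3,4)[OF u] k, of a b]
  have "cross3 (dif N u a) (dif Yc u b) - cross3 (dif N u b) (dif Yc u a)
    = (cross3 (dif N u a) (dif Y u b) + cross3 (dif Y u a) (dif N u b)) + (2 * c) *\<^sub>R cross3 (dif N u a) (dif N u b)"
    using cross_skew[of "dif N u b" "dif Y u a"] cross_skew[of "dif N u b" "dif N u a"]
    by (simp add: dYc[OF u] cross_add_right cross_mult_right scaleR_2 flip: scaleR_scaleR)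
  also have "\<dots> = 0" unfolding g weingarten(2)[OF uP k] by simp
  finally show "cross3 (dif N u a) (dif Yc u b) = cross3 (dif N u b) (dif Yc u a)" by simp
qed

definition sg :: real where "sg = sgn C"
definition C1 :: real where "C1 = \<bar>C\<bar>"

lemma sg: "sg * sg = 1" "C1 > 0" "C = sg * C1"
  using C by (auto simp: sg_def C1_def sgn_if)

text \<open>Near a point of \<open>W\<close>, the parameter \<open>w\<close> of the profile can be replaced by the angle \<open>\<theta>\<close> of the
  models, with \<open>w = h \<theta>\<close>.\<close>

lemma secant_patch:
  assumes q: "(u0, w0) \<in> W" and A: "open A" "u0 \<in> A"
  obtains U1 J0 \<Theta> h where "open U1" "u0 \<in> U1" "U1 \<subseteq> A" "w0 \<in> J0" "U1 \<times> J0 \<subseteq> W" "\<Theta> \<subseteq> {-pi/2<..<pi/2}"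
    "diffeomorphism_betw (U1 \<times> \<Theta>) (U1 \<times> J0) (\<lambda>(u, \<theta>). (u, h \<theta>))"
    "\<forall>\<theta>\<in>\<Theta>. h \<theta> \<in> J0 \<and> C1 * sec \<theta> ^ 2 = sg * (z1 (h \<theta>) - c) \<and> C2 + 2 * C1 * tan \<theta> = z2 (h \<theta>)"
proof -
  obtain A' B where AB: "open A'" "open B" "(u0, w0) \<in> A' \<times> B" "A' \<times> B \<subseteq> W"
    using dom(1) q by (rule open_prod_elim)
  define U1 where "U1 = A' \<inter> A"
  have U1: "open U1" "u0 \<in> U1" "U1 \<subseteq> A" "U1 \<times> B \<subseteq> W" using AB A by (auto simp: U1_def)
  have BQ: "B \<subseteq> Q" using AB(3,4) unfolding Q_def by force
  have B: "w0 \<in> B" "smooth_on B z2" "\<forall>w\<in>B. (z2 has_real_derivative z2' w) (at w)" "\<forall>w\<in>B. z2' w \<noteq> 0"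
  proof -
    show "w0 \<in> B" using AB by simp
    show "smooth_on B z2" by (rule smooth_on_subset[OF J(2)]) (use BQ Q in blast)
    show "\<forall>w\<in>B. (z2 has_real_derivative z2' w) (at w)" using z(2) BQ Q by blast
    show "\<forall>w\<in>B. z2' w \<noteq> 0" using nondegenerate(1)[of u0] AB by blast
  qed
  obtain \<Theta> J0 h where \<Theta>: "\<Theta> \<subseteq> {-pi/2<..<pi/2}" "w0 \<in> J0" "J0 \<subseteq> B"
    "\<forall>\<theta>\<in>\<Theta>. h \<theta> \<in> J0 \<and> C2 + 2 * C1 * tan \<theta> = z2 (h \<theta>)"
    "diffeomorphism_betw (U1 \<times> \<Theta>) (U1 \<times> J0) (\<lambda>(u, \<theta>). (u, h \<theta>))"
    by (rule tangent_reparametrization[OF U1(1) AB(2) B(1) sg(2) B(2-4)])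
  show ?thesis
  proof (rule that[OF U1(1-3) \<Theta>(2) _ \<Theta>(1,5)])
    show "U1 \<times> J0 \<subseteq> W" using U1(4) \<Theta>(3) by blast
  next
    show "\<forall>\<theta>\<in>\<Theta>. h \<theta> \<in> J0 \<and> C1 * sec \<theta> ^ 2 = sg * (z1 (h \<theta>) - c) \<and> C2 + 2 * C1 * tan \<theta> = z2 (h \<theta>)"
    proof (intro ballI conjI)
      fix \<theta> assume t: "\<theta> \<in> \<Theta>"
      show h: "h \<theta> \<in> J0" "C2 + 2 * C1 * tan \<theta> = z2 (h \<theta>)" using \<Theta>(4) t by auto
      have "h \<theta> \<in> Q" using h \<Theta>(3) BQ by blast
      then have "z1 (h \<theta>) - c = C * (1 + ((z2 (h \<theta>) - C2) / (2 * C))\<^sup>2)" by (rule parabola)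
      also have "(z2 (h \<theta>) - C2) / (2 * C) = sg * tan \<theta>"
      proof -
        have "y - d = s * t * (2 * k)" if "d + 2 * c1 * t = y" "s * s = 1" "k = s * c1" for d c1 t y s k :: real
        proof -
          have e: "s * t * (2 * (s * c1)) = (s * s) * (2 * c1 * t)" by (simp only: mult_ac)
          show ?thesis using that(1) unfolding that(3) e that(2) by simp
        qed
        from this[OF h(2) sg(1,3)] show ?thesis using C by simp
      qed
      also have "C * (1 + (sg * tan \<theta>)\<^sup>2) = sg * (C1 * (1 + (tan \<theta>)\<^sup>2))"
        using sg(1,3) by algebra
      finally have "sg * (z1 (h \<theta>) - c) = C1 * (1 + (tan \<theta>)\<^sup>2)" using sg(1) by algebra
      moreover have "cos \<theta> \<noteq> 0" using cos_nonzero \<Theta>(1) t by blast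
      ultimately show "C1 * sec \<theta> ^ 2 = sg * (z1 (h \<theta>) - c)" by (simp add: sec_squared)
    qed
  qed
qed

lemma rigid_motion_translate: "rigid_motion (\<lambda>x. t0 + T a + T x)"
  unfolding rigid_motion_def using T by blast

lemma smooth_sgN: "smooth_on U (\<lambda>u. sg *\<^sub>R N u)"
  by (rule smooth_on_cscaleR[OF surface(1) sN])

lemma dsgN: "u \<in> U \<Longrightarrow> dif (\<lambda>u. sg *\<^sub>R N u) u = (\<lambda>v. sg *\<^sub>R dif N u v)"
  by (rule frechet_derivative_eq[OF has_derivative_scaleR_right[OF YN(2)]])

lemma norm_sgN: "u \<in> U \<Longrightarrow> norm (sg *\<^sub>R N u) = 1"
  using YN(9)[of u] C by (simp add: norm_eq_1 sg_def abs_sgn_eq)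

text \<open>If \<open>Y + c N\<close> is a point \<open>y\<^sub>0\<close>, then \<open>Y + z\<^sub>1 N = y\<^sub>0 + (z\<^sub>1 - c) N\<close> is a multiple of the
  surface \<open>N\<close> in the unit sphere, translated by \<open>y\<^sub>0\<close>; the translation goes into the rigid motion. Restricting
  to a ball on which \<open>N\<close> is injective gives a parametrization of the sphere.\<close>

lemma sphere_case:
  assumes "W \<noteq> {}" and zero: "\<And>u v. u \<in> P \<Longrightarrow> dif Yc u v = 0"
  shows "locally_sphere_type C1 C2 W F"
proof -
  have "Yc constant_on P"
  proof (rule has_derivative_zero_connected_constant_on[OF P(2,1) finite.emptyI])
    show "continuous_on P Yc" using smooth_on_imp_continuous_on[OF smooth_on_subset[OF smooth_Yc P(3)]] .
    show "\<forall>x\<in>P - {}. (Yc has_derivative (\<lambda>h. 0)) (at x within P)"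
    proof
      fix x assume x: "x \<in> P - {}"
      have "(Yc has_derivative dif Yc x) (at x)" using smooth_Yc x P(3) by (auto intro: smooth_on_has_derivative)
      moreover have "dif Yc x = (\<lambda>h. 0)" using zero x by auto
      ultimately show "(Yc has_derivative (\<lambda>h. 0)) (at x within P)" by (simp add: has_derivative_at_withinI)
    qed
  qed
  then obtain y0 where y0: "\<And>u. u \<in> P \<Longrightarrow> Yc u = y0" unfolding constant_on_def by blast
  define B where "B x = t0 + T (emb y0) + T x" for x
  show ?thesis unfolding locally_sphere_type_def
  proof (intro exI[of _ B] conjI ballI)
    show "rigid_motion B" unfolding B_def[abs_def] by (rule rigid_motion_translate)
    fix q assume q: "q \<in> W"
    obtain u0 w0 where q0: "q = (u0, w0)" by (cases q)
    have u0: "u0 \<in> P" using q q0 by (force simp: P_def)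
    obtain r where r: "r > 0" "ball u0 r \<subseteq> P" "inj_on N (ball u0 r)"
      by (rule smooth_immersion_locally_injective[OF P(1) smooth_on_subset[OF sN P(3)] u0 inj_dN[OF u0]])
    obtain U1 J0 \<Theta> h where p: "open U1" "u0 \<in> U1" "U1 \<subseteq> ball u0 r" "w0 \<in> J0" "U1 \<times> J0 \<subseteq> W"
      "\<Theta> \<subseteq> {-pi/2<..<pi/2}" "diffeomorphism_betw (U1 \<times> \<Theta>) (U1 \<times> J0) (\<lambda>(u, \<theta>). (u, h \<theta>))"
      and h: "\<forall>\<theta>\<in>\<Theta>. h \<theta> \<in> J0 \<and> C1 * sec \<theta> ^ 2 = sg * (z1 (h \<theta>) - c) \<and> C2 + 2 * C1 * tan \<theta> = z2 (h \<theta>)"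
      by (rule secant_patch[OF q[unfolded q0] open_ball centre_in_ball[THEN iffD2, OF r(1)]])
    have h: "h \<theta> \<in> J0" "C1 * sec \<theta> ^ 2 = sg * (z1 (h \<theta>) - c)" "C2 + 2 * C1 * tan \<theta> = z2 (h \<theta>)"
      if "\<theta> \<in> \<Theta>" for \<theta> using h that by blast+
    have U1P: "U1 \<subseteq> P" "U1 \<subseteq> U" using p(3) r(2) P(3) by auto
    show "\<exists>U r Y W'. r > 0 \<and> sphere_parametrization_on U r Y \<and> W' \<subseteq> sphere_type_domain C1 U \<and>
        parametrizes_near W F q W' (B \<circ> sphere_type_map C1 C2 r Y)"
    proof (intro exI conjI)
      show "(1::real) > 0" by simp
      have "inj (\<lambda>v. sg *\<^sub>R dif N u v)" if "u \<in> P" for u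
        using inj_dN[OF that] sg(1) by (auto simp: inj_def)
      moreover have "inj_on (\<lambda>u. sg *\<^sub>R N u) U1"
        using inj_on_subset[OF r(3) p(3)] sg(1) by (auto simp: inj_on_def)
      ultimately show "sphere_parametrization_on U1 1 (\<lambda>u. sg *\<^sub>R N u)"
        unfolding sphere_parametrization_on_def immersion_on_def
        using p(1) smooth_on_subset[OF smooth_sgN U1P(2)] dsgN norm_sgN U1P by (auto simp: subset_iff)
      show "U1 \<times> \<Theta> \<subseteq> sphere_type_domain C1 U1"
        using p(6) sg(2) cos_nonzero by (auto simp: sphere_type_domain_def sec_def)
      show "parametrizes_near W F q (U1 \<times> \<Theta>) (B \<circ> sphere_type_map C1 C2 1 (\<lambda>u. sg *\<^sub>R N u))"
        unfolding parametrizes_near_def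
      proof (intro exI conjI ballI)
        show "U1 \<times> J0 \<subseteq> W" "diffeomorphism_betw (U1 \<times> \<Theta>) (U1 \<times> J0) (\<lambda>(u, \<theta>). (u, h \<theta>))" by fact+
        show "q \<in> U1 \<times> J0" using p q0 by simp
        fix x assume "x \<in> U1 \<times> \<Theta>"
        then obtain u \<theta> where x: "x = (u, \<theta>)" "u \<in> U1" "\<theta> \<in> \<Theta>" by blast
        have inW: "(u, h \<theta>) \<in> W" using x h(1) p(5) by blast
        have Y: "Y u = y0 - c *\<^sub>R N u" using y0[of u] x(2) U1P by (auto simp: Yc_def algebra_simps)
        have "F (u, h \<theta>) = t0 + T (emb (Y u) + z1 (h \<theta>) *\<^sub>R emb (N u) + z2 (h \<theta>) *\<^sub>R e4)"
          using FX[OF inW] by (simp add: X_def)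
        also have "\<dots> = B ((z1 (h \<theta>) - c) *\<^sub>R emb (N u) + z2 (h \<theta>) *\<^sub>R e4)"
          unfolding Y B_def by (simp add: emb_simps T_simps algebra_simps)
        also have "z1 (h \<theta>) - c = C1 * sec \<theta> ^ 2 * sg" using h(2)[OF x(3)] sg(1) by algebra
        also have "B ((C1 * sec \<theta> ^ 2 * sg) *\<^sub>R emb (N u) + z2 (h \<theta>) *\<^sub>R e4)
          = (B \<circ> sphere_type_map C1 C2 1 (\<lambda>u. sg *\<^sub>R N u)) x"
          by (simp add: x sphere_type_map_def emb_simps h(3)[OF x(3)])
        finally show "(B \<circ> sphere_type_map C1 C2 1 (\<lambda>u. sg *\<^sub>R N u)) x = F ((\<lambda>(u, \<theta>). (u, h \<theta>)) x)"
          by (simp add: x)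
      qed
    qed
  qed
qed

definition immersed_part :: "(real^2) set" where
  "immersed_part = {u \<in> P. \<exists>v. dif Yc u v \<noteq> 0}"

lemma open_immersed_part: "open immersed_part"
proof -
  have "open (P \<inter> (\<lambda>u. dif Yc u v) -` (- {0}))" for v
    by (rule continuous_open_preimage[OF smooth_on_imp_continuous_on[OF smooth_on_derivative[OF smooth_on_subset[OF smooth_Yc P(3)]]] P(1)])
      auto
  then have "open (\<Union>v. P \<inter> (\<lambda>u. dif Yc u v) -` (- {0}))" by blast
  also have "(\<Union>v. P \<inter> (\<lambda>u. dif Yc u v) -` (- {0})) = immersed_part" by (auto simp: immersed_part_def)
  finally show ?thesis .
qed

text \<open>With \<open>a = k\<^sub>0 / (1 - c k\<^sub>0)\<close> and \<open>b = k\<^sub>1 / (1 - c k\<^sub>1)\<close> the principal curvatures of \<open>Y + c N\<close> and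
  \<open>\<rho> = z\<^sub>1 - c\<close>, the relation \<open>a + b = 0\<close> gives \<open>1 + \<rho>\<^sup>2 a b = (1 - \<rho> a) (1 - \<rho> b)\<close>. The right-hand side
  is nonzero because it is \<open>(1 - z\<^sub>1 k\<^sub>0) (1 - z\<^sub>1 k\<^sub>1)\<close> up to the factors \<open>1 - c k\<^sub>i\<close>.\<close>

lemma minimal_patch:
  assumes "open U1" "U1 \<subseteq> immersed_part"
  shows "minimal_surface_on U1 Yc (\<lambda>u. sg *\<^sub>R N u)"
    and "(u, w) \<in> W \<Longrightarrow> u \<in> U1 \<Longrightarrow> 1 + (z1 w - c)\<^sup>2 * gaussian_curvature Yc (\<lambda>u. sg *\<^sub>R N u) u \<noteq> 0"
proof -
  have U1: "U1 \<subseteq> P" "U1 \<subseteq> U" using assms P(3) by (auto simp: immersed_part_def)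
  have lin: "linear (dif Yc u)" "linear (dif (\<lambda>u. sg *\<^sub>R N u) u)" if "u \<in> U1" for u
    using smooth_Yc smooth_sgN that U1 by (auto intro!: has_derivative_linear smooth_on_has_derivative)
  have pc: "\<exists>k. principal_curvatures_at Y N u k \<and> 1 - c * k 0 \<noteq> 0 \<and> 1 - c * k 1 \<noteq> 0 \<and> inj (dif Yc u)
    \<and> principal_curvatures_at Yc (\<lambda>u. sg *\<^sub>R N u) u (\<lambda>i. sg * (k i / (1 - c * k i)))
    \<and> k 0 / (1 - c * k 0) + k 1 / (1 - c * k 1) = 0" if u: "u \<in> U1" for u
  proof -
    have uP: "u \<in> P" and uU: "u \<in> U" using u U1 by auto
    obtain v where v: "dif Yc u v \<noteq> 0" using u assms by (auto simp: immersed_part_def)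
    obtain k where k: "principal_curvatures_at Y N u k" by (rule exists_principal[OF uU])
    note y = Yc_curvatures[OF uP k v]
    have "k 0 * (1 - c * k 1) + k 1 * (1 - c * k 0) = 0"
      using weingarten(2)[OF uP k] by (simp add: algebra_simps)
    then have "k 0 / (1 - c * k 0) + k 1 / (1 - c * k 1) = 0"
      using y(1,2) by (simp add: add_frac_eq)
    then show ?thesis using k y principal_curvatures_scale_normal[OF YN(2)[OF uU] y(4), of sg] by blast
  qed
  have "gauss_map_on U1 Yc (\<lambda>u. sg *\<^sub>R N u)"
    unfolding gauss_map_on_def
    using smooth_on_subset[OF smooth_sgN U1(2)] norm_sgN U1(2) YN(5,7)
    by (auto simp: dYc subset_iff inner_add_left)
  moreover have "immersion_on U1 Yc"
    unfolding immersion_on_def using assms(1) smooth_on_subset[OF smooth_Yc U1(2)] pc by blast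
  moreover have "r_mean_curvature 1 Yc (\<lambda>u. sg *\<^sub>R N u) u = 0" if u: "u \<in> U1" for u
  proof -
    obtain k where k: "principal_curvatures_at Yc (\<lambda>u. sg *\<^sub>R N u) u (\<lambda>i. sg * (k i / (1 - c * k i)))"
      "k 0 / (1 - c * k 0) + k 1 / (1 - c * k 1) = 0" using pc[OF u] by blast
    have "sg * (k 0 / (1 - c * k 0)) + sg * (k 1 / (1 - c * k 1)) = 0"
      unfolding distrib_left[symmetric] k(2) by simp
    then show ?thesis unfolding mean_curvatures_surface(1)[OF lin[OF u] k(1)] by simp
  qed
  ultimately show "minimal_surface_on U1 Yc (\<lambda>u. sg *\<^sub>R N u)" unfolding minimal_surface_on_def by blast
  assume uw: "(u, w) \<in> W" and u: "u \<in> U1"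
  obtain k where k: "principal_curvatures_at Y N u k" "1 - c * k 0 \<noteq> 0" "1 - c * k 1 \<noteq> 0"
    "principal_curvatures_at Yc (\<lambda>u. sg *\<^sub>R N u) u (\<lambda>i. sg * (k i / (1 - c * k i)))"
    "k 0 / (1 - c * k 0) + k 1 / (1 - c * k 1) = 0" using pc[OF u] by blast
  define a b where "a = k 0 / (1 - c * k 0)" and "b = k 1 / (1 - c * k 1)"
  have "gaussian_curvature Yc (\<lambda>u. sg *\<^sub>R N u) u = a * b"
    unfolding gaussian_curvature_def mean_curvatures_surface(2)[OF lin[OF u] k(4)] a_def b_def
    using sg(1) by (metis (no_types, opaque_lifting) mult.assoc mult.left_commute mult_1)
  moreover have "1 + (z1 w - c)\<^sup>2 * (a * b) = (1 - (z1 w - c) * a) * (1 - (z1 w - c) * b)"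
    using k(5) unfolding a_def[symmetric] b_def[symmetric] by algebra
  moreover have "1 - (z1 w - c) * a = (1 - z1 w * k 0) / (1 - c * k 0)"
    "1 - (z1 w - c) * b = (1 - z1 w * k 1) / (1 - c * k 1)"
    using k(2,3) by (simp_all add: a_def b_def field_simps)
  ultimately show "1 + (z1 w - c)\<^sup>2 * gaussian_curvature Yc (\<lambda>u. sg *\<^sub>R N u) u \<noteq> 0"
    using regular[OF uw k(1)] k(2,3) by simp
qed

lemma minimal_case:
  assumes dense: "\<And>S. open S \<Longrightarrow> S \<noteq> {} \<Longrightarrow> S \<subseteq> P \<Longrightarrow> S \<inter> immersed_part \<noteq> {}"
  shows "locally_minimal_type C1 C2 W F"
proof -
  let ?B = "\<lambda>x. t0 + T x" and ?G = "W \<inter> (immersed_part \<times> UNIV)"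
  show ?thesis unfolding locally_minimal_type_def
  proof (rule exI[of _ ?B], rule exI[of _ ?G], intro conjI ballI)
    show "rigid_motion ?B" unfolding rigid_motion_def using T by blast
    show "open ?G" using dom(1) open_immersed_part by (intro open_Int open_Times) auto
    show "?G \<subseteq> W" by blast
    show "W \<subseteq> closure ?G"
    proof
      fix q assume q: "q \<in> W"
      show "q \<in> closure ?G" unfolding closure_iff_nhds_not_empty
      proof (intro allI impI)
        fix A V assume V: "V \<subseteq> A" "open V" "q \<in> V"
        obtain A' B where AB: "open A'" "open B" "q \<in> A' \<times> B" "A' \<times> B \<subseteq> W \<inter> V"
          by (rule open_prod_elim[OF open_Int[OF dom(1) V(2)], of q]) (use q V in auto)
        have "A' \<subseteq> P" using AB(3,4) unfolding P_def by force
        then obtain u where "u \<in> A'" "u \<in> immersed_part" using dense[OF AB(1)] AB(3) by blast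
        moreover have "(u, snd q) \<in> A' \<times> B" using AB(3) \<open>u \<in> A'\<close> by auto
        ultimately have "(u, snd q) \<in> ?G \<inter> A" using AB(4) V(1) by blast
        then show "?G \<inter> A \<noteq> {}" by blast
      qed
    qed
    fix q assume q: "q \<in> ?G"
    obtain u0 w0 where q0: "q = (u0, w0)" "(u0, w0) \<in> W" "u0 \<in> immersed_part" using q by auto
    obtain U1 J0 \<Theta> h where p: "open U1" "u0 \<in> U1" "U1 \<subseteq> immersed_part" "w0 \<in> J0" "U1 \<times> J0 \<subseteq> W"
      "\<Theta> \<subseteq> {-pi/2<..<pi/2}" "diffeomorphism_betw (U1 \<times> \<Theta>) (U1 \<times> J0) (\<lambda>(u, \<theta>). (u, h \<theta>))"
      and h: "\<forall>\<theta>\<in>\<Theta>. h \<theta> \<in> J0 \<and> C1 * sec \<theta> ^ 2 = sg * (z1 (h \<theta>) - c) \<and> C2 + 2 * C1 * tan \<theta> = z2 (h \<theta>)"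
      by (rule secant_patch[OF q0(2) open_immersed_part q0(3)])
    have h: "h \<theta> \<in> J0" "C1 * sec \<theta> ^ 2 = sg * (z1 (h \<theta>) - c)" "C2 + 2 * C1 * tan \<theta> = z2 (h \<theta>)"
      if "\<theta> \<in> \<Theta>" for \<theta> using h that by blast+
    note mp = minimal_patch[OF p(1,3)]
    show "\<exists>U Y N W'. minimal_surface_on U Y N \<and> W' \<subseteq> minimal_type_domain C1 U Y N \<and>
        parametrizes_near W F q W' (?B \<circ> minimal_type_map C1 C2 Y N)"
    proof (intro exI conjI)
      show "minimal_surface_on U1 Yc (\<lambda>u. sg *\<^sub>R N u)" by (rule mp(1))
      show "U1 \<times> \<Theta> \<subseteq> minimal_type_domain C1 U1 Yc (\<lambda>u. sg *\<^sub>R N u)"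
      proof
        fix x assume "x \<in> U1 \<times> \<Theta>"
        then obtain u \<theta> where x: "x = (u, \<theta>)" "u \<in> U1" "\<theta> \<in> \<Theta>" by blast
        have inW: "(u, h \<theta>) \<in> W" using x h(1) p(5) by blast
        have "C1\<^sup>2 * sec \<theta> ^ 4 = (C1 * sec \<theta> ^ 2)\<^sup>2" by algebra
        also have "\<dots> = (z1 (h \<theta>) - c)\<^sup>2" unfolding h(2)[OF x(3)] using sg(1) by algebra
        finally have "1 + C1\<^sup>2 * gaussian_curvature Yc (\<lambda>u. sg *\<^sub>R N u) u * sec \<theta> ^ 4
          = 1 + (z1 (h \<theta>) - c)\<^sup>2 * gaussian_curvature Yc (\<lambda>u. sg *\<^sub>R N u) u" by algebra
        then have "1 + C1\<^sup>2 * gaussian_curvature Yc (\<lambda>u. sg *\<^sub>R N u) u * sec \<theta> ^ 4 \<noteq> 0"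
          using mp(2)[OF inW x(2)] by (simp only: not_False_eq_True)
        then show "x \<in> minimal_type_domain C1 U1 Yc (\<lambda>u. sg *\<^sub>R N u)"
          using x p(6) unfolding minimal_type_domain_def by blast
      qed
      show "parametrizes_near W F q (U1 \<times> \<Theta>) (?B \<circ> minimal_type_map C1 C2 Yc (\<lambda>u. sg *\<^sub>R N u))"
        unfolding parametrizes_near_def
      proof (intro exI conjI ballI)
        show "U1 \<times> J0 \<subseteq> W" "diffeomorphism_betw (U1 \<times> \<Theta>) (U1 \<times> J0) (\<lambda>(u, \<theta>). (u, h \<theta>))" by fact+
        show "q \<in> U1 \<times> J0" using p q0 by simp
        fix x assume "x \<in> U1 \<times> \<Theta>"
        then obtain u \<theta> where x: "x = (u, \<theta>)" "u \<in> U1" "\<theta> \<in> \<Theta>" by blast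
        have inW: "(u, h \<theta>) \<in> W" using x h(1) p(5) by blast
        have "z1 (h \<theta>) = c + C1 * sec \<theta> ^ 2 * sg" using h(2)[OF x(3)] sg(1) by algebra
        then have "emb (Y u) + z1 (h \<theta>) *\<^sub>R emb (N u) = emb (Yc u) + (C1 * sec \<theta> ^ 2) *\<^sub>R emb (sg *\<^sub>R N u)"
          by (simp add: Yc_def emb_simps algebra_simps)
        then show "(?B \<circ> minimal_type_map C1 C2 Yc (\<lambda>u. sg *\<^sub>R N u)) x = F ((\<lambda>(u, \<theta>). (u, h \<theta>)) x)"
          using FX[OF inW] by (simp add: x minimal_type_map_def X_def h(3)[OF x(3)])
      qed
    qed
  qed
qed

text \<open>Either the parallel surface has zero differential on some open set, and then everywhere by
  unique continuation, or it is immersed on a dense set.\<close>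

lemma classification:
  assumes "W \<noteq> {}"
  shows "locally_minimal_type C1 C2 W F \<or> locally_sphere_type C1 C2 W F"
proof (cases "\<exists>S. open S \<and> S \<noteq> {} \<and> S \<subseteq> P \<and> S \<inter> immersed_part = {}")
  case True
  then obtain S where S: "open S" "S \<noteq> {}" "S \<subseteq> P" "S \<inter> immersed_part = {}" by blast
  have "dif Yc u v = 0" if "u \<in> S" for u v using S(3,4) that by (auto simp: immersed_part_def)
  then have "dif Yc u v = 0" if "u \<in> P" for u v
    using tracefree_surface_unique_continuation[OF Yc_tracefree P(2) S(1-3) _ that] by blast
  then show ?thesis using sphere_case[OF assms] by blast
next
  case False
  then show ?thesis using minimal_case by blast
qed

end

lemma (in zero_H2_hypersurface) classified:
  assumes "W \<noteq> {}"
  shows "\<exists>C1 C2. C1 > 0 \<and> (locally_minimal_type C1 C2 W F \<or> locally_sphere_type C1 C2 W F)"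
proof -
  obtain c where c: "\<And>u. u \<in> P \<Longrightarrow> mixed u = - (2 * c * detN u)"
    "\<And>w. w \<in> Q \<Longrightarrow> z2' w * ((z1' w)\<^sup>2 + (z2' w)\<^sup>2) = 2 * (z1 w - c) * bending w"
    using separated by metis
  have nz: "z2' w \<noteq> 0" if "w \<in> Q" for w using that nondegenerate(1) by (force simp: Q_def)
  obtain C C2 where C: "C \<noteq> 0" "\<And>w. w \<in> Q \<Longrightarrow> z1 w - c = C * (1 + ((z2 w - C2) / (2 * C))\<^sup>2)"
    using profile_parabola[OF Q(1,2) z(1)[OF subsetD[OF Q(3)]] z(2)[OF subsetD[OF Q(3)]] z(3)[OF subsetD[OF Q(3)]]
        z(4)[OF subsetD[OF Q(3)]] nz c(2)[unfolded bending_def]] by metis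
  interpret parabolic_hypersurface U Y N J z1 z2 z1' z2' z1'' z2'' W T t0 F \<eta> c C C2
    by unfold_locales (use c C in auto)
  show ?thesis using classification[OF assms] sg(2) by blast
qed

section \<open>The classification\<close>

lemma smooth_curve_component:
  fixes Z :: "real \<Rightarrow> real^2"
  assumes "smooth_on I Z" "w \<in> I"
  shows "((\<lambda>w. Z w $ i) has_real_derivative dif Z w 1 $ i) (at w)"
proof -
  have Z: "(Z has_derivative dif Z w) (at w)" using assms by (rule smooth_on_has_derivative)
  have "dif Z w h $ i = dif Z w 1 $ i * h" for h
    using linear_scale[OF has_derivative_linear[OF Z], of h 1] by simp
  then have "(\<lambda>h. dif Z w h $ i) = (*) (dif Z w 1 $ i)" by (rule ext)
  then show ?thesis
    using bounded_linear.has_derivative[OF bounded_linear_vec_nth Z, of i]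
    by (simp only: has_field_derivative_def)
qed

lemma rotated_translational_profile:
  assumes D: "open D" and rt: "rotated_translational_on D F"
  obtains U Y N J z1 z2 z1' z2' z1'' z2'' T t0 where
    "profile_over_surface U Y N J z1 z2 z1' z2' z1'' z2'' D T"
    "open J" "smooth_on J z2" "continuous_on J z1''" "continuous_on J z2''"
    "\<forall>p\<in>D. F p = profile_over_surface.X Y N z1 z2 T t0 p"
proof -
  obtain U :: "(real^2) set" and I :: "real set" and Y N :: "real^2 \<Rightarrow> real^3" and Z :: "real \<Rightarrow> real^2" and B
    where B: "rigid_motion B" and Y: "immersion_on U Y" "gauss_map_on U Y N"
    and Z: "immersion_on I Z" and sub: "D \<subseteq> U \<times> I"
    and reg: "\<forall>(u, w)\<in>D. \<forall>k. principal_curvatures_at Y N u k \<longrightarrow>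
            1 - Z w $ 1 * k 0 \<noteq> 0 \<and> 1 - Z w $ 1 * k 1 \<noteq> 0"
    and F: "\<forall>(u, w)\<in>D. F (u, w) = B (emb (Y u) + (Z w $ 1) *\<^sub>R emb (N u) + (Z w $ 2) *\<^sub>R e4)"
    using rt unfolding rotated_translational_on_def by blast
  obtain R t0 where R: "orthogonal_transformation R" "\<And>x. B x = t0 + R x"
    using B unfolding rigid_motion_def by metis
  have I: "open I" "smooth_on I Z" "\<And>w. w \<in> I \<Longrightarrow> inj (dif Z w)" using Z by (auto simp: immersion_on_def)
  have I': "smooth_on I (\<lambda>w. dif Z w 1)" "smooth_on I (\<lambda>w. dif (\<lambda>w. dif Z w 1) w 1)"
    using smooth_on_derivative I(2) by blast+
  interpret profile_over_surface U Y N I "\<lambda>w. Z w $ 1" "\<lambda>w. Z w $ 2" "\<lambda>w. dif Z w 1 $ 1" "\<lambda>w. dif Z w 1 $ 2"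
    "\<lambda>w. dif (\<lambda>w. dif Z w 1) w 1 $ 1" "\<lambda>w. dif (\<lambda>w. dif Z w 1) w 1 $ 2" D R t0
  proof
    show "open U" "smooth_on U Y" "\<And>u. u \<in> U \<Longrightarrow> inj (dif Y u)" using Y(1) by (auto simp: immersion_on_def)
    show "gauss_map_on U Y N" "open D" "D \<subseteq> U \<times> I" "orthogonal_transformation R" by fact+
    show "1 - Z w $ 1 * k 0 \<noteq> 0 \<and> 1 - Z w $ 1 * k 1 \<noteq> 0"
      if "(u, w) \<in> D" "principal_curvatures_at Y N u k" for u w k
      using reg that by blast
    fix w assume w: "w \<in> I"
    show "((\<lambda>w. Z w $ 1) has_real_derivative dif Z w 1 $ 1) (at w)" "((\<lambda>w. Z w $ 2) has_real_derivative dif Z w 1 $ 2) (at w)"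
      by (rule smooth_curve_component[OF I(2) w])+
    show "((\<lambda>w. dif Z w 1 $ 1) has_real_derivative dif (\<lambda>w. dif Z w 1) w 1 $ 1) (at w)"
      "((\<lambda>w. dif Z w 1 $ 2) has_real_derivative dif (\<lambda>w. dif Z w 1) w 1 $ 2) (at w)"
      by (rule smooth_curve_component[OF I'(1) w])+
    have "linear (dif Z w)" using I(2) w by (auto intro: has_derivative_linear smooth_on_has_derivative)
    then have "dif Z w 1 \<noteq> 0" using I(3)[OF w] linear_injective_0 by (metis zero_neq_one)
    then have "dif Z w 1 $ 1 \<noteq> 0 \<or> dif Z w 1 $ 2 \<noteq> 0" by (auto simp: vec_eq_iff forall_2)
    then show "(dif Z w 1 $ 1)\<^sup>2 + (dif Z w 1 $ 2)\<^sup>2 > 0" by (simp add: sum_power2_gt_zero_iff)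
  qed
  show ?thesis
  proof (rule that[OF profile_over_surface_axioms I(1)])
    show "smooth_on I (\<lambda>w. Z w $ 2)"
      by (rule smooth_on_bounded_linear_compose[OF I(1) bounded_linear_vec_nth I(2)])
    show "continuous_on I (\<lambda>w. dif (\<lambda>w. dif Z w 1) w 1 $ 1)" "continuous_on I (\<lambda>w. dif (\<lambda>w. dif Z w 1) w 1 $ 2)"
      by (intro continuous_intros smooth_on_imp_continuous_on I')+
    show "\<forall>p\<in>D. F p = X p" using F R(2) by (auto simp: X_def)
  qed
qed

theorem theorem6p2:
  fixes D :: "((real^2) \<times> real) set"
    and F :: "(real^2) \<times> real \<Rightarrow> real^4"
    and \<eta> :: "(real^2) \<times> real \<Rightarrow> real^4"
  assumes "open D" and "connected D"
    and "rotated_translational_on D F"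
    and "gauss_map_on D F \<eta>"
    and "\<forall>q\<in>D. r_mean_curvature 3 F \<eta> q \<noteq> 0"
  shows "(\<forall>q\<in>D. r_mean_curvature 2 F \<eta> q = 0) \<longleftrightarrow>
    (\<exists>C1 C2. C1 > 0 \<and> (locally_minimal_type C1 C2 D F \<or> locally_sphere_type C1 C2 D F))"
proof -
  obtain U Y N J z1 z2 z1' z2' z1'' z2'' T t0 where
    p: "profile_over_surface U Y N J z1 z2 z1' z2' z1'' z2'' D T"
    and J: "open J" "smooth_on J z2" "continuous_on J z1''" "continuous_on J z2''"
    and F: "\<forall>p\<in>D. F p = profile_over_surface.X Y N z1 z2 T t0 p"
    by (rule rotated_translational_profile[OF assms(1,3)])
  interpret nondegenerate_hypersurface U Y N J z1 z2 z1' z2' z1'' z2'' D T t0 F \<eta>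
    by (rule nondegenerate_hypersurface.intro[OF p], unfold_locales) (use J F assms in auto)
  show ?thesis
  proof
    assume zero: "\<forall>q\<in>D. r_mean_curvature 2 F \<eta> q = 0"
    show "\<exists>C1 C2. C1 > 0 \<and> (locally_minimal_type C1 C2 D F \<or> locally_sphere_type C1 C2 D F)"
    proof (cases "D = {}")
      \<comment> \<open>The empty hypersurface is of minimal type for any constants.\<close>
      case True
      have "rigid_motion (\<lambda>x::real^4. 0 + x)"
        unfolding rigid_motion_def using orthogonal_transformation_id by blast
      then have "locally_minimal_type 1 0 D F"
        unfolding locally_minimal_type_def True by blast
      then show ?thesis using zero_less_one by blast
    next
      case False
      interpret zero_H2_hypersurface U Y N J z1 z2 z1' z2' z1'' z2'' D T t0 F \<eta>
        by unfold_locales (use zero assms(2) in auto)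
      show ?thesis by (rule classified[OF False])
    qed
  qed (use models_have_zero_curvature in blast)
qed

end
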